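(* Let $W$ be a random variable with mean $a\in\mathbb{R}$ and variance $\sigma^2\in(0,\infty)$ and suppose that $\sigma^2>a^2$. Suppose that $W^A$ has the $W$-asymmetric equilibrium distribution. (i) The $\mathrm{AL}(0,a,\sqrt{\sigma^2-a^2})$ distribution is the unique fixed point of the asymmetric equilibrium transformation. (ii) There exists a unique distribution for $W^A$ such that the defining equation $$\frac{\sigma^2-a^2}{2}\mathbb{E}\big[f''(W^A)\big]=\mathbb{E}\big[f(W)-f(0)-af'(W)\big]$$ holds (for all $f$ in the class specified in the definition of the asymmetric equilibrium distribution). Moreover, the distribution of $W^A$ is absolutely continuous and its density is given, for $w\in\mathbb{R}$, by $$f_{W^A}(w)=\frac{2}{\sigma^2-a^2}\bigg[a\mathbb{P}(W\leq w)-\int_{0}^{1}\mathbb{E}[W\mathbb{I}(W\leq w/v)]\,\mathrm{d}v\bigg]=\frac{2}{\sigma^2-a^2}\bigg[\int_{0}^{1}\mathbb{E}[W\mathbb{I}(W> w/v)]\,\mathrm{d}v-a\mathbb{P}(W>w)\bigg].$$ (iii) Suppose that $\alpha=\inf\mathrm{support}(W)$ and $\beta=\sup\mathrm{support}(W)$ are finite. Then $\mathrm{support}(W^A)=[\alpha,\beta]$. A closed end point in the interval is replaced by an open end point if any of the values $\alpha$ or $\beta$ are infinite. In particular, if $|W|\leq C$ for some $C>0$, then $|W^A|\leq C$. (iv) For $c\in\mathbb{R}$, the random variable $cW^A$ has the $cW$-asymmetric equilibrium distribution. (v) For $r\geq0$, $$\mathbb{E}[(W^A)^r]=\frac{2\mathbb{E}[W^{r+2}]-2a(r+2)\mathbb{E}[W^{r+1}]}{(r+1)(r+2)(\sigma^2-a^2)},$$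 and $$\mathbb{E}[|W^A|^r]=\frac{2\mathbb{E}[|W|^{r+2}]-2a(r+2)\mathbb{E}[|W|^{r+1}\mathrm{sgn}(W)]}{(r+1)(r+2)(\sigma^2-a^2)},$$ where $\mathrm{sgn}(x)=-1$ for $x<0$, $\mathrm{sgn}(0)=0$ and $\mathrm{sgn}(x)=1$ for $x>0$. (vi) If $W$ has characteristic function $\phi_W(t)=\mathbb{E}[\mathrm{e}^{\mathrm{i}tW}]$, then $W^A$ has characteristic function $$\phi_{W^A}(t)=\frac{2(1+[a\mathrm{i}t-1]\phi_W(t))}{t^2(\sigma^2-a^2)}.$$
   Context: Asymmetric equilibrium distribution: let $W$ be a random variable with mean $a\in\mathbb{R}$ and variance $\sigma^2\in(0,\infty)$ and suppose that $\sigma^2>a^2$. A random variable $W^A$ is said to have the asymmetric equilibrium distribution with respect to $W$ (the $W$-asymmetric equilibrium distribution) if $$\frac{\sigma^2-a^2}{2}\mathbb{E}\big[f''(W^A)\big]=\mathbb{E}\big[f(W)-f(0)-af'(W)\big]$$ for all functions $f:\mathbb{R}\to\mathbb{R}$ for which $f$ and $f'$ are locally absolutely continuous with $\mathbb{E}|f(W)|,\mathbb{E}|f'(W)|<\infty$. The map $W\to W^A$ is called the asymmetric equilibrium transformation. For $a\in\mathbb{R}$, $b>0$, $\mathrm{AL}(0,a,b)$ is the asymmetric Laplace distribution, with characteristic function $\dfrac{1}{1+b^2t^2/2-\mathrm{i}at}$, $t\in\mathbb{R}$, equivalently with density $\dfrac{1}{\sqrt{2b^2+a^2}}\exp\big(\frac{a}{b^2}x-\frac{1}{b}\sqrt{2+\frac{a^2}{b^2}}\,|x|\big)$,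 $x\in\mathbb{R}$. $\mathbb{I}$ denotes the indicator function.
   Formalization: (iii) fails for infinite end points with a≠0; there support(W^A) equals the interval iff the density vanishes on no open subinterval. E|f''(W^A)|<∞ is required of f; existence in (ii) rests on the assumed W^A; first formula of (v) for integer r, finite moments in (v); t≠0 in (vi). *)

theory Defs
  imports "HOL-Probability.Probability"
begin

definition abs_cont_on :: "real \<Rightarrow> real \<Rightarrow> (real \<Rightarrow> real) \<Rightarrow> bool" where
  "abs_cont_on x y f \<longleftrightarrow>
     (\<forall>\<epsilon>>0. \<exists>\<delta>>0. \<forall>(n::nat) l u.
        (\<forall>i<n. x \<le> l i \<and> l i \<le> u i \<and> u i \<le> y) \<and>
        disjoint_family_on (\<lambda>i. {l i<..<u i}) {..<n} \<and>
        (\<Sum>i<n. u i - l i) < \<delta> \<longrightarrow>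
        (\<Sum>i<n. \<bar>f (u i) - f (l i)\<bar>) < \<epsilon>)"

definition locally_abs_cont :: "(real \<Rightarrow> real) \<Rightarrow> bool" where
  "locally_abs_cont f \<longleftrightarrow> (\<forall>x y. abs_cont_on x y f)"

definition has_mean_variance :: "'a measure \<Rightarrow> ('a \<Rightarrow> real) \<Rightarrow> real \<Rightarrow> real \<Rightarrow> bool" where
  "has_mean_variance M W m v \<longleftrightarrow>
     integrable M W \<and> integrable M (\<lambda>x. (W x)\<^sup>2) \<and>
     prob_space.expectation M W = m \<and> prob_space.variance M W = v"

(* X, a random variable on N, has the asymmetric equilibrium distribution with respect to the
   random variable W on M.  As f' is required to be locally absolutely continuous it is defined
   everywhere, so f is differentiable, whereas f'' exists only almost everywhere (deriv is an
   unspecified constant elsewhere).  Integrability of f''(X) is required for the left-hand side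
   to be meaningful; it does not follow from that of f(W) and f'(W).
   Nothing is assumed here about the mean and variance of W; for a constant variable W = 0 the
   equation degenerates to 0 = 0. *)
definition asym_equilibrium ::
    "'a measure \<Rightarrow> ('a \<Rightarrow> real) \<Rightarrow> 'b measure \<Rightarrow> ('b \<Rightarrow> real) \<Rightarrow> bool" where
  "asym_equilibrium M W N X \<longleftrightarrow>
     prob_space N \<and> X \<in> borel_measurable N \<and>
     (\<forall>f. (\<forall>x. f differentiable (at x)) \<longrightarrow>
          locally_abs_cont f \<longrightarrow> locally_abs_cont (deriv f) \<longrightarrow>
          integrable M (\<lambda>x. f (W x)) \<longrightarrow> integrable M (\<lambda>x. deriv f (W x)) \<longrightarrow>
          integrable N (\<lambda>y. deriv (deriv f) (X y)) \<longrightarrow>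
          (prob_space.variance M W - (prob_space.expectation M W)\<^sup>2) / 2 *
              prob_space.expectation N (\<lambda>y. deriv (deriv f) (X y)) =
            prob_space.expectation M
              (\<lambda>x. f (W x) - f 0 - prob_space.expectation M W * deriv f (W x)))"

(* AL(0, a, b): location 0. *)
definition asym_laplace :: "real \<Rightarrow> real \<Rightarrow> real measure" where
  "asym_laplace a b = density lborel (\<lambda>x. ennreal
     (1 / sqrt (2 * b\<^sup>2 + a\<^sup>2) * exp (a / b\<^sup>2 * x - 1 / b * sqrt (2 + a\<^sup>2 / b\<^sup>2) * \<bar>x\<bar>)))"

definition rv_support :: "'a measure \<Rightarrow> ('a \<Rightarrow> real) \<Rightarrow> real set" where
  "rv_support M W = {x. \<forall>U. open U \<and> x \<in> U \<longrightarrow> 0 < measure M (W -` U \<inter> space M)}"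

definition support_inf :: "'a measure \<Rightarrow> ('a \<Rightarrow> real) \<Rightarrow> ereal" where
  "support_inf M W = (INF x\<in>rv_support M W. ereal x)"

definition support_sup :: "'a measure \<Rightarrow> ('a \<Rightarrow> real) \<Rightarrow> ereal" where
  "support_sup M W = (SUP x\<in>rv_support M W. ereal x)"

(* The real points between the two extended-real end points: an end point belongs to the
   interval exactly when it is finite. *)
definition support_hull :: "'a measure \<Rightarrow> ('a \<Rightarrow> real) \<Rightarrow> real set" where
  "support_hull M W = {x. support_inf M W \<le> ereal x \<and> ereal x \<le> support_sup M W}"

end

theory Submission
  imports Defs
begin

text \<open>
Let \<open>q w = a * P(W \<le> w) + E (w - W)\<^sup>+ - w\<^sup>+\<close>, called
\<open>raw_density\<close> below. Writing a test function through its second derivative (Taylor's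
formula with integral remainder) and exchanging integrals gives, whenever \<open>E W = a\<close>,

  \<open>E (f W - f 0 - a * f' W) = (integral of f'' w * q w over w)\<close>

(\<open>integral_kernel\<close>, \<open>integral_raw_density\<close>). So the defining equation says
that \<open>W\<^sup>A\<close> has the density \<open>p = 2 / (\<sigma>\<^sup>2 - a\<^sup>2) * q\<close>.
Continuous ramps as second derivatives identify the distribution function
(\<open>distribution_function\<close>), and the right continuity of \<open>q\<close> yields \<open>p
\<ge> 0\<close> everywhere (\<open>raw_density_nonneg\<close>): not every \<open>W\<close> has an
equilibrium variable, and its existence constrains \<open>W\<close>. Uniqueness, the density formulas,
the moments and the characteristic function follow by choosing \<open>f\<close>.

The support is the closure of \<open>{q \<noteq> 0}\<close>. Two forms of \<open>q\<close>, one with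
lower and one with upper tails of \<open>W\<close>, show that \<open>q\<close> vanishes outside the hull
of the support of \<open>W\<close> and is positive inside it on the side of the origin where the sign of
\<open>a\<close> helps. If the support of \<open>W\<close> is bounded, nonnegativity of \<open>q\<close>
near its end points forces \<open>a = 0\<close>, so that both sides are covered
(\<open>bounded_support_imp_centered\<close>).

A fixed point has a characteristic function that solves a linear equation, so there is at most one. That
the asymmetric Laplace distribution is a fixed point must be checked for every test function in the
class, so for \<open>f'\<close> that are merely locally absolutely continuous. There, and for the
scaling property, one needs Lebesgue's theorem: an absolutely continuous function is almost everywhere
differentiable and is the integral of its derivative (\<open>abs_cont_FTC\<close>). It is derived from
the total variation, the Radon-Nikodym theorem, and the Lebesgue differentiation theorem, which in turn
rests on the Vitali covering theorem. The Laplace case is then integration by parts on the two half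
lines (\<open>half_line_by_parts\<close>, \<open>fixed_point_AL\<close>).
\<close>

section \<open>Absolutely continuous functions\<close>

text \<open>The index type is arbitrary so that families can be concatenated, and intervals may degenerate to points
so that cutting an interval at a point outside it needs no change of the index set.\<close>

definition interval_family :: "real \<Rightarrow> real \<Rightarrow> 'i set \<Rightarrow> ('i \<Rightarrow> real) \<Rightarrow> ('i \<Rightarrow> real) \<Rightarrow> bool" where
  "interval_family x y I l u \<longleftrightarrow> finite I \<and> (\<forall>i\<in>I. x \<le> l i \<and> l i \<le> u i \<and> u i \<le> y) \<and>
     disjoint_family_on (\<lambda>i. {l i<..<u i}) I"

text \<open>Absolute continuity is stated for families indexed by an initial segment of the naturals. Index sets of
other types arise when families are concatenated (pairs) or come from a covering theorem (sets of
reals); an enumeration of the index set reduces these to the definition.\<close>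

lemma abs_cont_on_familyD:
  fixes f :: "real \<Rightarrow> real"
  assumes "abs_cont_on x y f" "0 < e"
  obtains d where "0 < d"
    "\<And>(I :: 'i set) l u. interval_family x y I l u \<Longrightarrow> (\<Sum>i\<in>I. u i - l i) < d \<Longrightarrow>
       (\<Sum>i\<in>I. \<bar>f (u i) - f (l i)\<bar>) < e"
proof -
  obtain d where d: "d > 0" and D: "\<And>(n::nat) l u. (\<forall>i<n. x \<le> l i \<and> l i \<le> u i \<and> u i \<le> y) \<Longrightarrow>
        disjoint_family_on (\<lambda>i. {l i<..<u i}) {..<n} \<Longrightarrow>
        (\<Sum>i<n. u i - l i) < d \<Longrightarrow> (\<Sum>i<n. \<bar>f (u i) - f (l i)\<bar>) < e"
    using assms unfolding abs_cont_on_def by meson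
  have "(\<Sum>i\<in>I. \<bar>f (u i) - f (l i)\<bar>) < e"
    if fam: "interval_family x y I l u" and len: "(\<Sum>i\<in>I. u i - l i) < d" for I :: "'i set" and l u
  proof -
    have "finite I" using fam by (simp add: interval_family_def)
    then obtain b where b: "bij_betw b {..<card I} I"
      using ex_bij_betw_nat_finite[of I] by (auto simp: atLeast0LessThan)
    have mem: "b i \<in> I" if "i < card I" for i using b that by (auto simp: bij_betw_def)
    have "disjoint_family_on (\<lambda>i. {l (b i)<..<u (b i)}) {..<card I}"
      using fam b unfolding interval_family_def disjoint_family_on_def bij_betw_def inj_on_def
      by blast
    moreover have "\<forall>i<card I. x \<le> l (b i) \<and> l (b i) \<le> u (b i) \<and> u (b i) \<le> y"
      using fam mem by (auto simp: interval_family_def)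
    moreover have "(\<Sum>i<card I. u (b i) - l (b i)) < d"
      using len by (subst sum.reindex_bij_betw[OF b, of "\<lambda>i. u i - l i"])
    ultimately have "(\<Sum>i<card I. \<bar>f (u (b i)) - f (l (b i))\<bar>) < e"
      by (intro D)
    then show ?thesis
      by (subst (asm) sum.reindex_bij_betw[OF b, of "\<lambda>i. \<bar>f (u i) - f (l i)\<bar>"])
  qed
  with d that show ?thesis by blast
qed

lemma abs_cont_onI:
  assumes "\<And>e. 0 < e \<Longrightarrow> \<exists>d>0. \<forall>(I :: nat set) l u. interval_family x y I l u \<longrightarrow>
    (\<Sum>i\<in>I. u i - l i) < d \<longrightarrow> (\<Sum>i\<in>I. \<bar>f (u i) - f (l i)\<bar>) < e"
  shows "abs_cont_on x y f"
  unfolding abs_cont_on_def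
proof (intro allI impI)
  fix e :: real assume "0 < e"
  from assms[OF this] obtain d where d: "0 < d" "\<And>(I :: nat set) l u. interval_family x y I l u \<Longrightarrow>
    (\<Sum>i\<in>I. u i - l i) < d \<Longrightarrow> (\<Sum>i\<in>I. \<bar>f (u i) - f (l i)\<bar>) < e" by blast
  have "(\<Sum>i<n. \<bar>f (u i) - f (l i)\<bar>) < e"
    if "(\<forall>i<n. x \<le> l i \<and> l i \<le> u i \<and> u i \<le> y) \<and> disjoint_family_on (\<lambda>i. {l i<..<u i}) {..<n} \<and>
      (\<Sum>i<n. u i - l i) < d" for n :: nat and l u
    using that by (intro d(2)) (auto simp: interval_family_def)
  with d(1) show "\<exists>\<delta>>0. \<forall>(n::nat) l u. (\<forall>i<n. x \<le> l i \<and> l i \<le> u i \<and> u i \<le> y) \<and>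
      disjoint_family_on (\<lambda>i. {l i<..<u i}) {..<n} \<and> (\<Sum>i<n. u i - l i) < \<delta> \<longrightarrow>
      (\<Sum>i<n. \<bar>f (u i) - f (l i)\<bar>) < e" by blast
qed

text \<open>The open intervals are disjoint subsets of \<open>{x..y}\<close>, so additivity of Lebesgue measure
bounds their total length.\<close>

lemma interval_family_length_le:
  assumes "interval_family x y I l u" "x \<le> y"
  shows "(\<Sum>i\<in>I. u i - l i) \<le> y - x"
proof -
  have I: "finite I" "\<And>i. i \<in> I \<Longrightarrow> x \<le> l i \<and> l i \<le> u i \<and> u i \<le> y"
    "disjoint_family_on (\<lambda>i. {l i<..<u i}) I" using assms by (auto simp: interval_family_def)
  have "(\<Sum>i\<in>I. u i - l i) = (\<Sum>i\<in>I. measure lborel {l i<..<u i})"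
    using I by (intro sum.cong) auto
  also have "\<dots> = measure lborel (\<Union>i\<in>I. {l i<..<u i})"
    using I by (intro measure_finite_Union[symmetric]) auto
  also have "\<dots> \<le> measure lborel {x..y}"
    using I by (intro measure_mono_fmeasurable fmeasurable_cbox[of x y, simplified]) fastforce+
  finally show ?thesis using assms by simp
qed

lemma abs_cont_on_continuous:
  assumes "abs_cont_on x y f"
  shows "continuous_on {x..y} f"
proof (rule continuous_on_iff[THEN iffD2], intro ballI allI impI)
  fix s e :: real assume s: "s \<in> {x..y}" "0 < e"
  obtain d where d: "0 < d" "\<And>(I :: unit set) l u. interval_family x y I l u \<Longrightarrow> (\<Sum>i\<in>I. u i - l i) < d \<Longrightarrow>
       (\<Sum>i\<in>I. \<bar>f (u i) - f (l i)\<bar>) < e"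
    using abs_cont_on_familyD[OF assms s(2)] by metis
  show "\<exists>d>0. \<forall>x'\<in>{x..y}. dist x' s < d \<longrightarrow> dist (f x') (f s) < e"
  proof (intro exI[of _ d] conjI ballI impI)
    fix t assume t: "t \<in> {x..y}" "dist t s < d"
    have "(\<Sum>i\<in>{()}. \<bar>f (max s t) - f (min s t)\<bar>) < e"
      using t s by (intro d(2)[of "{()}" "\<lambda>_. min s t" "\<lambda>_. max s t"])
        (auto simp: interval_family_def dist_real_def disjoint_family_on_def max_def min_def)
    then show "dist (f t) (f s) < e" by (auto simp: dist_real_def max_def min_def split: if_splits)
  qed (use d in auto)
qed

text \<open>All closure properties used below follow from this one: an increment of \<open>h\<close> is controlled
by increments of two absolutely continuous functions. For a product, \<open>f t * g t - f s * g s = g t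
* (f t - f s) + f s * (g t - g s)\<close>, and both factors are bounded on a compact interval.\<close>

lemma abs_cont_on_dominated:
  assumes f: "abs_cont_on x y f" and g: "abs_cont_on x y g" and A: "0 \<le> A" and B: "0 \<le> B"
    and bd: "\<And>s t. x \<le> s \<Longrightarrow> s \<le> t \<Longrightarrow> t \<le> y \<Longrightarrow> \<bar>h t - h s\<bar> \<le> A * \<bar>f t - f s\<bar> + B * \<bar>g t - g s\<bar>"
  shows "abs_cont_on x y h"
proof (rule abs_cont_onI)
  fix e :: real assume e: "0 < e"
  \<comment> \<open>chosen so that \<open>(A + B) * e' < e\<close>, also when \<open>A + B = 0\<close>\<close>
  define e' where "e' = e / (2 * (A + B + 1))"
  have e': "0 < e'" using e A B by (simp add: e'_def)
  obtain d1 where d1: "0 < d1" "\<And>(I :: nat set) l u. interval_family x y I l u \<Longrightarrow> (\<Sum>i\<in>I. u i - l i) < d1 \<Longrightarrow>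
       (\<Sum>i\<in>I. \<bar>f (u i) - f (l i)\<bar>) < e'"
    using abs_cont_on_familyD[OF f e'] by metis
  obtain d2 where d2: "0 < d2" "\<And>(I :: nat set) l u. interval_family x y I l u \<Longrightarrow> (\<Sum>i\<in>I. u i - l i) < d2 \<Longrightarrow>
       (\<Sum>i\<in>I. \<bar>g (u i) - g (l i)\<bar>) < e'"
    using abs_cont_on_familyD[OF g e'] by metis
  have "(\<Sum>i\<in>I. \<bar>h (u i) - h (l i)\<bar>) < e"
    if fam: "interval_family x y I l u" and len: "(\<Sum>i\<in>I. u i - l i) < min d1 d2" for I :: "nat set" and l u
  proof -
    have "(\<Sum>i\<in>I. \<bar>h (u i) - h (l i)\<bar>) \<le> (\<Sum>i\<in>I. A * \<bar>f (u i) - f (l i)\<bar> + B * \<bar>g (u i) - g (l i)\<bar>)"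
      using fam by (intro sum_mono bd) (auto simp: interval_family_def)
    also have "\<dots> = A * (\<Sum>i\<in>I. \<bar>f (u i) - f (l i)\<bar>) + B * (\<Sum>i\<in>I. \<bar>g (u i) - g (l i)\<bar>)"
      by (simp add: sum.distrib sum_distrib_left)
    also have "\<dots> \<le> A * e' + B * e'"
      using d1(2)[OF fam] d2(2)[OF fam] len A B by (intro add_mono mult_left_mono) auto
    also have "\<dots> = (A + B) / (2 * (A + B + 1)) * e"
      by (simp add: e'_def add_divide_distrib distrib_right)
    also have "\<dots> < 1 * e" using e A B by (intro mult_strict_right_mono) (auto simp: field_simps)
    finally show ?thesis by simp
  qed
  then show "\<exists>d>0. \<forall>(I :: nat set) l u. interval_family x y I l u \<longrightarrow>
      (\<Sum>i\<in>I. u i - l i) < d \<longrightarrow> (\<Sum>i\<in>I. \<bar>h (u i) - h (l i)\<bar>) < e"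
    using d1(1) d2(1) by (intro exI[of _ "min d1 d2"]) auto
qed

lemma abs_cont_on_ident: "abs_cont_on x y (\<lambda>t. t)"
proof (rule abs_cont_onI)
  fix e :: real assume e: "0 < e"
  have "(\<Sum>i\<in>I. \<bar>u i - l i\<bar>) < e" if "interval_family x y I l u" "(\<Sum>i\<in>I. u i - l i) < e"
    for I :: "nat set" and l u
  proof -
    have "(\<Sum>i\<in>I. \<bar>u i - l i\<bar>) = (\<Sum>i\<in>I. u i - l i)"
      using that(1) by (intro sum.cong) (auto simp: interval_family_def)
    with that(2) show ?thesis by simp
  qed
  with e show "\<exists>d>0. \<forall>(I :: nat set) l u. interval_family x y I l u \<longrightarrow>
      (\<Sum>i\<in>I. u i - l i) < d \<longrightarrow> (\<Sum>i\<in>I. \<bar>u i - l i\<bar>) < e" by blast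
qed

lemma abs_cont_on_lipschitz:
  fixes h :: "real \<Rightarrow> real"
  assumes "0 \<le> L" "\<And>s t. x \<le> s \<Longrightarrow> s \<le> t \<Longrightarrow> t \<le> y \<Longrightarrow> \<bar>h t - h s\<bar> \<le> L * \<bar>t - s\<bar>"
  shows "abs_cont_on x y h"
  by (rule abs_cont_on_dominated[OF abs_cont_on_ident abs_cont_on_ident assms(1) order_refl])
    (metis assms(2) add.right_neutral mult_zero_left)

lemma abs_cont_on_diff:
  assumes "abs_cont_on x y f" "abs_cont_on x y g"
  shows "abs_cont_on x y (\<lambda>t. f t - g t)"
  by (rule abs_cont_on_dominated[OF assms, of 1 1]) auto

lemma abs_cont_on_mult:
  assumes f: "abs_cont_on x y f" and g: "abs_cont_on x y g"
  shows "abs_cont_on x y (\<lambda>t. f t * g t)"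
proof -
  have "bounded (f ` {x..y})" "bounded (g ` {x..y})"
    using assms by (auto intro!: compact_imp_bounded compact_continuous_image abs_cont_on_continuous)
  then obtain A B where "\<forall>t\<in>{x..y}. \<bar>f t\<bar> \<le> A" "\<forall>t\<in>{x..y}. \<bar>g t\<bar> \<le> B"
    unfolding bounded_iff ball_simps real_norm_def by blast
  then have AB: "\<bar>f t\<bar> \<le> \<bar>A\<bar>" "\<bar>g t\<bar> \<le> \<bar>B\<bar>" if "x \<le> t" "t \<le> y" for t
    using that by (smt (verit) atLeastAtMost_iff)+
  show ?thesis
  proof (rule abs_cont_on_dominated[OF f g])
    fix s t assume st: "x \<le> s" "s \<le> t" "t \<le> y"
    have "f t * g t - f s * g s = g t * (f t - f s) + f s * (g t - g s)" by algebra
    also have "\<bar>\<dots>\<bar> \<le> \<bar>g t\<bar> * \<bar>f t - f s\<bar> + \<bar>f s\<bar> * \<bar>g t - g s\<bar>"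
      by (metis abs_mult abs_triangle_ineq)
    also have "\<dots> \<le> \<bar>B\<bar> * \<bar>f t - f s\<bar> + \<bar>A\<bar> * \<bar>g t - g s\<bar>"
      using AB st by (intro add_mono mult_right_mono) auto
    finally show "\<bar>f t * g t - f s * g s\<bar> \<le> \<bar>B\<bar> * \<bar>f t - f s\<bar> + \<bar>A\<bar> * \<bar>g t - g s\<bar>" .
  qed auto
qed

text \<open>By the mean value theorem such a function is Lipschitz on compact intervals, with the maximum of the
derivative as constant.\<close>

lemma locally_abs_cont_C1:
  assumes "\<And>t. (f has_real_derivative f' t) (at t)" "continuous_on UNIV f'"
  shows "locally_abs_cont f"
  unfolding locally_abs_cont_def
proof (intro allI)
  fix x y
  have "bounded (f' ` {x..y})"
    using assms by (auto intro!: compact_imp_bounded compact_continuous_image intro: continuous_on_subset)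
  then obtain B where "\<forall>t\<in>{x..y}. \<bar>f' t\<bar> \<le> B"
    unfolding bounded_iff ball_simps real_norm_def by blast
  then have B: "\<bar>f' t\<bar> \<le> \<bar>B\<bar>" if "x \<le> t" "t \<le> y" for t
    using that by (smt (verit) atLeastAtMost_iff)
  show "abs_cont_on x y f"
  proof (rule abs_cont_on_lipschitz)
    fix s t assume st: "x \<le> s" "s \<le> t" "t \<le> y"
    show "\<bar>f t - f s\<bar> \<le> \<bar>B\<bar> * \<bar>t - s\<bar>"
    proof (cases "s = t")
      case False
      then obtain z where z: "s < z" "z < t" "f t - f s = (t - s) * f' z"
        using MVT2[of s t f f'] assms st by auto
      then have "\<bar>f t - f s\<bar> = \<bar>t - s\<bar> * \<bar>f' z\<bar>" by (simp add: abs_mult)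
      also have "\<dots> \<le> \<bar>t - s\<bar> * \<bar>B\<bar>" using B[of z] z st by (intro mult_left_mono) auto
      finally show ?thesis by (simp add: mult.commute)
    qed simp
  qed simp
qed

text \<open>For negative \<open>c\<close> the end points of every interval change roles, hence the minima and
maxima; for \<open>c = 0\<close> all intervals are empty.\<close>

lemma interval_family_scale:
  assumes "interval_family x y I l u"
  shows "interval_family (min (c * x) (c * y)) (max (c * x) (c * y)) I
     (\<lambda>i. min (c * l i) (c * u i)) (\<lambda>i. max (c * l i) (c * u i))"
proof -
  have I: "finite I" "\<And>i. i \<in> I \<Longrightarrow> x \<le> l i \<and> l i \<le> u i \<and> u i \<le> y"
    "disjoint_family_on (\<lambda>i. {l i<..<u i}) I" using assms by (auto simp: interval_family_def)
  have sub: "{min (c * l i) (c * u i)<..<max (c * l i) (c * u i)} \<subseteq> (\<lambda>z. c * z) ` {l i<..<u i}"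
    if "i \<in> I" for i
  proof
    fix z assume z: "z \<in> {min (c * l i) (c * u i)<..<max (c * l i) (c * u i)}"
    then have c: "c \<noteq> 0" by auto
    have "l i < z / c \<and> z / c < u i"
      using z I(2)[OF that] c by (cases "c > 0") (auto simp: field_simps min_def max_def split: if_splits)
    then show "z \<in> (\<lambda>z. c * z) ` {l i<..<u i}" using c by (intro image_eqI[of _ _ "z / c"]) auto
  qed
  have "disjoint_family_on (\<lambda>i. {min (c * l i) (c * u i)<..<max (c * l i) (c * u i)}) I"
    unfolding disjoint_family_on_def
  proof (intro ballI impI)
    fix i j assume ij: "i \<in> I" "j \<in> I" "i \<noteq> j"
    show "{min (c * l i) (c * u i)<..<max (c * l i) (c * u i)} \<inter>
      {min (c * l j) (c * u j)<..<max (c * l j) (c * u j)} = {}"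
    proof (cases "c = 0")
      case False
      then have "(\<lambda>z. c * z) ` {l i<..<u i} \<inter> (\<lambda>z. c * z) ` {l j<..<u j} = {}"
        using I(3) ij False unfolding disjoint_family_on_def by (simp add: image_Int[symmetric] inj_on_def)
      then show ?thesis using sub[OF ij(1)] sub[OF ij(2)] by blast
    qed auto
  qed
  moreover have "min (c * x) (c * y) \<le> c * t \<and> c * t \<le> max (c * x) (c * y)" if "x \<le> t" "t \<le> y" for t
    using that by (cases "c \<ge> 0") (auto simp: min_le_iff_disj le_max_iff_disj intro: mult_left_mono mult_left_mono_neg)
  then have "min (c * x) (c * y) \<le> min (c * l i) (c * u i)"
    "max (c * l i) (c * u i) \<le> max (c * x) (c * y)" if "i \<in> I" for i
    using I(2)[OF that] by (meson order_trans min.boundedI max.boundedI)+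
  moreover have "min (c * l i) (c * u i) \<le> max (c * l i) (c * u i)" for i by simp
  ultimately show ?thesis
    using I(1) unfolding interval_family_def by blast
qed

lemma locally_abs_cont_scale:
  assumes "locally_abs_cont f"
  shows "locally_abs_cont (\<lambda>t. f (c * t))"
  unfolding locally_abs_cont_def
proof (intro allI abs_cont_onI)
  fix x y e :: real assume e: "0 < e"
  let ?x = "min (c * x) (c * y)" and ?y = "max (c * x) (c * y)"
  obtain d where d: "0 < d" "\<And>(I :: nat set) l u. interval_family ?x ?y I l u \<Longrightarrow> (\<Sum>i\<in>I. u i - l i) < d \<Longrightarrow>
       (\<Sum>i\<in>I. \<bar>f (u i) - f (l i)\<bar>) < e"
    using abs_cont_on_familyD[OF assms[unfolded locally_abs_cont_def, rule_format] e] by metis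
  have "(\<Sum>i\<in>I. \<bar>f (c * u i) - f (c * l i)\<bar>) < e"
    if fam: "interval_family x y I l u" and len: "(\<Sum>i\<in>I. u i - l i) < d / (\<bar>c\<bar> + 1)" for I :: "nat set" and l u
  proof -
    have le: "l i \<le> u i" if "i \<in> I" for i using fam that by (auto simp: interval_family_def)
    have pos: "0 \<le> (\<Sum>i\<in>I. u i - l i)" using le by (intro sum_nonneg) auto
    have "(\<Sum>i\<in>I. max (c * l i) (c * u i) - min (c * l i) (c * u i)) = (\<Sum>i\<in>I. \<bar>c\<bar> * (u i - l i))"
    proof (intro sum.cong refl)
      fix i assume "i \<in> I"
      then have "\<bar>c * u i - c * l i\<bar> = \<bar>c\<bar> * (u i - l i)"
        using le[of i] by (simp flip: right_diff_distrib add: abs_mult)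
      then show "max (c * l i) (c * u i) - min (c * l i) (c * u i) = \<bar>c\<bar> * (u i - l i)"
        by (auto simp: max_def min_def)
    qed
    also have "\<dots> \<le> (\<bar>c\<bar> + 1) * (\<Sum>i\<in>I. u i - l i)"
      using pos unfolding sum_distrib_left[symmetric] by (intro mult_right_mono) auto
    also have "\<dots> < d" using len by (simp add: field_simps)
    finally have "(\<Sum>i\<in>I. \<bar>f (max (c * l i) (c * u i)) - f (min (c * l i) (c * u i))\<bar>) < e"
      by (intro d(2) interval_family_scale fam)
    also have "(\<Sum>i\<in>I. \<bar>f (max (c * l i) (c * u i)) - f (min (c * l i) (c * u i))\<bar>) =
        (\<Sum>i\<in>I. \<bar>f (c * u i) - f (c * l i)\<bar>)"
      by (intro sum.cong) (auto simp: max_def min_def)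
    finally show ?thesis .
  qed
  then show "\<exists>d>0. \<forall>(I :: nat set) l u. interval_family x y I l u \<longrightarrow>
      (\<Sum>i\<in>I. u i - l i) < d \<longrightarrow> (\<Sum>i\<in>I. \<bar>f (c * u i) - f (c * l i)\<bar>) < e"
    using d(1) by (intro exI[of _ "d / (\<bar>c\<bar> + 1)"]) auto
qed

section \<open>Total variation\<close>

text \<open>The total variation decomposes an absolutely continuous function into increasing absolutely continuous
parts, which are the distribution functions of measures. Families instead of partitions are used so that
the definition of absolute continuity applies to the sums directly.\<close>

definition variation_sums :: "(real \<Rightarrow> real) \<Rightarrow> real \<Rightarrow> real \<Rightarrow> real set" where
  "variation_sums h x y =
     {\<Sum>i\<in>I. \<bar>h (u i) - h (l i)\<bar> | (I :: nat set) l u. interval_family x y I l u}"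

definition variation :: "(real \<Rightarrow> real) \<Rightarrow> real \<Rightarrow> real \<Rightarrow> real" where
  "variation h x y = Sup (variation_sums h x y)"

lemma variation_sums_nonempty: "0 \<in> variation_sums h x y"
  unfolding variation_sums_def
  by (rule CollectI, rule exI[of _ "{}"]) (auto simp: interval_family_def disjoint_family_on_def)

text \<open>Cut every interval at \<open>z\<close> by replacing its end points with their minima and maxima with
\<open>z\<close>. The index set stays the same: an interval on one side of \<open>z\<close> has a
degenerate, hence harmless, counterpart on the other.\<close>

lemma variation_sums_split:
  assumes "s \<in> variation_sums h x y" "x \<le> z" "z \<le> y"
  obtains s1 s2 where "s1 \<in> variation_sums h x z" "s2 \<in> variation_sums h z y" "s \<le> s1 + s2"
proof -
  obtain I :: "nat set" and l u where fam: "interval_family x y I l u"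
    and s: "s = (\<Sum>i\<in>I. \<bar>h (u i) - h (l i)\<bar>)"
    using assms(1) by (auto simp: variation_sums_def)
  define l1 u1 l2 u2 where "l1 i = min (l i) z" and "u1 i = min (u i) z" and
    "l2 i = max (l i) z" and "u2 i = max (u i) z" for i
  have disj: "disjoint_family_on (\<lambda>i. {l1 i<..<u1 i}) I" "disjoint_family_on (\<lambda>i. {l2 i<..<u2 i}) I"
  proof -
    have "{l1 i<..<u1 i} \<subseteq> {l i<..<u i}" "{l2 i<..<u2 i} \<subseteq> {l i<..<u i}" for i
      by (auto simp: l1_def u1_def l2_def u2_def)
    with fam show "disjoint_family_on (\<lambda>i. {l1 i<..<u1 i}) I" "disjoint_family_on (\<lambda>i. {l2 i<..<u2 i}) I"
      unfolding interval_family_def disjoint_family_on_def by blast+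
  qed
  have f1: "interval_family x z I l1 u1" and f2: "interval_family z y I l2 u2"
    using fam assms(2,3) disj unfolding interval_family_def l1_def u1_def l2_def u2_def
    by (auto simp: min_def max_def)
  have "\<bar>h (u i) - h (l i)\<bar> \<le> \<bar>h (u1 i) - h (l1 i)\<bar> + \<bar>h (u2 i) - h (l2 i)\<bar>" if "i \<in> I" for i
    using fam that unfolding interval_family_def l1_def u1_def l2_def u2_def by (auto simp: min_def max_def)
  then have "s \<le> (\<Sum>i\<in>I. \<bar>h (u1 i) - h (l1 i)\<bar>) + (\<Sum>i\<in>I. \<bar>h (u2 i) - h (l2 i)\<bar>)"
    unfolding s sum.distrib[symmetric] by (intro sum_mono)
  then show ?thesis using f1 f2 by (intro that) (auto simp: variation_sums_def)
qed

text \<open>On intervals shorter than the \<open>d\<close> that belongs to \<open>1\<close> all sums are at most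
\<open>1\<close>, and the splitting lemma passes boundedness from adjacent intervals to their union;
bisection does the rest.\<close>

lemma bdd_above_variation_sums:
  assumes ac: "abs_cont_on x y h" and "x \<le> s" "s \<le> t" "t \<le> y"
  shows "bdd_above (variation_sums h s t)"
proof -
  obtain d where d: "0 < d" "\<And>(I :: nat set) l u. interval_family x y I l u \<Longrightarrow> (\<Sum>i\<in>I. u i - l i) < d \<Longrightarrow>
       (\<Sum>i\<in>I. \<bar>h (u i) - h (l i)\<bar>) < 1"
    using abs_cont_on_familyD[OF ac zero_less_one] by metis
  have "x \<le> s \<and> t \<le> y \<longrightarrow> bdd_above (variation_sums h s t)"
    using \<open>s \<le> t\<close>
  proof (induction rule: Bolzano)
    case (trans a b c)
    show ?case
    proof
      assume ac: "x \<le> a \<and> c \<le> y"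
      with trans obtain B1 B2 where B: "\<And>s. s \<in> variation_sums h a b \<Longrightarrow> s \<le> B1"
        "\<And>s. s \<in> variation_sums h b c \<Longrightarrow> s \<le> B2" by (fastforce simp: bdd_above_def)
      show "bdd_above (variation_sums h a c)"
      proof (rule bdd_aboveI)
        fix s assume "s \<in> variation_sums h a c"
        then obtain s1 s2 where "s1 \<in> variation_sums h a b" "s2 \<in> variation_sums h b c" "s \<le> s1 + s2"
          using variation_sums_split trans by blast
        with B show "s \<le> B1 + B2" by fastforce
      qed
    qed
  next
    case (local z)
    have "bdd_above (variation_sums h a b)" if "a \<le> z" "z \<le> b" "b - a < d" "x \<le> a" "b \<le> y" for a b
    proof (rule bdd_aboveI)
      fix s assume "s \<in> variation_sums h a b"
      then obtain I :: "nat set" and l u where fam: "interval_family a b I l u"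
        and s: "s = (\<Sum>i\<in>I. \<bar>h (u i) - h (l i)\<bar>)"
        by (auto simp: variation_sums_def)
      have "interval_family x y I l u" using fam that by (fastforce simp: interval_family_def)
      moreover have "(\<Sum>i\<in>I. u i - l i) < d" using interval_family_length_le[OF fam] that by auto
      ultimately show "s \<le> 1" unfolding s using d(2) by (intro less_imp_le)
    qed
    then have "0 < d \<and> (\<forall>a b. a \<le> z \<and> z \<le> b \<and> b - a < d \<longrightarrow>
        x \<le> a \<and> b \<le> y \<longrightarrow> bdd_above (variation_sums h a b))"
      using d(1) by simp
    then show ?case by (rule exI)
  qed
  with assms show ?thesis by auto
qed

lemma variation_subadditive:
  assumes "abs_cont_on x y h" "x \<le> s" "s \<le> t" "t \<le> y"
  shows "variation h x t \<le> variation h x s + variation h s t"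
  unfolding variation_def
proof (rule cSup_least)
  fix r assume "r \<in> variation_sums h x t"
  then obtain s1 s2 where 1: "s1 \<in> variation_sums h x s" "s2 \<in> variation_sums h s t" "r \<le> s1 + s2"
    using variation_sums_split assms by blast
  have "s1 \<le> Sup (variation_sums h x s)" "s2 \<le> Sup (variation_sums h s t)"
    using 1 assms by (auto intro!: cSup_upper bdd_above_variation_sums[OF assms(1)])
  with 1 show "r \<le> Sup (variation_sums h x s) + Sup (variation_sums h s t)" by linarith
qed (use variation_sums_nonempty in blast)

text \<open>A family on \<open>{x..s}\<close> together with the single interval from \<open>s\<close> to
\<open>t\<close> is a family on \<open>{x..t}\<close>.\<close>

lemma variation_increment_ge:
  assumes ac: "abs_cont_on x y h" and st: "x \<le> s" "s \<le> t" "t \<le> y"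
  shows "\<bar>h t - h s\<bar> \<le> variation h x t - variation h x s"
proof -
  have "variation h x s \<le> variation h x t - \<bar>h t - h s\<bar>"
    unfolding variation_def
  proof (rule cSup_least)
    fix r assume "r \<in> variation_sums h x s"
    then obtain I :: "nat set" and l u where fam: "interval_family x s I l u"
        and r: "r = (\<Sum>i\<in>I. \<bar>h (u i) - h (l i)\<bar>)"
      by (auto simp: variation_sums_def)
    then have I: "finite I" "\<And>i. i \<in> I \<Longrightarrow> x \<le> l i \<and> l i \<le> u i \<and> u i \<le> s"
      "disjoint_family_on (\<lambda>i. {l i<..<u i}) I" by (auto simp: interval_family_def)
    obtain k where k: "k \<notin> I" using I(1) ex_new_if_finite infinite_UNIV_nat by blast
    define l' u' where "l' = l(k := s)" and "u' = u(k := t)"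
    have eq: "l' i = l i" "u' i = u i" if "i \<in> I" for i using that k by (auto simp: l'_def u'_def)
    have lu: "x \<le> l' i \<and> l' i \<le> u' i \<and> u' i \<le> t" if "i \<in> insert k I" for i
      using I(2)[of i] st k that by (auto simp: l'_def u'_def)
    have "disjoint_family_on (\<lambda>i. {l' i<..<u' i}) I"
      using I(3) eq unfolding disjoint_family_on_def by simp
    moreover have "{l' k<..<u' k} \<inter> (\<Union>i\<in>I. {l' i<..<u' i}) = {}"
    proof -
      have "l' k = s" "\<And>i. i \<in> I \<Longrightarrow> u' i \<le> s"
        using I(2) k by (auto simp: l'_def u'_def)
      then show ?thesis by force
    qed
    ultimately have dis: "disjoint_family_on (\<lambda>i. {l' i<..<u' i}) (insert k I)"
      using k by (subst disjoint_family_on_insert) auto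
    have "interval_family x t (insert k I) l' u'"
      unfolding interval_family_def using I(1) lu dis by blast
    then have "(\<Sum>i\<in>insert k I. \<bar>h (u' i) - h (l' i)\<bar>) \<in> variation_sums h x t"
      by (auto simp: variation_sums_def)
    also have "(\<Sum>i\<in>insert k I. \<bar>h (u' i) - h (l' i)\<bar>) = \<bar>h t - h s\<bar> + r"
      using I(1) k eq by (simp add: r l'_def u'_def)
    finally have "\<bar>h t - h s\<bar> + r \<le> Sup (variation_sums h x t)"
      using st by (intro cSup_upper bdd_above_variation_sums[OF ac]) auto
    then show "r \<le> Sup (variation_sums h x t) - \<bar>h t - h s\<bar>" by simp
  qed (use variation_sums_nonempty in blast)
  then show ?thesis by simp
qed

text \<open>An increment of the variation is at most the variation of that interval, which is nearly attained by a
family inside the interval. Concatenating these families, one for each interval of a short family, gives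
a family that is still short.\<close>

lemma abs_cont_on_variation:
  assumes ac: "abs_cont_on x y h"
  shows "abs_cont_on x y (variation h x)"
proof (rule abs_cont_onI)
  fix e :: real assume e: "0 < e"
  obtain d where d: "0 < d" "\<And>(I :: (nat \<times> nat) set) l u. interval_family x y I l u \<Longrightarrow> (\<Sum>i\<in>I. u i - l i) < d \<Longrightarrow>
       (\<Sum>i\<in>I. \<bar>h (u i) - h (l i)\<bar>) < e / 2"
    using abs_cont_on_familyD[OF ac half_gt_zero[OF e]] by metis
  have "(\<Sum>i\<in>I. \<bar>variation h x (u i) - variation h x (l i)\<bar>) < e"
    if fam: "interval_family x y I l u" and len: "(\<Sum>i\<in>I. u i - l i) < d" for I :: "nat set" and l u
  proof -
    have I: "finite I" "\<And>i. i \<in> I \<Longrightarrow> x \<le> l i \<and> l i \<le> u i \<and> u i \<le> y"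
      "disjoint_family_on (\<lambda>i. {l i<..<u i}) I" using fam by (auto simp: interval_family_def)
    \<comment> \<open>the total loss over the whole family then stays below \<open>e / 2\<close>\<close>
    define \<eta> where "\<eta> = e / (2 * (real (card I) + 1))"
    have \<eta>: "\<eta> > 0" using e by (simp add: \<eta>_def)
    have "\<forall>i\<in>I. \<exists>p. interval_family (l i) (u i) (fst p :: nat set) (fst (snd p)) (snd (snd p)) \<and>
        variation h (l i) (u i) - \<eta> < (\<Sum>j\<in>fst p. \<bar>h (snd (snd p) j) - h (fst (snd p) j)\<bar>)"
    proof
      fix i
      have "\<exists>r\<in>variation_sums h (l i) (u i). variation h (l i) (u i) - \<eta> < r"
        using \<eta> variation_sums_nonempty[of h "l i" "u i"] unfolding variation_def
        by (intro less_cSupD) auto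
      then obtain K :: "nat set" and l' u' where "interval_family (l i) (u i) K l' u'"
        and "variation h (l i) (u i) - \<eta> < (\<Sum>j\<in>K. \<bar>h (u' j) - h (l' j)\<bar>)"
        unfolding variation_sums_def by blast
      then show "\<exists>p. interval_family (l i) (u i) (fst p :: nat set) (fst (snd p)) (snd (snd p)) \<and>
        variation h (l i) (u i) - \<eta> < (\<Sum>j\<in>fst p. \<bar>h (snd (snd p) j) - h (fst (snd p) j)\<bar>)"
        by (intro exI[of _ "(K, l', u')"]) simp
    qed
    then obtain P :: "nat \<Rightarrow> nat set \<times> (nat \<Rightarrow> real) \<times> (nat \<Rightarrow> real)" where P:
      "\<forall>i\<in>I. interval_family (l i) (u i) (fst (P i)) (fst (snd (P i))) (snd (snd (P i))) \<and>
        variation h (l i) (u i) - \<eta> < (\<Sum>j\<in>fst (P i). \<bar>h (snd (snd (P i)) j) - h (fst (snd (P i)) j)\<bar>)"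
      by (rule bchoice[THEN exE])
    define J l' u' where "J i = fst (P i)" and "l' i = fst (snd (P i))" and "u' i = snd (snd (P i))" for i
    have J: "interval_family (l i) (u i) (J i) (l' i) (u' i)"
      "variation h (l i) (u i) - \<eta> < (\<Sum>j\<in>J i. \<bar>h (u' i j) - h (l' i j)\<bar>)" if "i \<in> I" for i
      using P that by (auto simp: J_def l'_def u'_def)
    have finJ: "finite (J i)" if "i \<in> I" for i using J(1)[OF that] by (simp add: interval_family_def)
    let ?S = "Sigma I J"
    have fam: "interval_family x y ?S (\<lambda>(i,j). l' i j) (\<lambda>(i,j). u' i j)"
      unfolding interval_family_def disjoint_family_on_def
    proof (intro conjI ballI impI)
      show "finite ?S" using I(1) finJ by auto
      fix p assume p: "p \<in> ?S"
      obtain i j where pp: "p = (i, j)" by force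
      have ij: "i \<in> I" "j \<in> J i" using p pp by auto
      have 1: "l i \<le> l' i j" "l' i j \<le> u' i j" "u' i j \<le> u i"
        using J(1)[OF ij(1)] ij by (auto simp: interval_family_def)
      then show "x \<le> (\<lambda>(i,j). l' i j) p" "(\<lambda>(i,j). l' i j) p \<le> (\<lambda>(i,j). u' i j) p" "(\<lambda>(i,j). u' i j) p \<le> y"
        using I(2)[OF ij(1)] pp by auto
      fix q assume q: "q \<in> ?S" "p \<noteq> q"
      obtain i' j' where qq: "q = (i', j')" by force
      have ij': "i' \<in> I" "j' \<in> J i'" using q qq by auto
      have 2: "l i' \<le> l' i' j'" "l' i' j' \<le> u' i' j'" "u' i' j' \<le> u i'"
        using J(1)[OF ij'(1)] ij' by (auto simp: interval_family_def)
      have "{l' i j<..<u' i j} \<inter> {l' i' j'<..<u' i' j'} = {}"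
      proof (cases "i = i'")
        case True
        then show ?thesis using J(1)[OF ij(1)] ij ij' q(2) pp qq
          by (auto simp: interval_family_def disjoint_family_on_def)
      next
        case False
        have "{l i<..<u i} \<inter> {l i'<..<u i'} = {}"
          using I(3) False ij ij' by (auto simp: disjoint_family_on_def)
        moreover have "{l' i j<..<u' i j} \<subseteq> {l i<..<u i}" "{l' i' j'<..<u' i' j'} \<subseteq> {l i'<..<u i'}"
          using 1 2 by auto
        ultimately show ?thesis by blast
      qed
      then show "{(case p of (i, j) \<Rightarrow> l' i j)<..<case p of (i, j) \<Rightarrow> u' i j} \<inter>
             {(case q of (i, j) \<Rightarrow> l' i j)<..<case q of (i, j) \<Rightarrow> u' i j} = {}" using pp qq by simp
    qed
    have "(\<Sum>p\<in>?S. (\<lambda>(i,j). u' i j) p - (\<lambda>(i,j). l' i j) p) = (\<Sum>i\<in>I. \<Sum>j\<in>J i. u' i j - l' i j)"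
      using I(1) finJ by (subst sum.Sigma) (auto simp: case_prod_beta)
    also have "\<dots> \<le> (\<Sum>i\<in>I. u i - l i)"
      using I(2) J(1) by (intro sum_mono interval_family_length_le) auto
    also have "\<dots> < d" by (rule len)
    finally have "(\<Sum>p\<in>?S. \<bar>h ((\<lambda>(i,j). u' i j) p) - h ((\<lambda>(i,j). l' i j) p)\<bar>) < e / 2"
      by (intro d(2) fam)
    also have "(\<Sum>p\<in>?S. \<bar>h ((\<lambda>(i,j). u' i j) p) - h ((\<lambda>(i,j). l' i j) p)\<bar>) =
        (\<Sum>i\<in>I. \<Sum>j\<in>J i. \<bar>h (u' i j) - h (l' i j)\<bar>)"
      using I(1) finJ by (subst sum.Sigma) (auto simp: case_prod_beta)
    finally have main: "(\<Sum>i\<in>I. \<Sum>j\<in>J i. \<bar>h (u' i j) - h (l' i j)\<bar>) < e / 2" .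
    have "(\<Sum>i\<in>I. \<bar>variation h x (u i) - variation h x (l i)\<bar>) \<le>
       (\<Sum>i\<in>I. (\<Sum>j\<in>J i. \<bar>h (u' i j) - h (l' i j)\<bar>) + \<eta>)"
    proof (intro sum_mono)
      fix i assume i: "i \<in> I"
      then have b: "x \<le> l i" "l i \<le> u i" "u i \<le> y" using I(2) by auto
      have "variation h x (l i) \<le> variation h x (u i)"
        using variation_increment_ge[OF ac b] by linarith
      with variation_subadditive[OF ac b] J(2)[of i] i
      show "\<bar>variation h x (u i) - variation h x (l i)\<bar> \<le> (\<Sum>j\<in>J i. \<bar>h (u' i j) - h (l' i j)\<bar>) + \<eta>"
        by auto
    qed
    also have "\<dots> < e / 2 + card I * \<eta>" using main by (simp add: sum.distrib)
    also have "\<dots> \<le> e" using e by (simp add: \<eta>_def field_simps)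
    finally show ?thesis .
  qed
  then show "\<exists>d>0. \<forall>(I :: nat set) l u. interval_family x y I l u \<longrightarrow> (\<Sum>i\<in>I. u i - l i) < d \<longrightarrow>
      (\<Sum>i\<in>I. \<bar>variation h x (u i) - variation h x (l i)\<bar>) < e"
    using d(1) by blast
qed


lemma set_integrable_of_integrable:
  fixes g :: "real \<Rightarrow> real"
  assumes "integrable M g" "S \<in> sets M"
  shows "set_integrable M S g"
  unfolding set_integrable_def using assms by (intro integrable_mult_indicator)

section \<open>Densities of absolutely continuous functions\<close>

text \<open>The function \<open>F\<close>, extended by constants, is the distribution function of a measure.
Absolute continuity makes Lebesgue null sets null for this measure: a null set lies in an open set of
small length, is covered there by countably many non-overlapping intervals, and the increments of
\<open>F\<close> over finitely many of them have a small sum. The density is then supplied by the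
Radon-Nikodym theorem.\<close>

lemma increasing_abs_cont_density:
  assumes F: "mono_on {x..y} F" and ac: "abs_cont_on x y F" and xy: "x < y"
  obtains g :: "real \<Rightarrow> real" where "integrable lborel g"
    "\<And>t. x \<le> t \<Longrightarrow> t \<le> y \<Longrightarrow> F t - F x = (LBINT s:{x..t}. g s)"
proof -
  define G where "G t = F (max x (min y t))" for t
  have G_eq: "G t = F t" if "x \<le> t" "t \<le> y" for t using that by (simp add: G_def)
  have G_mono: "G s \<le> G t" if "s \<le> t" for s t
    unfolding G_def using xy that by (intro mono_onD[OF F]) auto
  have G_cont: "continuous_on UNIV G"
    unfolding G_def using xy
    by (intro continuous_on_compose2[OF abs_cont_on_continuous[OF ac]] continuous_intros) auto
  define \<mu> where "\<mu> = interval_measure G"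
  have [simp, measurable_cong]: "sets \<mu> = sets borel" and [simp]: "space \<mu> = UNIV"
    by (simp_all add: \<mu>_def)
  have \<mu>_Icc: "emeasure \<mu> {s..t} = ennreal (G t - G s)" if "s \<le> t" for s t
    unfolding \<mu>_def using that G_mono G_cont by (rule emeasure_interval_measure_Icc)
  have \<mu>_Ioc: "emeasure \<mu> {s<..t} = ennreal (G t - G s)" if "s \<le> t" for s t
    unfolding \<mu>_def using that G_mono
    by (rule emeasure_interval_measure_Ioc)
      (use G_cont in \<open>auto simp: continuous_on_eq_continuous_within intro: continuous_within_subset\<close>)
  have outside: "emeasure \<mu> (- {x..y}) = 0"
  proof -
    have "(\<Union>n::nat. {x - real n<..x} \<union> {y<..y + real n}) \<in> null_sets \<mu>"
    proof (intro null_sets_UN null_sets.Un)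
      fix n :: nat
      have "G x - G (x - real n) = 0" "G (y + real n) - G y = 0" using xy by (auto simp: G_def)
      then show "{x - real n<..x} \<in> null_sets \<mu>" "{y<..y + real n} \<in> null_sets \<mu>"
        by (auto simp: null_sets_def \<mu>_Ioc)
    qed
    moreover have "- {x..y} \<subseteq> (\<Union>n::nat. {x - real n<..x} \<union> {y<..y + real n})"
    proof
      fix t assume t: "t \<in> - {x..y}"
      obtain n :: nat where "max (x - t) (t - y) < n" using reals_Archimedean2 by blast
      with t show "t \<in> (\<Union>n::nat. {x - real n<..x} \<union> {y<..y + real n})"
        by (intro UN_I[of n]) auto
    qed
    moreover have "- {x..y} \<in> sets \<mu>" by simp
    ultimately have "- {x..y} \<in> null_sets \<mu>" by (meson null_sets_subset)
    then show ?thesis by (rule null_setsD1)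
  qed
  have fin: "emeasure \<mu> UNIV < \<infinity>"
  proof -
    have "emeasure \<mu> UNIV \<le> emeasure \<mu> {x..y} + emeasure \<mu> (- {x..y})"
      by (subst Compl_partition[of "{x..y}", symmetric], rule emeasure_subadditive) auto
    also have "\<dots> < \<infinity>" using xy by (simp add: outside \<mu>_Icc)
    finally show ?thesis .
  qed
  have null: "emeasure \<mu> A = 0" if A: "A \<in> null_sets lborel" for A
  proof -
    define B where "B = A \<inter> {x..y}"
    have A': "A \<in> sets borel" using A by auto
    have B[measurable]: "B \<in> sets borel" using A by (auto simp: B_def)
    have Bnull: "emeasure lborel B = 0"
      using A by (metis B_def Int_lower1 null_setsD1 null_sets_subset B sets_lborel)
    have eps: "emeasure \<mu> B \<le> 0 + ennreal e" if e: "0 < e" for e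
    proof -
      obtain d where d: "0 < d" "\<And>(I :: real set set) l u. interval_family x y I l u \<Longrightarrow>
         (\<Sum>i\<in>I. u i - l i) < d \<Longrightarrow> (\<Sum>i\<in>I. \<bar>F (u i) - F (l i)\<bar>) < e"
        using abs_cont_on_familyD[OF ac e] by metis
      obtain U where U: "open U" "B \<subseteq> U" "emeasure lborel (U - B) < d"
        using outer_regular_lborel[OF B d(1)] by metis
      have U': "emeasure lborel U < d"
      proof -
        have "emeasure lborel (U - B) = emeasure lborel U"
          using Bnull U(1) by (intro emeasure_Diff_null_set) (auto simp: null_sets_def)
        then show ?thesis using U by simp
      qed
      have gauge: "gauge (\<lambda>z. if z \<in> U then U else UNIV)" using U by (auto simp: gauge_def)
      have "B \<subseteq> cbox x y" "box x y \<noteq> {}" using xy by (auto simp: B_def)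
      from covering_lemma[OF this gauge]
      obtain D where D: "countable D" "\<Union>D \<subseteq> cbox x y"
        "\<And>K. K \<in> D \<Longrightarrow> interior K \<noteq> {} \<and> (\<exists>c d. K = cbox c d)"
        "pairwise (\<lambda>A B. interior A \<inter> interior B = {}) D"
        "\<And>K. K \<in> D \<Longrightarrow> \<exists>z\<in>B \<inter> K. K \<subseteq> (if z \<in> U then U else UNIV)" "B \<subseteq> \<Union>D"
        by metis
      have K: "Inf K < Sup K" "K = {Inf K..Sup K}" "x \<le> Inf K" "Sup K \<le> y" "K \<subseteq> U" if KD: "K \<in> D" for K
      proof -
        obtain c d where "K = cbox c d" "interior K \<noteq> {}" using D(3)[OF KD] by blast
        then have cd: "K = {c..d}" "c < d" by (auto simp: interior_cbox)
        then show "Inf K < Sup K" "K = {Inf K..Sup K}" by auto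
        have "K \<subseteq> {x..y}" using D(2) KD by auto
        then have "{c..d} \<subseteq> {x..y}" using cd by simp
        then show "x \<le> Inf K" "Sup K \<le> y" using cd by auto
        show "K \<subseteq> U" using D(5)[OF KD] U(2) by (auto split: if_splits)
      qed
      have finite_case: "emeasure \<mu> (\<Union>\<F>) \<le> ennreal e" if \<F>: "finite \<F>" "\<F> \<subseteq> D" for \<F>
      proof -
        have disj: "disjoint_family_on (\<lambda>K. {Inf K<..<Sup K}) \<F>"
          unfolding disjoint_family_on_def
        proof (intro ballI impI)
          fix K L assume KL: "K \<in> \<F>" "L \<in> \<F>" "K \<noteq> L"
          have "interior K = {Inf K<..<Sup K}" if "K \<in> D" for K
            using K(2)[OF that] interior_atLeastAtMost_real by metis
          then show "{Inf K<..<Sup K} \<inter> {Inf L<..<Sup L} = {}"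
            using pairwiseD[OF D(4), of K L] KL \<F>(2) by (metis subsetD)
        qed
        have fam: "interval_family x y \<F> Inf Sup"
          unfolding interval_family_def using \<F> disj K by (auto intro: less_imp_le)
        have "ennreal (\<Sum>K\<in>\<F>. Sup K - Inf K) = (\<Sum>K\<in>\<F>. ennreal (Sup K - Inf K))"
          using \<F> K by (subst sum_ennreal) (auto intro: less_imp_le)
        also have "\<dots> = (\<Sum>K\<in>\<F>. emeasure lborel {Inf K<..<Sup K})"
          using \<F> K(1) by (intro sum.cong refl emeasure_lborel_Ioo[symmetric] less_imp_le) auto
        also have "\<dots> = emeasure lborel (\<Union>K\<in>\<F>. {Inf K<..<Sup K})"
          using \<F> disj by (intro sum_emeasure) auto
        also have "\<dots> \<le> emeasure lborel U"
        proof (intro emeasure_mono UN_least)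
          fix L assume "L \<in> \<F>"
          then have "L \<in> D" using \<F> by auto
          have "{Inf L<..<Sup L} \<subseteq> {Inf L..Sup L}" by auto
          also have "\<dots> \<subseteq> U" using K(2,5)[OF \<open>L \<in> D\<close>] by simp
          finally show "{Inf L<..<Sup L} \<subseteq> U" .
        qed (use U in auto)
        finally have "ennreal (\<Sum>K\<in>\<F>. Sup K - Inf K) < ennreal d" using U' by simp
        then have "(\<Sum>K\<in>\<F>. Sup K - Inf K) < d"
          using d(1) by (simp add: ennreal_less_iff sum_nonneg less_imp_le K subsetD[OF \<F>(2)])
        from d(2)[OF fam this] have lt: "(\<Sum>K\<in>\<F>. \<bar>F (Sup K) - F (Inf K)\<bar>) < e" .
        have "emeasure \<mu> (\<Union>\<F>) \<le> (\<Sum>K\<in>\<F>. emeasure \<mu> K)"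
        proof -
          have "K \<in> sets borel" if "K \<in> \<F>" for K
            using K(2)[of K] that \<F>(2) by (metis subsetD atLeastAtMost_borel)
          then show ?thesis using emeasure_subadditive_finite[of \<F> "\<lambda>K. K" \<mu>] \<F>(1) by auto
        qed
        also have "\<dots> = (\<Sum>K\<in>\<F>. ennreal \<bar>F (Sup K) - F (Inf K)\<bar>)"
        proof (intro sum.cong refl)
          fix L assume "L \<in> \<F>"
          then have L: "L \<in> D" using \<F> by auto
          have "emeasure \<mu> L = emeasure \<mu> {Inf L..Sup L}" using K(2)[OF L] by simp
          also have "\<dots> = ennreal (G (Sup L) - G (Inf L))" using K(1)[OF L] by (intro \<mu>_Icc) auto
          also have "G (Sup L) - G (Inf L) = \<bar>G (Sup L) - G (Inf L)\<bar>"
            using G_mono[of "Inf L" "Sup L"] K(1)[OF L] by auto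
          finally show "emeasure \<mu> L = ennreal \<bar>F (Sup L) - F (Inf L)\<bar>"
            using K(1,3,4)[OF L] by (simp add: G_eq)
        qed
        also have "\<dots> = ennreal (\<Sum>K\<in>\<F>. \<bar>F (Sup K) - F (Inf K)\<bar>)" by (intro sum_ennreal) auto
        also have "\<dots> \<le> ennreal e" using lt by (intro ennreal_leI) auto
        finally show ?thesis .
      qed
      have Dm: "K \<in> sets \<mu>" if "K \<in> D" for K
        using K(2)[OF that] \<open>sets \<mu> = sets borel\<close> by (metis atLeastAtMost_borel)
      have "emeasure \<mu> (\<Union>D) \<le> ennreal e"
      proof (cases "D = {}")
        case False
        define \<F> where "\<F> n = from_nat_into D ` {..n}" for n :: nat
        have sub: "\<F> n \<subseteq> D" for n using from_nat_into[OF False] by (auto simp: \<F>_def)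
        have fm: "\<Union>(\<F> n) \<in> sets \<mu>" for n using sub Dm by (intro sets.finite_Union) (auto simp: \<F>_def)
        have "(SUP n. emeasure \<mu> (\<Union>(\<F> n))) = emeasure \<mu> (\<Union>n. \<Union>(\<F> n))"
          using fm by (intro SUP_emeasure_incseq) (force simp: \<F>_def incseq_def)+
        also have "(\<Union>n. \<Union>(\<F> n)) = \<Union>(\<Union>n. \<F> n)" by blast
        also have "(\<Union>n. \<F> n) = range (from_nat_into D)" by (auto simp: \<F>_def)
        also have "\<dots> = D" using False D(1) by (simp add: range_from_nat_into)
        finally show ?thesis using finite_case[OF _ sub] by (metis SUP_least \<F>_def finite_atMost finite_imageI)
      qed auto
      moreover have "emeasure \<mu> B \<le> emeasure \<mu> (\<Union>D)"
        using D(1,6) Dm by (intro emeasure_mono sets.countable_Union) auto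
      ultimately show ?thesis by simp
    qed
    have "emeasure \<mu> B \<le> 0" by (rule ennreal_le_epsilon) (rule eps)
    moreover have "emeasure \<mu> A \<le> emeasure \<mu> (B \<union> - {x..y})"
      using A' by (intro emeasure_mono) (auto simp: B_def)
    moreover have "\<dots> \<le> emeasure \<mu> B + emeasure \<mu> (- {x..y})" by (intro emeasure_subadditive) auto
    ultimately show ?thesis by (simp add: outside)
  qed
  have "absolutely_continuous lborel \<mu>"
    unfolding absolutely_continuous_def
  proof
    fix A :: "real set" assume "A \<in> null_sets lborel"
    then show "A \<in> null_sets \<mu>" using null by (intro null_setsI) auto
  qed
  then obtain f where f[measurable]: "f \<in> borel_measurable lborel" and f_density: "density lborel f = \<mu>"
    using sigma_finite_measure.Radon_Nikodym[OF sigma_finite_lborel, of \<mu>] by auto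
  have f_fin: "(\<integral>\<^sup>+t. f t \<partial>lborel) < \<infinity>"
    using fin unfolding f_density[symmetric] by (simp add: emeasure_density)
  then have AEf: "AE t in lborel. f t \<noteq> \<infinity>" by (intro nn_integral_PInf_AE) auto
  define g where "g t = enn2real (f t)" for t
  have [measurable]: "g \<in> borel_measurable borel" unfolding g_def by measurable
  have gf: "AE t in lborel. ennreal (g t) = f t" using AEf by eventually_elim (simp add: g_def less_top)
  have "(\<integral>\<^sup>+t. ennreal (g t) \<partial>lborel) = (\<integral>\<^sup>+t. f t \<partial>lborel)" using gf by (intro nn_integral_cong_AE)
  then have g: "integrable lborel g"
    using f_fin by (intro integrableI_nonneg) (auto simp: g_def)
  show ?thesis
  proof (rule that[OF g])
    fix t assume t: "x \<le> t" "t \<le> y"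
    have "ennreal (F t - F x) = emeasure \<mu> {x..t}" using t xy by (simp add: \<mu>_Icc G_eq)
    also have "\<dots> = (\<integral>\<^sup>+s. f s * indicator {x..t} s \<partial>lborel)"
      unfolding f_density[symmetric] by (simp add: emeasure_density)
    also have "\<dots> = (\<integral>\<^sup>+s. ennreal (indicator {x..t} s *\<^sub>R g s) \<partial>lborel)"
      using gf by (intro nn_integral_cong_AE) (auto elim!: eventually_mono simp: indicator_def)
    also have "\<dots> = ennreal (LBINT s:{x..t}. g s)"
      unfolding set_lebesgue_integral_def using g
      by (intro nn_integral_eq_integral integrable_mult_indicator) (simp_all, simp add: g_def)
    finally show "F t - F x = (LBINT s:{x..t}. g s)"
      using mono_onD[OF F, of x t] t xy
      by (subst (asm) ennreal_inj) (auto simp: set_lebesgue_integral_def g_def intro!: Bochner_Integration.integral_nonneg)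
  qed
qed

text \<open>Both the variation \<open>V\<close> and \<open>V - f\<close> are increasing and absolutely continuous.\<close>

lemma abs_cont_density:
  assumes ac: "abs_cont_on x y f" and xy: "x < y"
  obtains g :: "real \<Rightarrow> real" where "integrable lborel g"
    "\<And>t. x \<le> t \<Longrightarrow> t \<le> y \<Longrightarrow> f t - f x = (LBINT s:{x..t}. g s)"
proof -
  let ?V = "variation f x"
  note V = variation_increment_ge[OF ac]
  have mono: "mono_on {x..y} ?V" "mono_on {x..y} (\<lambda>t. ?V t - f t)"
  proof (rule_tac [!] mono_onI)
    fix s t assume "s \<in> {x..y}" "t \<in> {x..y}" "s \<le> t"
    with V[of s t] show "?V s \<le> ?V t" "?V s - f s \<le> ?V t - f t" by auto
  qed
  obtain g1 where g1: "integrable lborel g1" "\<And>t. x \<le> t \<Longrightarrow> t \<le> y \<Longrightarrow> ?V t - ?V x = (LBINT s:{x..t}. g1 s)"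
    using increasing_abs_cont_density[OF mono(1) abs_cont_on_variation[OF ac] xy] by blast
  obtain g2 where g2: "integrable lborel g2"
    "\<And>t. x \<le> t \<Longrightarrow> t \<le> y \<Longrightarrow> (?V t - f t) - (?V x - f x) = (LBINT s:{x..t}. g2 s)"
    using increasing_abs_cont_density[OF mono(2) abs_cont_on_diff[OF abs_cont_on_variation[OF ac] ac] xy] by blast
  show ?thesis
  proof (rule that[of "\<lambda>s. g1 s - g2 s"])
    show "integrable lborel (\<lambda>s. g1 s - g2 s)" using g1 g2 by auto
    fix t assume t: "x \<le> t" "t \<le> y"
    have "(LBINT s:{x..t}. g1 s - g2 s) = (LBINT s:{x..t}. g1 s) - (LBINT s:{x..t}. g2 s)"
      using g1(1) g2(1) by (intro set_integral_diff) (auto intro: set_integrable_of_integrable)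
    then show "f t - f x = (LBINT s:{x..t}. g1 s - g2 s)" using g1(2)[OF t] g2(2)[OF t] by simp
  qed
qed

section \<open>The fundamental theorem of calculus for absolutely continuous functions\<close>

text \<open>The single point \<open>s\<close> does not contribute to the integral.\<close>

lemma increment_eq_integral:
  assumes g: "integrable lborel (g :: real \<Rightarrow> real)" and "s \<le> t"
  shows "(LBINT z:{..t}. g z) - (LBINT z:{..s}. g z) = (LBINT z:{s..t}. g z)"
proof -
  have "(LBINT z:{..t}. g z) = (LBINT z:{..s} \<union> {s<..t}. g z)"
    using \<open>s \<le> t\<close> by (simp add: ivl_disj_un)
  also have "\<dots> = (LBINT z:{..s}. g z) + (LBINT z:{s<..t}. g z)"
    using g by (intro set_integral_Un) (auto intro: set_integrable_of_integrable)
  also have "(LBINT z:{s<..t}. g z) = (LBINT z:{s..t}. g z)"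
    unfolding set_lebesgue_integral_def
    using AE_lborel_singleton[of s] g
    by (intro integral_cong_AE) (auto elim!: eventually_mono simp: indicator_def)
  finally show ?thesis by simp
qed

text \<open>Let \<open>A\<close> be the part of \<open>{g < s}\<close> in a bounded open interval \<open>B\<close>,
and let \<open>P\<close> and \<open>Q\<close> be the measures with densities the positive and negative
parts of \<open>g - s\<close> on \<open>B\<close>. As \<open>P\<close> vanishes on \<open>A\<close>,
outer regularity gives an open \<open>U\<close> containing \<open>A\<close> with \<open>P U\<close>
small. Each bad point lies in arbitrarily short intervals inside \<open>U\<close> over which the average
of \<open>g\<close> exceeds \<open>s\<close>, that is, \<open>Q \<le> P\<close> there. The Vitali
covering theorem selects disjoint ones that cover almost all bad points, so these lie, up to a null set,
in a set of \<open>Q\<close>-measure at most \<open>P U\<close>. Hence the bad points are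
\<open>Q\<close>-null; but the density of \<open>Q\<close> is positive on \<open>A\<close>.\<close>

lemma AE_difference_quotient_le:
  assumes g: "integrable lborel (g :: real \<Rightarrow> real)"
  defines "G \<equiv> \<lambda>t. LBINT z:{..t}. g z"
  shows "AE x in lborel. g x < s \<longrightarrow> (\<forall>\<^sub>F y in at x. (G y - G x) / (y - x) \<le> s)"
proof -
  define bad where "bad = {x. g x < s \<and> \<not> (\<forall>\<^sub>F y in at x. (G y - G x) / (y - x) \<le> s)}"
  have [measurable]: "g \<in> borel_measurable borel" using g by auto
  have "AE x in lborel. x \<notin> bad \<inter> {-real k<..<real k}" for k :: nat
  proof -
    define B where "B = {-real k<..<real k}"
    have B[measurable]: "B \<in> sets borel" "open B" by (auto simp: B_def)
    define \<psi> where "\<psi> z = indicator B z * (g z - s)" for z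
    have \<psi>: "integrable lborel \<psi>"
    proof -
      have "integrable lborel (\<lambda>z. indicator B z *\<^sub>R g z)"
        using g by (intro integrable_mult_indicator) auto
      moreover have "integrable lborel (\<lambda>z. indicator B z *\<^sub>R s)" by (simp add: B_def)
      ultimately have "integrable lborel (\<lambda>z. indicator B z *\<^sub>R g z - indicator B z *\<^sub>R s)"
        by (rule Bochner_Integration.integrable_diff)
      then show ?thesis
        by (simp add: \<psi>_def[abs_def] algebra_simps)
    qed
    then have [measurable]: "\<psi> \<in> borel_measurable borel" by auto
    define P where "P = density lborel (\<lambda>z. ennreal (\<psi> z))"
    define Q where "Q = density lborel (\<lambda>z. ennreal (- \<psi> z))"
    have [simp, measurable_cong]: "sets P = sets borel" "sets Q = sets borel" by (auto simp: P_def Q_def)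
    have P_fin: "emeasure P X \<noteq> \<infinity>" and Q_fin: "emeasure Q X \<noteq> \<infinity>" if [measurable]: "X \<in> sets borel" for X
    proof -
      have "(\<integral>\<^sup>+ z. ennreal (\<psi> z) * indicator X z \<partial>lborel) \<le> (\<integral>\<^sup>+ z. ennreal (norm (\<psi> z)) \<partial>lborel)"
        "(\<integral>\<^sup>+ z. ennreal (- \<psi> z) * indicator X z \<partial>lborel) \<le> (\<integral>\<^sup>+ z. ennreal (norm (\<psi> z)) \<partial>lborel)"
        by (auto intro!: nn_integral_mono ennreal_leI simp: indicator_def)
      moreover have "(\<integral>\<^sup>+ z. ennreal (norm (\<psi> z)) \<partial>lborel) < \<infinity>" using \<psi> by (simp add: integrable_iff_bounded)
      ultimately show "emeasure P X \<noteq> \<infinity>" "emeasure Q X \<noteq> \<infinity>" by (auto simp: P_def Q_def emeasure_density)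
    qed
    have PQ: "(LBINT z:X. \<psi> z) = enn2real (emeasure P X) - enn2real (emeasure Q X)" if [measurable]: "X \<in> sets borel" for X
    proof -
      have "(LBINT z:X. \<psi> z) = enn2real (\<integral>\<^sup>+ z. ennreal (indicator X z *\<^sub>R \<psi> z) \<partial>lborel) -
          enn2real (\<integral>\<^sup>+ z. ennreal (- (indicator X z *\<^sub>R \<psi> z)) \<partial>lborel)"
        unfolding set_lebesgue_integral_def using \<psi>
        by (intro real_lebesgue_integral_def integrable_mult_indicator) auto
      also have "(\<integral>\<^sup>+ z. ennreal (indicator X z *\<^sub>R \<psi> z) \<partial>lborel) = emeasure P X"
        by (auto simp: P_def emeasure_density intro!: nn_integral_cong simp: indicator_def)
      also have "(\<integral>\<^sup>+ z. ennreal (- (indicator X z *\<^sub>R \<psi> z)) \<partial>lborel) = emeasure Q X"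
        by (auto simp: Q_def emeasure_density intro!: nn_integral_cong simp: indicator_def)
      finally show ?thesis .
    qed
    define A where "A = {z \<in> B. g z < s}"
    have A[measurable]: "A \<in> sets borel" unfolding A_def by measurable
    have PA: "emeasure P A = 0"
      unfolding P_def
      by (subst emeasure_density) (auto simp: A_def \<psi>_def indicator_def nn_integral_0_iff_AE ennreal_neg)
    have small: "\<exists>T\<in>sets borel. emeasure Q T \<le> ennreal e \<and> negligible (bad \<inter> B - T)" if e: "0 < e" for e
    proof -
      have "(INF U \<in> {U. A \<subseteq> U \<and> open U}. emeasure P U) < ennreal e"
        using outer_regular[of P A] PA P_fin[of UNIV] e by (simp add: P_def)
      then obtain U where U: "A \<subseteq> U" "open U" "emeasure P U < ennreal e" by (auto simp: INF_less_iff)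
      define K where "K = {(c, r). 0 < r \<and> cball c r \<subseteq> U \<inter> B \<and> 0 < (LBINT z:cball c r. \<psi> z)}"
      have cover: "\<exists>i. i \<in> K \<and> x \<in> cball (fst i) (snd i) \<and> snd i < d" if x: "x \<in> bad \<inter> B" and d: "0 < d" for x d
      proof -
        have "x \<in> U \<inter> B" using x U by (auto simp: bad_def A_def)
        moreover have "open (U \<inter> B)" using U B by auto
        ultimately obtain \<rho> where \<rho>: "0 < \<rho>" "ball x \<rho> \<subseteq> U \<inter> B" by (meson openE)
        have "\<exists>\<^sub>F y in at x. \<not> (G y - G x) / (y - x) \<le> s"
          using x by (simp add: bad_def not_eventually)
        moreover have "\<forall>\<^sub>F y in at x. dist y x < min d \<rho>" "\<forall>\<^sub>F y in at x. y \<noteq> x"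
          using d \<rho> by (auto simp: eventually_at intro!: exI[of _ "min d \<rho>"] eventually_neq_at_within)
        ultimately have "\<exists>\<^sub>F y in at x. \<not> (G y - G x) / (y - x) \<le> s \<and> dist y x < min d \<rho> \<and> y \<noteq> x"
          by (intro frequently_eventually_frequently eventually_conj)
        from frequently_ex[OF this] obtain y where y: "\<not> (G y - G x) / (y - x) \<le> s" "dist y x < min d \<rho>" "y \<noteq> x"
          by blast
        define c r where "c = (x + y) / 2" and "r = \<bar>y - x\<bar> / 2"
        define lo hi where "lo = min x y" and "hi = max x y"
        have r: "0 < r" "r < d" using y by (auto simp: r_def dist_real_def)
        have cb: "cball c r = {lo..hi}"
          by (auto simp: c_def r_def lo_def hi_def cball_def dist_real_def abs_if field_simps min_def max_def split: if_splits)
        have sub: "{lo..hi} \<subseteq> U \<inter> B"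
        proof -
          have "{lo..hi} \<subseteq> ball x \<rho>" using y(2) by (auto simp: lo_def hi_def dist_real_def min_def max_def split: if_splits)
          with \<rho> show ?thesis by blast
        qed
        have "(LBINT z:{lo..hi}. \<psi> z) = (LBINT z:{lo..hi}. g z - s)"
          using sub by (intro set_lebesgue_integral_cong) (auto simp: \<psi>_def)
        also have "\<dots> = (LBINT z:{lo..hi}. g z) - (LBINT z:{lo..hi}. s)"
          using g by (intro set_integral_diff) (auto intro: set_integrable_of_integrable borel_integrable_atLeastAtMost' continuous_intros)
        also have "\<dots> = G hi - G lo - s * (hi - lo)"
        proof -
          have "lo \<le> hi" by (simp add: lo_def hi_def)
          moreover from this have "(LBINT z:{lo..hi}. s) = s * (hi - lo)"
            by (simp add: set_lebesgue_integral_def)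
          ultimately show ?thesis using increment_eq_integral[OF g, of lo hi] by (simp add: G_def)
        qed
        also have "\<dots> > 0"
        proof -
          have eq: "(G y - G x) / (y - x) = (G hi - G lo) / (hi - lo)"
            by (cases "x \<le> y") (simp_all add: lo_def hi_def minus_divide_divide[of "G x - G y" "x - y", simplified])
          have "0 < hi - lo" using y(3) by (auto simp: lo_def hi_def)
          with y(1) show ?thesis unfolding eq by (simp add: field_simps)
        qed
        finally have "(c, r) \<in> K" using sub r by (simp add: K_def cb)
        moreover have "x \<in> cball c r" unfolding cb by (simp add: lo_def hi_def)
        ultimately show ?thesis using r by (intro exI[of _ "(c, r)"]) simp
      qed
      have "0 < snd i" if "i \<in> K" for i using that by (auto simp: K_def)
      then obtain C where C: "countable C" "C \<subseteq> K"
        "pairwise (\<lambda>i j. disjnt (cball (fst i) (snd i)) (cball (fst j) (snd j))) C"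
        "negligible (bad \<inter> B - (\<Union>i\<in>C. cball (fst i) (snd i)))"
        using cover by (rule Vitali_covering_theorem_cballs[where K = K and r = snd and a = fst and S = "bad \<inter> B"])
      define T where "T = (\<Union>i\<in>C. cball (fst i) (snd i))"
      have T: "T \<in> sets borel" unfolding T_def using C(1) by (intro sets.countable_UN') auto
      have disj: "disjoint_family_on (\<lambda>i. cball (fst i) (snd i)) C"
        using C(3) by (auto simp: disjoint_family_on_def pairwise_def disjnt_def)
      have "emeasure Q T = (\<integral>\<^sup>+i. emeasure Q (cball (fst i) (snd i)) \<partial>count_space C)"
        unfolding T_def using C(1) disj by (intro emeasure_UN_countable) auto
      also have "\<dots> \<le> (\<integral>\<^sup>+i. emeasure P (cball (fst i) (snd i)) \<partial>count_space C)"
      proof (intro nn_integral_mono)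
        fix i assume "i \<in> space (count_space C)"
        then have "0 < (LBINT z:cball (fst i) (snd i). \<psi> z)" using C(2) by (auto simp: K_def)
        then have "enn2real (emeasure Q (cball (fst i) (snd i))) \<le> enn2real (emeasure P (cball (fst i) (snd i)))"
          by (subst (asm) PQ) auto
        then show "emeasure Q (cball (fst i) (snd i)) \<le> emeasure P (cball (fst i) (snd i))"
          using P_fin[of "cball (fst i) (snd i)"] Q_fin[of "cball (fst i) (snd i)"]
          by (metis enn2real_nonneg ennreal_enn2real ennreal_leI infinity_ennreal_def less_top borel_closed closed_cball)
      qed
      also have "\<dots> = emeasure P T"
        unfolding T_def using C(1) disj by (intro emeasure_UN_countable[symmetric]) auto
      also have "\<dots> \<le> emeasure P U"
      proof (rule emeasure_mono)
        have "cball (fst i) (snd i) \<subseteq> U" if "i \<in> C" for i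
          using subsetD[OF C(2) that] by (simp add: K_def case_prod_beta)
        then show "T \<subseteq> U" unfolding T_def by (rule UN_least)
      qed (use U(2) in auto)
      finally have "emeasure Q T \<le> ennreal e" using U(3) by simp
      then show ?thesis using T C(4) by (auto simp: T_def)
    qed
    have "\<forall>n::nat. \<exists>T. T \<in> sets borel \<and> emeasure Q T \<le> ennreal (1 / Suc n) \<and> negligible (bad \<inter> B - T)"
      using small by (metis of_nat_0_less_iff zero_less_Suc zero_less_divide_1_iff)
    then obtain T where T: "\<And>n::nat. T n \<in> sets borel" "\<And>n. emeasure Q (T n) \<le> ennreal (1 / Suc n)"
      "\<And>n. negligible (bad \<inter> B - T n)" by metis
    have QT: "emeasure Q (\<Inter>n. T n) = 0"
    proof -
      have "(\<lambda>n. ennreal (1 / Suc n)) \<longlonglongrightarrow> ennreal 0"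
        by (intro tendsto_ennrealI) (rule LIMSEQ_inverse_real_of_nat[simplified inverse_eq_divide])
      moreover have "emeasure Q (\<Inter>n. T n) \<le> ennreal (1 / Suc n)" for n
        using emeasure_mono[of "\<Inter>n. T n" "T n" Q] T by (intro order_trans[OF _ T(2)]) auto
      ultimately have "emeasure Q (\<Inter>n. T n) \<le> ennreal 0" by (intro LIMSEQ_le_const) auto
      then show ?thesis by simp
    qed
    have "AE x in lborel. x \<in> (\<Inter>n. T n) \<longrightarrow> ennreal (- \<psi> x) = 0"
    proof -
      have "(\<Inter>n. T n) \<in> null_sets Q" using QT T by (intro null_setsI) auto
      then show ?thesis unfolding Q_def by (subst (asm) null_sets_density_iff) auto
    qed
    moreover have "AE x in lborel. x \<notin> bad \<inter> B - T n" for n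
    proof -
      have "AE x in lebesgue. x \<notin> bad \<inter> B - T n"
        using T(3)[of n] by (intro AE_not_in) (simp add: negligible_iff_null_sets)
      then show ?thesis by (simp add: AE_completion_iff)
    qed
    then have "AE x in lborel. \<forall>n. x \<notin> bad \<inter> B - T n" unfolding AE_all_countable by blast
    ultimately show ?thesis
      unfolding B_def[symmetric]
      by eventually_elim (auto simp: bad_def \<psi>_def ennreal_eq_0_iff)
  qed
  then have "AE x in lborel. \<forall>k::nat. x \<notin> bad \<inter> {-real k<..<real k}"
    unfolding AE_all_countable by blast
  then show ?thesis
  proof eventually_elim
    case (elim x)
    obtain k :: nat where "\<bar>x\<bar> < k" using reals_Archimedean2 by blast
    with elim have "x \<notin> bad" by (auto simp: abs_less_iff)
    then show ?case by (auto simp: bad_def)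
  qed
qed

text \<open>The one-sided bound, applied to \<open>g\<close> and \<open>- g\<close> with all rational levels at
once, squeezes the difference quotients.\<close>

theorem lebesgue_differentiation:
  assumes g: "integrable lborel (g :: real \<Rightarrow> real)"
  shows "AE x in lborel. ((\<lambda>t. LBINT z:{..t}. g z) has_real_derivative g x) (at x)"
proof -
  define G where "G t = (LBINT z:{..t}. g z)" for t
  have neg: "(LBINT z:{..t}. - g z) = - G t" for t
    by (simp add: G_def set_lebesgue_integral_def)
  have "AE x in lborel. \<forall>s\<in>\<rat>. g x < s \<longrightarrow> (\<forall>\<^sub>F y in at x. (G y - G x) / (y - x) \<le> s)"
    unfolding G_def by (intro AE_ball_countable' AE_difference_quotient_le g countable_rat)
  moreover have "AE x in lborel. \<forall>s\<in>\<rat>. - g x < s \<longrightarrow> (\<forall>\<^sub>F y in at x. (- G y - - G x) / (y - x) \<le> s)"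
    unfolding neg[symmetric] using g by (intro AE_ball_countable' AE_difference_quotient_le countable_rat) auto
  ultimately have "AE x in lborel. (G has_real_derivative g x) (at x)"
  proof eventually_elim
    case (elim x)
    have "((\<lambda>y. (G y - G x) / (y - x)) \<longlongrightarrow> g x) (at x)"
    proof (rule order_tendstoI)
      fix a assume "g x < a"
      then obtain s where s: "s \<in> \<rat>" "g x < s" "s < a" using Rats_dense_in_real by blast
      then have "\<forall>\<^sub>F y in at x. (G y - G x) / (y - x) \<le> s" using elim by blast
      then show "\<forall>\<^sub>F y in at x. (G y - G x) / (y - x) < a" using s by (auto elim: eventually_mono)
    next
      fix a assume "a < g x"
      then obtain s where s: "s \<in> \<rat>" "a < s" "s < g x" using Rats_dense_in_real by blast
      then have "\<forall>\<^sub>F y in at x. (- G y - - G x) / (y - x) \<le> - s" using elim by (metis Rats_minus_iff neg_less_iff_less)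
      then show "\<forall>\<^sub>F y in at x. a < (G y - G x) / (y - x)"
      proof eventually_elim
        case (elim y)
        have "(- G y - - G x) / (y - x) = - ((G y - G x) / (y - x))" by (simp add: minus_divide_left)
        with elim s show ?case by simp
      qed
    qed
    then show ?case by (simp add: has_field_derivative_iff)
  qed
  then show ?thesis by (simp add: G_def[abs_def])
qed

theorem abs_cont_FTC:
  assumes ac: "abs_cont_on x y f" and xy: "x < y"
  obtains g :: "real \<Rightarrow> real" where "integrable lborel g"
    "f y - f x = (LBINT s:{x..y}. g s)"
    "AE t in lborel. x < t \<and> t < y \<longrightarrow> (f has_real_derivative g t) (at t)"
proof -
  obtain g where g: "integrable lborel g" and fg: "\<And>t. x \<le> t \<Longrightarrow> t \<le> y \<Longrightarrow> f t - f x = (LBINT s:{x..t}. g s)"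
    using abs_cont_density[OF ac xy] by metis
  have "AE t in lborel. x < t \<and> t < y \<longrightarrow> (f has_real_derivative g t) (at t)"
    using lebesgue_differentiation[OF g]
  proof eventually_elim
    case (elim t)
    show ?case
    proof
      assume t: "x < t \<and> t < y"
      have "((\<lambda>t. (LBINT z:{..t}. g z) + (f x - (LBINT z:{..x}. g z))) has_real_derivative g t + 0) (at t)"
        by (intro DERIV_add elim DERIV_const)
      moreover have "\<forall>\<^sub>F s in nhds t. (LBINT z:{..s}. g z) + (f x - (LBINT z:{..x}. g z)) = f s"
      proof -
        have "\<forall>\<^sub>F s in nhds t. s \<in> {x<..<y}" using t by (intro eventually_nhds_in_open) auto
        then show ?thesis
        proof eventually_elim
          case (elim s)
          with increment_eq_integral[OF g, of x s] fg[of s] show ?case by simp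
        qed
      qed
      ultimately show "(f has_real_derivative g t) (at t)"
        by (subst (asm) DERIV_cong_ev[OF refl _ refl]) auto
    qed
  qed
  with g fg[of y] xy show ?thesis by (intro that) auto
qed

lemma locally_abs_cont_AE_differentiable:
  assumes "locally_abs_cont f"
  shows "AE t in lborel. f differentiable (at t)"
proof -
  have "AE t in lborel. - real n < t \<and> t < real n \<longrightarrow> f differentiable (at t)" for n :: nat
  proof (cases "n = 0")
    case False
    then have n: "- real n < real n" by simp
    have "abs_cont_on (- real n) (real n) f" using assms by (simp add: locally_abs_cont_def)
    then obtain g where "AE t in lborel. - real n < t \<and> t < real n \<longrightarrow> (f has_real_derivative g t) (at t)"
      using n by (rule abs_cont_FTC)
    then show ?thesis by eventually_elim (auto simp: real_differentiable_def)
  qed auto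
  then have "AE t in lborel. \<forall>n::nat. - real n < t \<and> t < real n \<longrightarrow> f differentiable (at t)"
    unfolding AE_all_countable by blast
  then show ?thesis
  proof eventually_elim
    case (elim t)
    obtain k :: nat where "\<bar>t\<bar> < k" using reals_Archimedean2 by blast
    with elim show ?case by (metis abs_less_iff minus_less_iff)
  qed
qed

lemma locally_abs_cont_continuous:
  assumes "locally_abs_cont f"
  shows "continuous_on UNIV f"
proof -
  have "isCont f t" for t
  proof (rule continuous_on_interior)
    show "continuous_on {t - 1..t + 1} f"
      using assms by (intro abs_cont_on_continuous) (simp add: locally_abs_cont_def)
  qed auto
  then show ?thesis by (simp add: continuous_on_eq_continuous_at)
qed

text \<open>The only possible derivative at \<open>t\<close> is the limit \<open>L t\<close> of the difference
quotients along \<open>1 / Suc n\<close>, which is a Borel function of \<open>t\<close> even where the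
quotients diverge. By continuity of \<open>f\<close> it suffices to compare the quotients with \<open>L
t\<close> for rational increments, which leaves countably many conditions.\<close>

lemma borel_set_differentiable:
  assumes f: "continuous_on UNIV (f :: real \<Rightarrow> real)"
  shows "{t. f differentiable (at t)} \<in> sets borel"
proof -
  have [measurable]: "f \<in> borel_measurable borel" using f by (rule borel_measurable_continuous_onI)
  define L where "L t = lim (\<lambda>n. (f (t + 1 / Suc n) - f t) / (1 / Suc n))" for t
  have [measurable]: "L \<in> borel_measurable borel" unfolding L_def by measurable
  define D where "D = {t. \<forall>k::nat. \<exists>n::nat. \<forall>q::rat. q \<noteq> 0 \<and> \<bar>real_of_rat q\<bar> < 1 / Suc n \<longrightarrow>
      \<bar>(f (t + real_of_rat q) - f t) / real_of_rat q - L t\<bar> \<le> 1 / Suc k}"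
  have "D \<in> sets borel"
    unfolding D_def by measurable
  also have "D = {t. f differentiable (at t)}"
  proof (intro set_eqI iffI; unfold mem_Collect_eq)
    fix t assume "f differentiable (at t)"
    then obtain d where "(f has_real_derivative d) (at t)" by (auto simp: real_differentiable_def)
    then have lim: "((\<lambda>s. (f (t + s) - f t) / s) \<longlongrightarrow> d) (at 0)" by (simp add: DERIV_def)
    have "filterlim (\<lambda>n. 1 / real (Suc n)) (at 0) sequentially"
      using LIMSEQ_inverse_real_of_nat unfolding filterlim_at by (auto simp: inverse_eq_divide)
    from filterlim_compose[OF lim this] have "L t = d" unfolding L_def by (rule limI)
    show "t \<in> D"
      unfolding D_def mem_Collect_eq
    proof
      fix k :: nat
      have "\<forall>\<^sub>F s in at 0. dist ((f (t + s) - f t) / s) d < 1 / Suc k" using lim by (intro tendstoD) auto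
      then obtain e where e: "0 < e" "\<And>s. s \<noteq> 0 \<Longrightarrow> dist s 0 < e \<Longrightarrow> dist ((f (t + s) - f t) / s) d < 1 / Suc k"
        by (auto simp: eventually_at)
      obtain n :: nat where n: "1 / Suc n < e" using e(1) nat_approx_posE by blast
      show "\<exists>n::nat. \<forall>q::rat. q \<noteq> 0 \<and> \<bar>real_of_rat q\<bar> < 1 / Suc n \<longrightarrow>
          \<bar>(f (t + real_of_rat q) - f t) / real_of_rat q - L t\<bar> \<le> 1 / Suc k"
      proof (intro exI[of _ n] allI impI)
        fix q :: rat assume "q \<noteq> 0 \<and> \<bar>real_of_rat q\<bar> < 1 / Suc n"
        with e(2)[of "real_of_rat q"] n
        show "\<bar>(f (t + real_of_rat q) - f t) / real_of_rat q - L t\<bar> \<le> 1 / Suc k"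
          by (simp add: \<open>L t = d\<close> dist_real_def)
      qed
    qed
  next
    fix t assume t: "t \<in> D"
    have "((\<lambda>s. (f (t + s) - f t) / s) \<longlongrightarrow> L t) (at 0)"
    proof (rule tendstoI)
      fix e :: real assume "0 < e"
      then obtain k :: nat where k: "1 / Suc k < e" using nat_approx_posE by blast
      obtain n :: nat where n: "\<And>s. s \<in> \<rat> \<Longrightarrow> s \<noteq> 0 \<Longrightarrow> \<bar>s\<bar> < 1 / Suc n \<Longrightarrow> \<bar>(f (t + s) - f t) / s - L t\<bar> \<le> 1 / Suc k"
      proof -
        obtain n :: nat where n: "\<And>q::rat. q \<noteq> 0 \<and> \<bar>real_of_rat q\<bar> < 1 / Suc n \<Longrightarrow>
            \<bar>(f (t + real_of_rat q) - f t) / real_of_rat q - L t\<bar> \<le> 1 / Suc k"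
          using t unfolding D_def by blast
        show thesis
        proof (rule that)
          fix s :: real assume "s \<in> \<rat>" "s \<noteq> 0" "\<bar>s\<bar> < 1 / Suc n"
          then show "\<bar>(f (t + s) - f t) / s - L t\<bar> \<le> 1 / Suc k"
            using n by (auto elim!: Rats_cases)
        qed
      qed
      have "dist ((f (t + s) - f t) / s) (L t) < e" if s: "s \<noteq> 0" "dist s 0 < 1 / Suc n" for s
      proof -
        \<comment> \<open>continuity in the increment passes the bound from rational to real increments\<close>
        let ?q = "\<lambda>s. \<bar>(f (t + s) - f t) / s - L t\<bar>"
        let ?S = "{s. s \<noteq> 0 \<and> \<bar>s\<bar> < 1 / Suc n} :: real set"
        have S: "open ?S"
        proof -
          have "?S = ball 0 (1 / Suc n) - {0}" by (auto simp: dist_real_def)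
          then show ?thesis by (metis open_ball open_delete)
        qed
        have "continuous_on (- {0}) ?q"
          by (intro continuous_intros continuous_on_compose2[OF f]) auto
        then have isC: "isCont ?q s" using s(1)
          by (metis (no_types, lifting) ComplI continuous_on_eq_continuous_at open_Compl closed_singleton singletonD)
        have "?q s \<le> 1 / Suc k"
        proof (rule ccontr)
          assume "\<not> ?q s \<le> 1 / Suc k"
          moreover have "(?q \<longlongrightarrow> ?q s) (nhds s)"
            using isC unfolding isCont_def by (rule tendsto_at_iff_tendsto_nhds[THEN iffD1])
          ultimately have "\<forall>\<^sub>F r in nhds s. 1 / Suc k < ?q r"
            by (intro order_tendstoD(1)[of ?q "?q s"]) auto
          moreover have "\<forall>\<^sub>F r in nhds s. r \<in> ?S" using S s by (intro eventually_nhds_in_open) (auto simp: dist_real_def)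
          ultimately have "\<forall>\<^sub>F r in nhds s. 1 / Suc k < ?q r \<and> r \<in> ?S" by (rule eventually_conj)
          then obtain d where d: "0 < d" "\<And>r. dist r s < d \<Longrightarrow> 1 / Suc k < ?q r \<and> r \<in> ?S"
            by (auto simp: eventually_nhds_metric)
          obtain r where "r \<in> \<rat>" "s < r" "r < s + d" using Rats_dense_in_real[of s "s + d"] d(1) by auto
          with d(2)[of r] n[of r] show False by (auto simp: dist_real_def)
        qed
        with k show ?thesis by (simp add: dist_real_def)
      qed
      then show "\<forall>\<^sub>F s in at 0. dist ((f (t + s) - f t) / s) (L t) < e"
        unfolding eventually_at by (intro exI[of _ "1 / Suc n"]) auto
    qed
    then show "f differentiable (at t)" by (auto simp: real_differentiable_def DERIV_def)
  qed
  finally show ?thesis .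
qed

text \<open>At a point without derivative \<open>deriv\<close> returns one fixed value, so that \<open>deriv
f\<close> stays measurable.\<close>

lemma deriv_not_differentiable:
  assumes "\<not> f differentiable (at (t :: real))"
  shows "deriv f t = (SOME d. False)"
proof -
  have "(\<lambda>d. (f has_real_derivative d) (at t)) = (\<lambda>d. False)"
    using assms by (auto simp: real_differentiable_def)
  then show ?thesis by (simp add: deriv_def)
qed

lemma borel_measurable_deriv:
  assumes f: "continuous_on UNIV (f :: real \<Rightarrow> real)"
  shows "deriv f \<in> borel_measurable borel"
proof -
  have [measurable]: "f \<in> borel_measurable borel" using f by (rule borel_measurable_continuous_onI)
  note [measurable] = borel_set_differentiable[OF f]
  define L where "L t = lim (\<lambda>n. (f (t + 1 / Suc n) - f t) / (1 / Suc n))" for t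
  have [measurable]: "L \<in> borel_measurable borel" unfolding L_def by measurable
  have "L t = deriv f t" if "f differentiable (at t)" for t
  proof -
    have lim: "((\<lambda>s. (f (t + s) - f t) / s) \<longlongrightarrow> deriv f t) (at 0)"
      using that by (simp add: DERIV_def[symmetric] DERIV_deriv_iff_real_differentiable)
    have "filterlim (\<lambda>n. 1 / real (Suc n)) (at 0) sequentially"
      using LIMSEQ_inverse_real_of_nat unfolding filterlim_at by (auto simp: inverse_eq_divide)
    from filterlim_compose[OF lim this] show ?thesis unfolding L_def by (rule limI)
  qed
  then have "deriv f = (\<lambda>t. if t \<in> {t. f differentiable (at t)} then L t else (SOME d. False))"
    by (auto simp: deriv_not_differentiable)
  also have "\<dots> \<in> borel_measurable borel" by measurable
  finally show ?thesis .
qed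

lemma integral_deriv_abs_cont:
  assumes ac: "locally_abs_cont f" and "x < y"
  shows "set_integrable lborel {x..y} (deriv f)" "(LBINT t:{x..y}. deriv f t) = f y - f x"
proof -
  have [measurable]: "deriv f \<in> borel_measurable borel"
    using ac by (intro borel_measurable_deriv locally_abs_cont_continuous)
  have "abs_cont_on x y f" using ac by (simp add: locally_abs_cont_def)
  then obtain g where g: "integrable lborel g" "f y - f x = (LBINT s:{x..y}. g s)"
    "AE t in lborel. x < t \<and> t < y \<longrightarrow> (f has_real_derivative g t) (at t)"
    using \<open>x < y\<close> by (rule abs_cont_FTC)
  have AE: "AE t in lborel. indicator {x..y} t *\<^sub>R deriv f t = indicator {x..y} t *\<^sub>R g t"
    using g(3) AE_lborel_singleton[of x] AE_lborel_singleton[of y]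
    by eventually_elim (auto simp: indicator_def dest!: DERIV_imp_deriv)
  have "integrable lborel (\<lambda>t. indicator {x..y} t *\<^sub>R g t)" using g(1) by (intro integrable_mult_indicator) auto
  then show "set_integrable lborel {x..y} (deriv f)"
    unfolding set_integrable_def using AE g(1) by (subst integrable_cong_AE) auto
  show "(LBINT t:{x..y}. deriv f t) = f y - f x"
    unfolding g(2) set_lebesgue_integral_def using AE g(1) by (intro integral_cong_AE) auto
qed


section \<open>The equilibrium kernel\<close>

text \<open>For \<open>a = 0\<close> this is the Peano kernel of the first-order Taylor expansion at
\<open>0\<close>, namely \<open>\<bar>x - w\<bar>\<close> for \<open>w\<close> between \<open>0\<close>
and \<open>x\<close>; the first summand adds the kernel of \<open>- a * (f' x - f' 0)\<close>. Written
without case distinctions on the sign of \<open>x\<close>, its expectation over a random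
\<open>x\<close> can be read off term by term.\<close>

definition equilibrium_kernel :: "real \<Rightarrow> real \<Rightarrow> real \<Rightarrow> real" where
  "equilibrium_kernel a w x =
     a * ((if x \<le> w then 1 else 0) - (if 0 \<le> w then 1 else 0)) +
     (max (w - x) 0 - max w 0 + (if 0 \<le> w then x else 0))"

lemma equilibrium_kernel_bound:
  "\<bar>equilibrium_kernel a w x\<bar> \<le> (\<bar>a\<bar> + \<bar>x\<bar>) * indicator {-\<bar>x\<bar>..\<bar>x\<bar>} w"
  unfolding equilibrium_kernel_def by (auto simp: indicator_def max_def abs_if)

text \<open>Between \<open>0\<close> and \<open>x\<close> the kernel is, up to sign, \<open>x - a - w\<close>, and
\<open>(x - a - w) * f'' w\<close> has the antiderivative \<open>(x - a - w) * f' w + f w\<close>. The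
term \<open>f' 0 * (x - a)\<close> has expectation zero when \<open>x\<close> is random with mean
\<open>a\<close>.\<close>

lemma integral_kernel:
  assumes f': "\<And>t. (f has_real_derivative f' t) (at t)"
    and f'': "\<And>t. (f' has_real_derivative g t) (at t)" and g: "continuous_on UNIV g"
  shows "has_bochner_integral lborel (\<lambda>w. g w * equilibrium_kernel a w x)
    (f x - f 0 - a * f' x - f' 0 * (x - a))"
proof -
  let ?H = "\<lambda>w. (x - a - w) * f' w + f w"
  have H: "(?H has_real_derivative (x - a - w) * g w) (at w)" for w
    by (rule derivative_eq_intros f' f'' refl)+ (simp add: algebra_simps)
  have cont: "isCont (\<lambda>w. (x - a - w) * g w) w" for w
    using g by (intro continuous_intros) (auto simp: continuous_on_eq_continuous_at)
  have [measurable]: "g \<in> borel_measurable borel" using g by (rule borel_measurable_continuous_onI)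
  show ?thesis
  proof (cases "0 \<le> x")
    case True
    have "has_bochner_integral lborel (\<lambda>w. (x - a - w) * g w * indicator {0..x} w) (?H x - ?H 0)"
      by (intro has_bochner_integral_FTC_Icc_real True H cont)
    moreover have "AE w in lborel. (x - a - w) * g w * indicator {0..x} w = g w * equilibrium_kernel a w x"
      using AE_lborel_singleton[of x]
      by eventually_elim (use True in \<open>auto simp: equilibrium_kernel_def indicator_def max_def algebra_simps\<close>)
    ultimately have "has_bochner_integral lborel (\<lambda>w. g w * equilibrium_kernel a w x) (?H x - ?H 0)"
      by (subst (asm) has_bochner_integral_cong_AE) (auto simp: equilibrium_kernel_def)
    then show ?thesis by (simp add: algebra_simps)
  next
    case False
    have "has_bochner_integral lborel (\<lambda>w. - ((x - a - w) * g w * indicator {x..0} w)) (- (?H 0 - ?H x))"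
      using False by (intro has_bochner_integral_minus has_bochner_integral_FTC_Icc_real H cont) auto
    moreover have "AE w in lborel. - ((x - a - w) * g w * indicator {x..0} w) = g w * equilibrium_kernel a w x"
      using AE_lborel_singleton[of 0]
      by eventually_elim (use False in \<open>auto simp: equilibrium_kernel_def indicator_def max_def algebra_simps\<close>)
    ultimately have "has_bochner_integral lborel (\<lambda>w. g w * equilibrium_kernel a w x) (- (?H 0 - ?H x))"
      by (subst (asm) has_bochner_integral_cong_AE) (auto simp: equilibrium_kernel_def)
    then show ?thesis by (simp add: algebra_simps)
  qed
qed

text \<open>In each of the four cases the indicator is, up to end points, that of an interval of \<open>v\<close>
with end points among \<open>0\<close>, \<open>1\<close> and \<open>w / x\<close>.\<close>

lemma integral_truncated_le:
  "has_bochner_integral lborel (\<lambda>v. indicator {0..1} v * (x * (if x \<le> w / v then 1 else 0)))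
     (max w 0 - max (w - x) 0 :: real)"
proof -
  have *: "has_bochner_integral lborel (\<lambda>v. indicator {l..u} v * x :: real) ((u - l) * x)" if "l \<le> u" for l u :: real
    using that by (simp add: has_bochner_integral_iff)
  have key: "has_bochner_integral lborel (\<lambda>v. indicator {0..1} v * (x * (if x \<le> w / v then 1 else 0))) ((u - l) * x)"
    if "l \<le> u" "\<And>v. v \<noteq> 0 \<Longrightarrow> v \<noteq> l \<Longrightarrow> v \<noteq> u \<Longrightarrow> v \<in> {0..1} \<and> x \<le> w / v \<longleftrightarrow> v \<in> {l..u}" for l u
  proof -
    have "AE v in lborel. indicator {l..u} v * x = indicator {0..1} v * (x * (if x \<le> w / v then 1 else 0))"
      using AE_lborel_singleton[of 0] AE_lborel_singleton[of l] AE_lborel_singleton[of u]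
    proof eventually_elim
      case (elim v)
      with that(2)[of v] show ?case by (auto simp: indicator_def)
    qed
    then show ?thesis
      using *[OF that(1)] by (subst (asm) has_bochner_integral_cong_AE) auto
  qed
  consider "0 \<le> w" "x \<le> w" | "0 \<le> w" "w < x" | "w < 0" "w < x" | "w < 0" "x \<le> w" by linarith
  then show ?thesis
  proof cases
    case 1
    have "has_bochner_integral lborel (\<lambda>v. indicator {0..1} v * (x * (if x \<le> w / v then 1 else 0))) ((1 - 0) * x)"
    proof (rule key)
      fix v :: real assume v: "v \<noteq> 0"
      have "x \<le> w / v" if "0 \<le> v" "v \<le> 1"
      proof -
        have "v * x \<le> w"
          using 1 that mult_left_le_one_le[of x v] mult_nonneg_nonpos[of v x] by (cases "0 \<le> x") linarith+
        then show ?thesis using v that by (simp add: field_simps)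
      qed
      then show "v \<in> {0..1} \<and> x \<le> w / v \<longleftrightarrow> v \<in> {0..1}" by auto
    qed simp
    moreover have "max w 0 - max (w - x) 0 = x" using 1 by simp
    ultimately show ?thesis by simp
  next
    case 2
    have "has_bochner_integral lborel (\<lambda>v. indicator {0..1} v * (x * (if x \<le> w / v then 1 else 0))) ((w / x - 0) * x)"
    proof (rule key)
      fix v :: real assume v: "v \<noteq> 0"
      have x: "w / x \<le> 1" "0 < x" using 2 by auto
      have "x \<le> w / v \<longleftrightarrow> v \<le> w / x" if "0 < v" using x that by (simp add: field_simps)
      moreover have "v \<le> 1" if "v \<le> w / x" using that x(1) by (rule order_trans)
      ultimately show "v \<in> {0..1} \<and> x \<le> w / v \<longleftrightarrow> v \<in> {0..w / x}" using v by auto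
    qed (use 2 in auto)
    with 2 show ?thesis by (simp add: max_def)
  next
    case 3
    have "has_bochner_integral lborel (\<lambda>v. indicator {0..1} v * (x * (if x \<le> w / v then 1 else 0))) ((0 - 0) * x)"
    proof (rule key)
      fix v :: real assume v: "v \<noteq> 0"
      have "\<not> x \<le> w / v" if "0 < v" "v \<le> 1"
      proof -
        have "w / v \<le> w" using 3 that by (simp add: divide_simps mult_left_le)
        then show ?thesis using 3 by linarith
      qed
      then show "v \<in> {0..1} \<and> x \<le> w / v \<longleftrightarrow> v \<in> {0..0}" using v by auto
    qed simp
    with 3 show ?thesis by (simp add: max_def)
  next
    case 4
    have "has_bochner_integral lborel (\<lambda>v. indicator {0..1} v * (x * (if x \<le> w / v then 1 else 0))) ((1 - w / x) * x)"
    proof (rule key)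
      fix v :: real assume v: "v \<noteq> 0"
      have x: "0 < w / x" "w / x \<le> 1" using 4 by (auto simp: divide_simps)
      have "x \<le> w / v \<longleftrightarrow> w / x \<le> v" if "0 < v" using 4 that by (auto simp: field_simps)
      moreover have "0 < v" if "w / x \<le> v" using x(1) that by (rule less_le_trans)
      ultimately show "v \<in> {0..1} \<and> x \<le> w / v \<longleftrightarrow> v \<in> {w / x..1}" using v by auto
    qed (use 4 in \<open>auto simp: divide_simps\<close>)
    moreover have "(1 - w / x) * x = x - w" using 4 by (simp add: field_simps)
    moreover have "max w 0 - max (w - x) 0 = x - w" using 4 by simp
    ultimately show ?thesis by simp
  qed
qed

section \<open>The candidate density\<close>

locale mean_variance = prob_space M for M :: "'a measure" +
  fixes W :: "'a \<Rightarrow> real" and a s2 :: real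
  assumes W[measurable]: "W \<in> borel_measurable M"
    and integrable_W: "integrable M W" and integrable_W2: "integrable M (\<lambda>x. (W x)\<^sup>2)"
    and mean: "expectation W = a" and variance: "variance W = s2"
    and a2: "a\<^sup>2 < s2"
begin

lemma second_moment: "expectation (\<lambda>x. (W x)\<^sup>2) = s2 + a\<^sup>2"
  using variance_eq[OF integrable_W integrable_W2] variance mean by simp

text \<open>Twice this function, divided by \<open>s2 - a\<^sup>2\<close>, is the only possible density of an
equilibrium variable. It can be negative; then no equilibrium variable exists.\<close>

definition raw_density :: "real \<Rightarrow> real" where
  "raw_density w = a * prob {x \<in> space M. W x \<le> w} + expectation (\<lambda>x. max (w - W x) 0) - max w 0"

lemma integrable_pos_part: "integrable M (\<lambda>x. max (w - W x) 0)" "integrable M (\<lambda>x. max (W x - w) 0)"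
  using integrable_W by auto

lemma expectation_le: "expectation (\<lambda>x. if W x \<le> w then 1 else 0) = prob {x \<in> space M. W x \<le> w}"
proof -
  have "(\<lambda>x. if W x \<le> w then 1 else 0) = (indicator {x. W x \<le> w} :: 'a \<Rightarrow> real)" by (auto simp: indicator_def)
  moreover have "{x. W x \<le> w} \<inter> space M = {x \<in> space M. W x \<le> w}" by auto
  ultimately show ?thesis by simp
qed

lemma integrable_le: "integrable M (\<lambda>x. if W x \<le> w then 1 else 0 :: real)"
  by (intro integrable_const_bound[of _ 1]) auto

text \<open>The two terms of the kernel that carry the indicator of \<open>0 \<le> w\<close> cancel in the mean,
because \<open>W\<close> has mean \<open>a\<close>.\<close>

lemma expectation_kernel: "expectation (\<lambda>x. equilibrium_kernel a w (W x)) = raw_density w"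
proof -
  have "has_bochner_integral M (\<lambda>x. equilibrium_kernel a w (W x))
    (a * (prob {x \<in> space M. W x \<le> w} - (if 0 \<le> w then 1 else 0)) +
     (expectation (\<lambda>x. max (w - W x) 0) - max w 0 + (if 0 \<le> w then a else 0)))"
    unfolding equilibrium_kernel_def
  proof (intro has_bochner_integral_add has_bochner_integral_mult_right has_bochner_integral_diff)
    show "has_bochner_integral M (\<lambda>x. if W x \<le> w then 1 else 0) (prob {x \<in> space M. W x \<le> w})"
      using integrable_le expectation_le by (simp add: has_bochner_integral_iff)
    show "has_bochner_integral M (\<lambda>x. if 0 \<le> w then 1 else 0 :: real) (if 0 \<le> w then 1 else 0)"
      by (simp add: has_bochner_integral_iff prob_space)
    show "has_bochner_integral M (\<lambda>x. max (w - W x) 0) (expectation (\<lambda>x. max (w - W x) 0))"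
      using integrable_pos_part by (simp add: has_bochner_integral_iff)
    show "has_bochner_integral M (\<lambda>x. max w 0) (max w 0)"
      by (simp add: has_bochner_integral_iff prob_space)
    show "has_bochner_integral M (\<lambda>x. if 0 \<le> w then W x else 0) (if 0 \<le> w then a else 0)"
      using integrable_W mean by (simp add: has_bochner_integral_iff)
  qed
  then show ?thesis
    by (cases "0 \<le> w"; simp add: has_bochner_integral_iff raw_density_def algebra_simps)
qed

lemma measurable_raw_density[measurable]: "raw_density \<in> borel_measurable borel"
proof -
  have "raw_density = (\<lambda>w. expectation (\<lambda>x. equilibrium_kernel a w (W x)))" by (simp add: expectation_kernel)
  also have "\<dots> \<in> borel_measurable borel"
    unfolding equilibrium_kernel_def by measurable
  finally show ?thesis .
qed

text \<open>Integrate the kernel representation of \<open>f\<close> over the distribution of \<open>W\<close> and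
exchange the integrals. The bound \<open>G\<close> for \<open>g\<close> between \<open>-
\<bar>x\<bar>\<close> and \<open>\<bar>x\<bar>\<close>, where the kernel lives, gives absolute
integrability.\<close>

lemma integral_raw_density:
  assumes f': "\<And>t. (f has_real_derivative f' t) (at t)"
    and f'': "\<And>t. (f' has_real_derivative g t) (at t)" and g: "continuous_on UNIV g"
    and bound: "\<And>x w. \<bar>w\<bar> \<le> \<bar>x\<bar> \<Longrightarrow> \<bar>g w\<bar> \<le> G x"
    and G: "integrable M (\<lambda>x. G (W x) * \<bar>W x\<bar>)" "integrable M (\<lambda>x. G (W x) * \<bar>W x\<bar>\<^sup>2)"
  shows "integrable lborel (\<lambda>w. g w * raw_density w)"
    and "(\<integral>w. g w * raw_density w \<partial>lborel) = expectation (\<lambda>x. f (W x) - f 0 - a * f' (W x))"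
proof -
  interpret pair: pair_sigma_finite M lborel
    by (intro pair_sigma_finite.intro sigma_finite_lborel) unfold_locales
  have [measurable]: "g \<in> borel_measurable borel" using g by (rule borel_measurable_continuous_onI)
  have kint: "has_bochner_integral lborel (\<lambda>w. g w * equilibrium_kernel a w x)
      (f x - f 0 - a * f' x - f' 0 * (x - a))" for x
    using f' f'' g by (rule integral_kernel)
  have meas[measurable]: "(\<lambda>(x, w). g w * equilibrium_kernel a w (W x)) \<in> borel_measurable (M \<Otimes>\<^sub>M lborel)"
    unfolding equilibrium_kernel_def by measurable
  have bd: "norm (\<integral>w. norm (g w * equilibrium_kernel a w x) \<partial>lborel) \<le> 2 * \<bar>a\<bar> * (G x * \<bar>x\<bar>) + 2 * (G x * \<bar>x\<bar>\<^sup>2)" for x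
  proof -
    have "norm (\<integral>w. norm (g w * equilibrium_kernel a w x) \<partial>lborel) = (\<integral>w. norm (g w * equilibrium_kernel a w x) \<partial>lborel)"
      by simp
    also have "\<dots> \<le> (\<integral>w. G x * (\<bar>a\<bar> + \<bar>x\<bar>) * indicator {-\<bar>x\<bar>..\<bar>x\<bar>} w \<partial>lborel)"
    proof (rule integral_mono)
      show "integrable lborel (\<lambda>w. norm (g w * equilibrium_kernel a w x))"
        using kint by (intro integrable_norm) (auto simp: has_bochner_integral_iff)
      show "norm (g w * equilibrium_kernel a w x) \<le> G x * (\<bar>a\<bar> + \<bar>x\<bar>) * indicator {-\<bar>x\<bar>..\<bar>x\<bar>} w" for w
      proof (cases "\<bar>w\<bar> \<le> \<bar>x\<bar>")
        case True
        have "\<bar>g w\<bar> * \<bar>equilibrium_kernel a w x\<bar> \<le> G x * ((\<bar>a\<bar> + \<bar>x\<bar>) * indicator {-\<bar>x\<bar>..\<bar>x\<bar>} w)"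
          using bound[OF True] by (intro mult_mono equilibrium_kernel_bound) auto
        then show ?thesis by (simp add: abs_mult algebra_simps)
      next
        case False
        then have "indicator {-\<bar>x\<bar>..\<bar>x\<bar>} w = (0::real)" by (auto simp: indicator_def)
        with equilibrium_kernel_bound[of a w x] show ?thesis by simp
      qed
    qed auto
    also have "\<dots> = 2 * \<bar>a\<bar> * (G x * \<bar>x\<bar>) + 2 * (G x * \<bar>x\<bar>\<^sup>2)"
      by (simp add: algebra_simps power2_eq_square)
    finally show ?thesis .
  qed
  have int: "integrable (M \<Otimes>\<^sub>M lborel) (\<lambda>(x, w). g w * equilibrium_kernel a w (W x))"
  proof (rule pair.Fubini_integrable)
    have [measurable]: "(\<lambda>(x, w). norm (g w * equilibrium_kernel a w (W x))) \<in> borel_measurable (M \<Otimes>\<^sub>M lborel)"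
      unfolding equilibrium_kernel_def by measurable
    have "integrable M (\<lambda>x. 2 * \<bar>a\<bar> * (G (W x) * \<bar>W x\<bar>) + 2 * (G (W x) * \<bar>W x\<bar>\<^sup>2))"
      using G by auto
    then show "integrable M (\<lambda>x. \<integral>w. norm (case (x, w) of (x, w) \<Rightarrow> g w * equilibrium_kernel a w (W x)) \<partial>lborel)"
    proof (rule Bochner_Integration.integrable_bound)
      show "AE x in M. norm (\<integral>w. norm (case (x, w) of (x, w) \<Rightarrow> g w * equilibrium_kernel a w (W x)) \<partial>lborel)
        \<le> norm (2 * \<bar>a\<bar> * (G (W x) * \<bar>W x\<bar>) + 2 * (G (W x) * \<bar>W x\<bar>\<^sup>2))"
        using bd by (auto intro!: AE_I2 order_trans[OF _ abs_ge_self])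
    qed simp
    show "AE x in M. integrable lborel (\<lambda>w. case (x, w) of (x, w) \<Rightarrow> g w * equilibrium_kernel a w (W x))"
      using kint by (simp add: has_bochner_integral_iff)
  qed simp
  show "integrable lborel (\<lambda>w. g w * raw_density w)" using pair.integrable_snd[OF int] by (simp add: expectation_kernel)
  have "(\<integral>w. g w * raw_density w \<partial>lborel) = (\<integral>x. (\<integral>w. g w * equilibrium_kernel a w (W x) \<partial>lborel) \<partial>M)"
    using pair.Fubini_integral[OF int] by (simp add: expectation_kernel)
  also have "\<dots> = expectation (\<lambda>x. f (W x) - f 0 - a * f' (W x) - f' 0 * (W x - a))"
    using kint by (simp add: has_bochner_integral_iff)
  also have "\<dots> = expectation (\<lambda>x. (f (W x) - f 0 - a * f' (W x) - f' 0 * (W x - a)) + f' 0 * (W x - a))"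
  proof -
    have "integrable M (\<lambda>x. (f (W x) - f 0 - a * f' (W x) - f' 0 * (W x - a)))"
      using pair.integrable_fst[OF int] kint by (simp add: has_bochner_integral_iff)
    moreover have "integrable M (\<lambda>x. f' 0 * (W x - a))" "expectation (\<lambda>x. f' 0 * (W x - a)) = 0"
      using integrable_W mean by (auto simp: prob_space)
    ultimately show ?thesis by (subst Bochner_Integration.integral_add) auto
  qed
  finally show "(\<integral>w. g w * raw_density w \<partial>lborel) = expectation (\<lambda>x. f (W x) - f 0 - a * f' (W x))"
    by simp
qed

text \<open>Exchange the integral over \<open>v\<close> with the expectation and integrate over \<open>v\<close>
first.\<close>

lemma raw_density_formula_le:
  "raw_density w = a * prob {x \<in> space M. W x \<le> w} - (LBINT v:{0..1}. (\<integral>x. W x * indicator {y. y \<le> w / v} (W x) \<partial>M))"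
  and set_integrable_truncated:
  "set_integrable lborel {0..1} (\<lambda>v. \<integral>x. W x * indicator {y. y \<le> w / v} (W x) \<partial>M)"
proof -
  interpret pair: pair_sigma_finite M lborel
    by (intro pair_sigma_finite.intro sigma_finite_lborel) unfold_locales
  let ?F = "\<lambda>(x, v). indicator {0..1} v * (W x * (if W x \<le> w / v then 1 else 0)) :: real"
  have meas[measurable]: "?F \<in> borel_measurable (M \<Otimes>\<^sub>M lborel)" by measurable
  have int: "integrable (M \<Otimes>\<^sub>M lborel) ?F"
  proof (rule Bochner_Integration.integrable_bound)
    show "integrable (M \<Otimes>\<^sub>M lborel) (\<lambda>(x, v). W x * indicator {0..1::real} v)"
    proof (rule pair.Fubini_integrable)
      show "integrable M (\<lambda>x. \<integral>v. norm (case (x, v) of (x, v) \<Rightarrow> W x * indicator {0..1::real} v) \<partial>lborel)"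
        using integrable_W by (simp add: abs_mult)
    qed (use integrable_W in auto)
  qed (auto simp: indicator_def)
  have eq: "(\<integral>x. ?F (x, v) \<partial>M) = indicator {0..1} v *\<^sub>R (\<integral>x. W x * indicator {y. y \<le> w / v} (W x) \<partial>M)" for v
    by (simp add: indicator_def of_bool_def)
  show "set_integrable lborel {0..1} (\<lambda>v. \<integral>x. W x * indicator {y. y \<le> w / v} (W x) \<partial>M)"
    unfolding set_integrable_def eq[symmetric] using pair.integrable_snd[OF int] by simp
  have "(LBINT v:{0..1}. (\<integral>x. W x * indicator {y. y \<le> w / v} (W x) \<partial>M)) =
      expectation (\<lambda>x. \<integral>v. ?F (x, v) \<partial>lborel)"
    unfolding set_lebesgue_integral_def eq[symmetric] using pair.Fubini_integral[OF int] by simp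
  also have "\<dots> = expectation (\<lambda>x. max w 0 - max (w - W x) 0)"
    using integral_truncated_le[of _ w] by (simp add: has_bochner_integral_iff)
  also have "\<dots> = max w 0 - expectation (\<lambda>x. max (w - W x) 0)"
    using integrable_pos_part by (subst Bochner_Integration.integral_diff) (auto simp: prob_space)
  finally show "raw_density w = a * prob {x \<in> space M. W x \<le> w} -
      (LBINT v:{0..1}. (\<integral>x. W x * indicator {y. y \<le> w / v} (W x) \<partial>M))"
    by (simp add: raw_density_def)
qed

lemma raw_density_formula_gt:
  "raw_density w = (LBINT v:{0..1}. (\<integral>x. W x * indicator {y. y > w / v} (W x) \<partial>M)) - a * prob {x \<in> space M. W x > w}"
proof -
  have "(\<integral>x. W x * indicator {y. y > w / v} (W x) \<partial>M) = a - (\<integral>x. W x * indicator {y. y \<le> w / v} (W x) \<partial>M)" for v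
  proof -
    have "integrable M (\<lambda>x. W x * indicator {y. y \<le> w / v} (W x))"
      by (rule Bochner_Integration.integrable_bound[OF integrable_W]) (auto simp: indicator_def)
    then have "a - (\<integral>x. W x * indicator {y. y \<le> w / v} (W x) \<partial>M) =
        (\<integral>x. W x - W x * indicator {y. y \<le> w / v} (W x) \<partial>M)"
      using integrable_W mean by (subst Bochner_Integration.integral_diff) auto
    also have "\<dots> = (\<integral>x. W x * indicator {y. y > w / v} (W x) \<partial>M)"
      by (intro Bochner_Integration.integral_cong) (auto simp: indicator_def)
    finally show ?thesis by simp
  qed
  then have "(LBINT v:{0..1}. (\<integral>x. W x * indicator {y. y > w / v} (W x) \<partial>M)) =
      (LBINT v:{0..1}. a - (\<integral>x. W x * indicator {y. y \<le> w / v} (W x) \<partial>M))" by simp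
  also have "\<dots> = (LBINT v:{0..1::real}. a) - (LBINT v:{0..1}. (\<integral>x. W x * indicator {y. y \<le> w / v} (W x) \<partial>M))"
    by (intro set_integral_diff set_integrable_truncated) (simp add: set_integrable_def)
  also have "(LBINT v:{0..1::real}. a) = a" by (simp add: set_lebesgue_integral_def)
  finally have 1: "(LBINT v:{0..1}. (\<integral>x. W x * indicator {y. y > w / v} (W x) \<partial>M)) =
    a - (LBINT v:{0..1}. (\<integral>x. W x * indicator {y. y \<le> w / v} (W x) \<partial>M))" .
  have "{x \<in> space M. W x > w} = space M - {x \<in> space M. W x \<le> w}" by auto
  then have "prob {x \<in> space M. W x > w} = 1 - prob {x \<in> space M. W x \<le> w}"
    by (simp add: prob_compl)
  then show ?thesis unfolding raw_density_formula_le 1 by (simp only: right_diff_distrib)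
qed

lemma raw_density_upper: "raw_density w = expectation (\<lambda>x. max (W x - w) 0) - max (- w) 0 - a * prob {x \<in> space M. W x > w}"
proof -
  have "expectation (\<lambda>x. max (w - W x) 0) = expectation (\<lambda>x. max (W x - w) 0 + (w - W x))"
    by (intro Bochner_Integration.integral_cong) (auto simp: max_def)
  also have "\<dots> = expectation (\<lambda>x. max (W x - w) 0) + (w - a)"
    using integrable_W integrable_pos_part mean by (subst Bochner_Integration.integral_add) (auto simp: prob_space)
  finally have "expectation (\<lambda>x. max (w - W x) 0) = expectation (\<lambda>x. max (W x - w) 0) + (w - a)" .
  moreover have "{x \<in> space M. W x > w} = space M - {x \<in> space M. W x \<le> w}" by auto
  then have "prob {x \<in> space M. W x > w} = 1 - prob {x \<in> space M. W x \<le> w}"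
    by (simp add: prob_compl)
  ultimately show ?thesis unfolding raw_density_def by (simp add: right_diff_distrib)
qed

text \<open>Right continuity is inherited from the distribution function of \<open>W\<close>; the other terms are
Lipschitz. It turns statements that hold almost everywhere into statements that hold everywhere.\<close>

lemma raw_density_right_continuous: "(raw_density \<longlongrightarrow> raw_density w) (at_right w)"
proof -
  let ?D = "distr M borel W"
  interpret D: real_distribution ?D by (rule real_distribution_distr) simp
  have cdf: "cdf ?D w = prob {x \<in> space M. W x \<le> w}" for w
    by (auto simp: cdf_def measure_distr intro!: arg_cong[where f = prob])
  have 1: "((\<lambda>w. prob {x \<in> space M. W x \<le> w}) \<longlongrightarrow> prob {x \<in> space M. W x \<le> w}) (at_right w)"
    using D.cdf_is_right_cont[of w] unfolding continuous_within cdf .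
  have lip: "\<bar>expectation (\<lambda>x. max (s - W x) 0) - expectation (\<lambda>x. max (t - W x) 0)\<bar> \<le> \<bar>s - t\<bar>" for s t
  proof -
    have "expectation (\<lambda>x. max (s - W x) 0) - expectation (\<lambda>x. max (t - W x) 0) =
        expectation (\<lambda>x. max (s - W x) 0 - max (t - W x) 0)"
      using integrable_pos_part by simp
    also have "\<bar>\<dots>\<bar> \<le> expectation (\<lambda>x. \<bar>max (s - W x) 0 - max (t - W x) 0\<bar>)"
      by (rule integral_abs_bound)
    also have "\<dots> \<le> expectation (\<lambda>x. \<bar>s - t\<bar>)"
      using integrable_pos_part by (intro integral_mono) auto
    finally show ?thesis by (simp add: prob_space)
  qed
  have "1-lipschitz_on UNIV (\<lambda>s. expectation (\<lambda>x. max (s - W x) 0))"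
    using lip by (intro lipschitz_onI) (auto simp: dist_real_def)
  then have "isCont (\<lambda>s. expectation (\<lambda>x. max (s - W x) 0)) w"
    using lipschitz_on_continuous_on continuous_on_eq_continuous_at[OF open_UNIV] by blast
  then have 2: "((\<lambda>s. expectation (\<lambda>x. max (s - W x) 0)) \<longlongrightarrow> expectation (\<lambda>x. max (w - W x) 0)) (at_right w)"
    unfolding isCont_def by (rule tendsto_within_subset) simp
  show ?thesis unfolding raw_density_def by (intro tendsto_intros 1 2)
qed

definition equilibrium_density :: "real \<Rightarrow> real" where "equilibrium_density w = 2 / (s2 - a\<^sup>2) * raw_density w"

lemma measurable_equilibrium_density[measurable]: "equilibrium_density \<in> borel_measurable borel" unfolding equilibrium_density_def by measurable

end


section \<open>The density of an equilibrium variable\<close>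

text \<open>Applied twice, this produces a test function with a prescribed continuous second derivative.\<close>

lemma continuous_antiderivative:
  assumes g: "continuous_on UNIV (g :: real \<Rightarrow> real)"
  obtains F where "\<And>t. (F has_real_derivative g t) (at t)"
proof -
  have "isCont g t" for t using g by (simp add: continuous_on_eq_continuous_at)
  then obtain F where "\<And>t. (F has_vector_derivative g t) (at t)"
    using einterval_antiderivative[of "-\<infinity>" "\<infinity>" g] by auto
  then show ?thesis by (intro that) (simp add: has_real_derivative_iff_has_vector_derivative)
qed

lemma DERIV_linear_growth:
  assumes F: "\<And>t. (F has_real_derivative g t) (at t)" and g: "\<And>t. \<bar>t\<bar> \<le> \<bar>x\<bar> \<Longrightarrow> \<bar>g t\<bar> \<le> B"
  shows "\<bar>F x\<bar> \<le> \<bar>F 0\<bar> + B * \<bar>x\<bar>"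
proof -
  have "norm (F x - F 0) \<le> B * norm (x - 0)"
  proof (rule field_differentiable_bound)
    show "convex (cball 0 \<bar>x\<bar> :: real set)" by simp
    show "(F has_field_derivative g t) (at t within cball 0 \<bar>x\<bar>)" for t
      using F by (rule has_field_derivative_at_within)
    show "norm (g t) \<le> B" if "t \<in> cball 0 \<bar>x\<bar>" for t using g that by simp
  qed auto
  then show ?thesis by simp
qed

locale equilibrium_variable = mean_variance M W a s2
  for M :: "'a measure" and W a s2 +
  fixes N :: "'b measure" and WA :: "'b \<Rightarrow> real"
  assumes equilibrium: "asym_equilibrium M W N WA"
begin

sublocale N: prob_space N using equilibrium by (simp add: asym_equilibrium_def)

lemma WA[measurable]: "WA \<in> borel_measurable N" using equilibrium by (simp add: asym_equilibrium_def)

lemma gap_pos: "0 < s2 - a\<^sup>2" using a2 by simp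

lemma equilibrium_eq:
  assumes f': "\<And>t. (f has_real_derivative f' t) (at t)"
    and f'': "\<And>t. (f' has_real_derivative g t) (at t)" and g: "continuous_on UNIV g"
    and "integrable M (\<lambda>x. f (W x))" "integrable M (\<lambda>x. f' (W x))" "integrable N (\<lambda>y. g (WA y))"
  shows "(s2 - a\<^sup>2) / 2 * N.expectation (\<lambda>y. g (WA y)) = expectation (\<lambda>x. f (W x) - f 0 - a * f' (W x))"
proof -
  have d: "deriv f = f'" "deriv f' = g" using f' f'' by (auto intro!: DERIV_imp_deriv)
  have "continuous_on UNIV f'" using f'' by (meson DERIV_isCont continuous_at_imp_continuous_on)
  then have lac: "locally_abs_cont f" "locally_abs_cont f'"
    using f' f'' g by (auto intro: locally_abs_cont_C1)
  have "\<forall>t. f differentiable (at t)" using f' by (auto simp: real_differentiable_def)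
  then have "(variance W - (expectation W)\<^sup>2) / 2 * N.expectation (\<lambda>y. deriv (deriv f) (WA y)) =
      expectation (\<lambda>x. f (W x) - f 0 - expectation W * deriv f (W x))"
    using equilibrium assms(4-6) lac unfolding asym_equilibrium_def d[symmetric] by blast
  then show ?thesis unfolding variance unfolding mean d .
qed

text \<open>A second antiderivative of a bounded function grows at most quadratically, so it is an admissible test
function. The defining equation and the kernel representation then evaluate the same expectation.\<close>

lemma integral_bounded_test:
  assumes g: "continuous_on UNIV g" and B: "\<And>t. \<bar>g t\<bar> \<le> B"
  shows "(s2 - a\<^sup>2) / 2 * N.expectation (\<lambda>y. g (WA y)) = (\<integral>w. g w * raw_density w \<partial>lborel)"
    and "integrable lborel (\<lambda>w. g w * raw_density w)"
proof -
  obtain f' where f'': "\<And>t. (f' has_real_derivative g t) (at t)" using continuous_antiderivative[OF g] by metis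
  have cf': "continuous_on UNIV f'" using f'' by (meson DERIV_isCont continuous_at_imp_continuous_on)
  obtain f where f': "\<And>t. (f has_real_derivative f' t) (at t)" using continuous_antiderivative[OF cf'] by metis
  have [measurable]: "g \<in> borel_measurable borel" "f' \<in> borel_measurable borel" "f \<in> borel_measurable borel"
    using g cf' f' by (auto intro!: borel_measurable_continuous_onI) (meson DERIV_isCont continuous_at_imp_continuous_on)
  have B0: "0 \<le> B" using B[of 0] by linarith
  have b1: "\<bar>f' x\<bar> \<le> \<bar>f' 0\<bar> + B * \<bar>x\<bar>" for x by (rule DERIV_linear_growth[OF f'' B])
  have b2: "\<bar>f x\<bar> \<le> \<bar>f 0\<bar> + (\<bar>f' 0\<bar> + B * \<bar>x\<bar>) * \<bar>x\<bar>" for x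
  proof (rule DERIV_linear_growth[OF f'])
    fix t assume "\<bar>t\<bar> \<le> \<bar>x\<bar>"
    then have "B * \<bar>t\<bar> \<le> B * \<bar>x\<bar>" using B0 by (intro mult_left_mono)
    with b1[of t] show "\<bar>f' t\<bar> \<le> \<bar>f' 0\<bar> + B * \<bar>x\<bar>" by linarith
  qed
  have i1: "integrable M (\<lambda>x. \<bar>f' 0\<bar> + B * \<bar>W x\<bar>)" using integrable_W by auto
  have i2: "integrable M (\<lambda>x. \<bar>f 0\<bar> + (\<bar>f' 0\<bar> * \<bar>W x\<bar> + B * (W x)\<^sup>2))"
    using integrable_W integrable_W2 by auto
  have int: "integrable M (\<lambda>x. f' (W x))" "integrable M (\<lambda>x. f (W x))"
  proof -
    show "integrable M (\<lambda>x. f' (W x))"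
      by (rule Bochner_Integration.integrable_bound[OF i1]) (use b1 in \<open>auto intro: order_trans[OF _ abs_ge_self]\<close>)
    have "\<bar>f x\<bar> \<le> \<bar>\<bar>f 0\<bar> + (\<bar>f' 0\<bar> * \<bar>x\<bar> + B * x\<^sup>2)\<bar>" for x
      using b2[of x] by (simp add: algebra_simps power2_eq_square)
    then show "integrable M (\<lambda>x. f (W x))"
      by (intro Bochner_Integration.integrable_bound[OF i2]) auto
  qed
  have "integrable N (\<lambda>y. g (WA y))" by (rule N.integrable_const_bound[of _ B]) (use B in auto)
  then have "(s2 - a\<^sup>2) / 2 * N.expectation (\<lambda>y. g (WA y)) = expectation (\<lambda>x. f (W x) - f 0 - a * f' (W x))"
    using int f' f'' g by (intro equilibrium_eq) auto
  moreover have "(\<integral>w. g w * raw_density w \<partial>lborel) = expectation (\<lambda>x. f (W x) - f 0 - a * f' (W x))"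
    by (rule integral_raw_density(2)[OF f' f'' g, of "\<lambda>_. B"]) (use B integrable_W integrable_W2 in auto)
  ultimately show "(s2 - a\<^sup>2) / 2 * N.expectation (\<lambda>y. g (WA y)) = (\<integral>w. g w * raw_density w \<partial>lborel)" by simp
  show "integrable lborel (\<lambda>w. g w * raw_density w)"
    by (rule integral_raw_density(1)[OF f' f'' g, of "\<lambda>_. B"]) (use B integrable_W integrable_W2 in auto)
qed

lemma integrable_raw_density: "integrable lborel raw_density"
  using integral_bounded_test(2)[of "\<lambda>_. 1" 1] by simp

lemma total_mass_raw_density: "(\<integral>w. raw_density w \<partial>lborel) = (s2 - a\<^sup>2) / 2"
  using integral_bounded_test(1)[of "\<lambda>_. 1" 1] by (simp add: N.prob_space)

text \<open>Approximate the indicator of \<open>{..u}\<close> from above by continuous ramps.\<close>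

lemma distribution_function:
  "(s2 - a\<^sup>2) / 2 * N.prob {y \<in> space N. WA y \<le> u} = (LBINT w:{..u}. raw_density w)"
proof -
  define g where "g n = cts_step u (u + 1 / real (Suc n))" for n
  have g01: "0 \<le> g n w \<and> g n w \<le> 1" for n w
    by (auto simp: g_def cts_step_def divide_simps)
  have gc: "continuous_on UNIV (g n)" for n
    unfolding g_def by (intro uniformly_continuous_imp_continuous cts_step_uniformly_continuous) simp
  then have [measurable]: "g n \<in> borel_measurable borel" for n by (rule borel_measurable_continuous_onI)
  have lim: "(\<lambda>n. g n w) \<longlonglongrightarrow> indicator {..u} w" for w
  proof (cases "w \<le> u")
    case False
    then obtain k :: nat where k: "1 / Suc k < w - u" using nat_approx_posE[of "w - u"] by auto
    have "g n w = 0" if "n \<ge> k" for n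
    proof -
      have "1 / real (Suc n) \<le> 1 / Suc k" using that by (intro divide_left_mono) auto
      with k False show ?thesis by (simp add: g_def cts_step_def)
    qed
    then have "\<forall>\<^sub>F n in sequentially. g n w = 0" by (auto simp: eventually_sequentially)
    then show ?thesis using False by (simp add: tendsto_eventually)
  qed (simp add: g_def cts_step_def)
  have "(\<lambda>n. N.expectation (\<lambda>y. g n (WA y))) \<longlonglongrightarrow> N.expectation (\<lambda>y. indicator {..u} (WA y))"
    by (rule integral_dominated_convergence[where w = "\<lambda>_. 1"]) (use lim g01 in \<open>auto simp: abs_le_iff intro: order_trans[of _ 0]\<close>)
  then have l1: "(\<lambda>n. (s2 - a\<^sup>2) / 2 * N.expectation (\<lambda>y. g n (WA y))) \<longlonglongrightarrow>
      (s2 - a\<^sup>2) / 2 * N.expectation (\<lambda>y. indicator {..u} (WA y))" by (rule tendsto_mult_left)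
  have l2: "(\<lambda>n. \<integral>w. g n w * raw_density w \<partial>lborel) \<longlonglongrightarrow> (\<integral>w. indicator {..u} w * raw_density w \<partial>lborel)"
  proof (rule integral_dominated_convergence[where w = "\<lambda>w. \<bar>raw_density w\<bar>"])
    show "AE w in lborel. (\<lambda>n. g n w * raw_density w) \<longlonglongrightarrow> indicator {..u} w * raw_density w"
      using lim by (auto intro!: tendsto_mult_right)
    show "AE w in lborel. norm (g n w * raw_density w) \<le> \<bar>raw_density w\<bar>" for n
      using g01 by (auto simp: abs_mult intro!: mult_left_le_one_le)
  qed (use integrable_raw_density in auto)
  have e: "(s2 - a\<^sup>2) / 2 * N.expectation (\<lambda>y. g n (WA y)) = (\<integral>w. g n w * raw_density w \<partial>lborel)" for n
    using gc g01[of n] by (intro integral_bounded_test(1)[of _ 1]) (auto simp: abs_le_iff intro: order_trans[of _ 0])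
  have "(s2 - a\<^sup>2) / 2 * N.expectation (\<lambda>y. indicator {..u} (WA y)) = (\<integral>w. indicator {..u} w * raw_density w \<partial>lborel)"
    using l1 l2 unfolding e by (rule LIMSEQ_unique)
  moreover have "N.expectation (\<lambda>y. indicator {..u} (WA y)) = N.prob {y \<in> space N. WA y \<le> u}"
  proof -
    have "(\<lambda>y. indicator {..u} (WA y)) = (indicator {y. WA y \<le> u} :: 'b \<Rightarrow> real)" by (auto simp: indicator_def)
    moreover have "{y. WA y \<le> u} \<inter> space N = {y \<in> space N. WA y \<le> u}" by auto
    ultimately show ?thesis by simp
  qed
  ultimately show ?thesis by (simp add: set_lebesgue_integral_def)
qed

text \<open>A negative value would, by right continuity, make the distribution function decrease on a short
interval.\<close>

lemma raw_density_nonneg: "0 \<le> raw_density w"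
proof (rule ccontr)
  assume "\<not> 0 \<le> raw_density w"
  then have neg: "raw_density w < raw_density w / 2" "raw_density w / 2 < 0" by auto
  then have "\<forall>\<^sub>F v in at_right w. raw_density v < raw_density w / 2" using raw_density_right_continuous by (intro order_tendstoD(2))
  then obtain b where b: "w < b" "\<And>v. w < v \<Longrightarrow> v < b \<Longrightarrow> raw_density v < raw_density w / 2"
    unfolding eventually_at_right_field by auto
  define c where "c = (w + b) / 2"
  have c: "w < c" "c < b" using b(1) by (auto simp: c_def)
  have "N.prob {y \<in> space N. WA y \<le> w} \<le> N.prob {y \<in> space N. WA y \<le> c}"
    using c by (intro N.finite_measure_mono) auto
  then have "(LBINT v:{..w}. raw_density v) \<le> (LBINT v:{..c}. raw_density v)"
    unfolding distribution_function[symmetric] using gap_pos by (intro mult_left_mono) auto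
  then have "0 \<le> (LBINT v:{w..c}. raw_density v)"
    using increment_eq_integral[OF integrable_raw_density, of w c] c by simp
  also have "(LBINT v:{w..c}. raw_density v) \<le> (LBINT v:{w..c}. raw_density w / 2)"
  proof (rule set_integral_mono)
    show "set_integrable lborel {w..c} raw_density" by (rule set_integrable_of_integrable[OF integrable_raw_density]) simp
    show "set_integrable lborel {w..c} (\<lambda>_. raw_density w / 2)"
      by (intro borel_integrable_atLeastAtMost' continuous_intros)
    show "raw_density v \<le> raw_density w / 2" if "v \<in> {w..c}" for v
      using that b(2)[of v] c neg by (cases "v = w") auto
  qed
  also have "(LBINT v:{w..c}. raw_density w / 2) = (c - w) * (raw_density w / 2)"
    using c by (simp add: set_lebesgue_integral_def)
  also have "\<dots> < 0" using c neg by (intro mult_pos_neg) auto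
  finally show False by simp
qed

lemma equilibrium_density_nonneg: "0 \<le> equilibrium_density w" using raw_density_nonneg gap_pos by (simp add: equilibrium_density_def)

lemma equilibrium_density_eq_0_iff: "equilibrium_density w = 0 \<longleftrightarrow> raw_density w = 0" using gap_pos by (simp add: equilibrium_density_def)

text \<open>Two probability distributions with the same distribution function agree.\<close>

lemma distributed_WA: "distributed N lborel WA (\<lambda>w. ennreal (equilibrium_density w))"
proof -
  let ?\<nu> = "density lborel (\<lambda>w. ennreal (equilibrium_density w))"
  have int_p: "integrable lborel equilibrium_density" using integrable_raw_density unfolding equilibrium_density_def[abs_def] by auto
  have "(\<integral>w. equilibrium_density w \<partial>lborel) = 1" using total_mass_raw_density gap_pos by (simp add: equilibrium_density_def)
  then have "emeasure ?\<nu> (space ?\<nu>) = 1"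
    using nn_integral_eq_integral[OF int_p] equilibrium_density_nonneg by (simp add: emeasure_density)
  then interpret \<nu>: real_distribution ?\<nu>
    by (auto simp: real_distribution_def real_distribution_axioms_def intro: prob_spaceI)
  have "distr N borel WA = ?\<nu>"
  proof (rule cdf_unique)
    show "real_distribution (distr N borel WA)" by (rule N.real_distribution_distr) simp
    show "cdf (distr N borel WA) = cdf ?\<nu>"
    proof
      fix u
      have "cdf (distr N borel WA) u = N.prob {y \<in> space N. WA y \<le> u}"
        by (auto simp: cdf_def measure_distr intro!: arg_cong[where f = N.prob])
      also have "\<dots> = (LBINT w:{..u}. equilibrium_density w)"
        using distribution_function[of u] gap_pos by (simp add: equilibrium_density_def set_lebesgue_integral_def field_simps)
      also have "\<dots> = cdf ?\<nu> u"
      proof -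
        have "emeasure ?\<nu> {..u} = (\<integral>\<^sup>+w. ennreal (indicator {..u} w *\<^sub>R equilibrium_density w) \<partial>lborel)"
          by (subst emeasure_density) (auto intro!: nn_integral_cong simp: indicator_def)
        also have "\<dots> = ennreal (LBINT w:{..u}. equilibrium_density w)"
          unfolding set_lebesgue_integral_def using int_p equilibrium_density_nonneg
          by (intro nn_integral_eq_integral integrable_mult_indicator) auto
        finally show ?thesis
          using equilibrium_density_nonneg by (simp add: cdf_def measure_def set_lebesgue_integral_def)
      qed
      finally show "cdf (distr N borel WA) u = cdf ?\<nu> u" .
    qed
  qed unfold_locales
  moreover have "distr N lborel WA = distr N borel WA" by (rule distr_cong) auto
  ultimately show ?thesis by (simp add: distributed_def)
qed

lemma distr_WA: "distr N borel WA = density lborel (\<lambda>w. ennreal (equilibrium_density w))"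
proof -
  have "distr N borel WA = distr N lborel WA" by (rule distr_cong) auto
  then show ?thesis using distributed_distr_eq_density[OF distributed_WA] by simp
qed

lemma AE_WA:
  assumes "AE w in lborel. P w" and [measurable]: "Measurable.pred borel P"
  shows "AE y in N. P (WA y)"
proof -
  have "AE w in distr N borel WA. P w"
    unfolding distr_WA using assms(1) by (subst AE_density) (auto elim: eventually_mono)
  then show ?thesis by (subst (asm) AE_distr_iff) auto
qed

text \<open>With the density at hand, the defining equation extends to test functions whose second derivative is not
bounded, and the integrability of \<open>g (WA y)\<close> becomes a conclusion.\<close>

lemma moment_identity:
  assumes f': "\<And>t. (f has_real_derivative f' t) (at t)"
    and f'': "\<And>t. (f' has_real_derivative g t) (at t)" and g: "continuous_on UNIV g"
    and bound: "\<And>x w. \<bar>w\<bar> \<le> \<bar>x\<bar> \<Longrightarrow> \<bar>g w\<bar> \<le> G x"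
    and G: "integrable M (\<lambda>x. G (W x) * \<bar>W x\<bar>)" "integrable M (\<lambda>x. G (W x) * \<bar>W x\<bar>\<^sup>2)"
  shows "integrable N (\<lambda>y. g (WA y))"
    and "N.expectation (\<lambda>y. g (WA y)) = 2 / (s2 - a\<^sup>2) * expectation (\<lambda>x. f (W x) - f 0 - a * f' (W x))"
proof -
  have [measurable]: "g \<in> borel_measurable borel" using g by (rule borel_measurable_continuous_onI)
  have "integrable lborel (\<lambda>w. 2 / (s2 - a\<^sup>2) * (g w * raw_density w))"
    using integral_raw_density(1)[OF assms] by (intro integrable_mult_right) auto
  then show "integrable N (\<lambda>y. g (WA y))"
    using distributed_integrable[OF distributed_WA, of g] equilibrium_density_nonneg by (simp add: equilibrium_density_def mult_ac)
  have "N.expectation (\<lambda>y. g (WA y)) = (\<integral>w. equilibrium_density w * g w \<partial>lborel)"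
    using distributed_integral[OF distributed_WA, of g] equilibrium_density_nonneg by simp
  also have "\<dots> = (\<integral>w. 2 / (s2 - a\<^sup>2) * (g w * raw_density w) \<partial>lborel)" by (simp add: equilibrium_density_def mult_ac)
  also have "\<dots> = 2 / (s2 - a\<^sup>2) * (\<integral>w. g w * raw_density w \<partial>lborel)" by simp
  finally show "N.expectation (\<lambda>y. g (WA y)) = 2 / (s2 - a\<^sup>2) * expectation (\<lambda>x. f (W x) - f 0 - a * f' (W x))"
    using integral_raw_density(2)[OF assms] by simp
qed

end


section \<open>Supports\<close>

text \<open>The complement of the support is a union of open null sets; by Lindelof countably many of them suffice.\<close>

lemma AE_in_rv_support:
  assumes "finite_measure M" and [measurable]: "W \<in> borel_measurable M"
  shows "AE x in M. W x \<in> rv_support M W"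
proof -
  interpret finite_measure M by fact
  define \<U> where "\<U> = {U. open U \<and> measure M (W -` U \<inter> space M) = 0}"
  obtain \<V> where V: "\<V> \<subseteq> \<U>" "countable \<V>" "\<Union>\<V> = \<Union>\<U>"
    using Lindelof[of \<U>] by (auto simp: \<U>_def)
  have "- rv_support M W = \<Union>\<U>"
    by (auto simp: rv_support_def \<U>_def zero_less_measure_iff)
  moreover have "AE x in M. \<forall>U\<in>\<V>. W x \<notin> U"
  proof (rule AE_ball_countable'[OF _ V(2)])
    fix U assume "U \<in> \<V>"
    then have U: "open U" "emeasure M (W -` U \<inter> space M) = 0"
      using V(1) by (auto simp: \<U>_def emeasure_eq_measure)
    then have "W -` U \<inter> space M \<in> null_sets M" by (auto intro!: null_setsI)
    then show "AE x in M. W x \<notin> U" by (auto dest!: AE_not_in elim: AE_mp)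
  qed
  ultimately show ?thesis using V(3) by (auto elim!: eventually_mono)
qed

lemma closed_support_hull: "closed (support_hull M W)"
  unfolding support_hull_def
  by (intro closed_Collect_conj closed_Collect_le continuous_on_ereal continuous_intros)

context mean_variance
begin

lemma support_bounds:
  "x \<in> rv_support M W \<Longrightarrow> support_inf M W \<le> ereal x" "x \<in> rv_support M W \<Longrightarrow> ereal x \<le> support_sup M W"
  unfolding support_inf_def support_sup_def by (auto intro: INF_lower SUP_upper)

lemma AE_support: "AE x in M. W x \<in> rv_support M W"
  by (rule AE_in_rv_support) (auto intro: finite_measure_axioms)

text \<open>A support with at most one point would force variance zero, whereas \<open>s2 > a\<^sup>2\<close>.\<close>

lemma two_support_points:
  obtains x y where "x \<in> rv_support M W" "y \<in> rv_support M W" "x < y"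
proof -
  have "\<exists>x. x \<in> rv_support M W"
  proof (rule ccontr)
    assume "\<nexists>x. x \<in> rv_support M W"
    then have "AE x in M. False" using AE_support by simp
    then show False by simp
  qed
  then obtain x where x: "x \<in> rv_support M W" by auto
  have "\<exists>y. y \<in> rv_support M W \<and> y \<noteq> x"
  proof (rule ccontr)
    assume "\<nexists>y. y \<in> rv_support M W \<and> y \<noteq> x"
    then have AE: "AE z in M. W z = x" using AE_support by (auto elim: eventually_mono)
    then have "expectation W = expectation (\<lambda>_. x)" by (intro integral_cong_AE) auto
    then have "a = x" by (simp add: mean prob_space)
    have "variance W = expectation (\<lambda>_. 0)"
      using AE by (intro integral_cong_AE) (auto elim!: eventually_mono simp: mean \<open>a = x\<close>)
    then have "s2 = 0" unfolding variance by simp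
    then show False using a2 by (simp add: not_less[symmetric])
  qed
  with x show ?thesis using that by (metis linorder_neqE)
qed

lemma expectation_pos:
  fixes Z :: "'a \<Rightarrow> real"
  assumes Z: "integrable M Z" "\<And>x. 0 \<le> Z x" and S: "0 < prob S" "S \<in> events" "\<And>x. x \<in> S \<Longrightarrow> 0 < Z x"
  shows "0 < expectation Z"
proof -
  have "expectation Z \<noteq> 0"
  proof
    assume "expectation Z = 0"
    then have "AE x in M. Z x = 0" using integral_nonneg_eq_0_iff_AE[OF Z(1)] Z(2) by simp
    then have "AE x in M. x \<notin> S" by eventually_elim (use S(3) in fastforce)
    then have "prob S = 0" using S(2) by (subst prob_eq_0) auto
    with S(1) show False by simp
  qed
  moreover have "0 \<le> expectation Z" using Z(2) by (intro Bochner_Integration.integral_nonneg) auto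
  ultimately show ?thesis by linarith
qed

lemma above_support_inf:
  assumes "support_inf M W < ereal w"
  shows "0 < expectation (\<lambda>x. max (w - W x) 0)" "0 < prob {x \<in> space M. W x \<le> w}"
proof -
  obtain s where s: "s \<in> rv_support M W" "s < w"
    using assms unfolding support_inf_def by (auto simp: INF_less_iff)
  have pos: "0 < prob (W -` {..<w} \<inter> space M)"
    using s unfolding rv_support_def by auto
  also have "\<dots> \<le> prob {x \<in> space M. W x \<le> w}" by (intro finite_measure_mono) auto
  finally show "0 < prob {x \<in> space M. W x \<le> w}" .
  show "0 < expectation (\<lambda>x. max (w - W x) 0)"
    by (rule expectation_pos[OF _ _ pos]) (use integrable_pos_part in auto)
qed

lemma below_support_sup:
  assumes "ereal w < support_sup M W"
  shows "0 < expectation (\<lambda>x. max (W x - w) 0)" "0 < prob {x \<in> space M. W x > w}"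
proof -
  obtain s where s: "s \<in> rv_support M W" "w < s"
    using assms unfolding support_sup_def by (auto simp: less_SUP_iff)
  have pos: "0 < prob (W -` {w<..} \<inter> space M)"
    using s unfolding rv_support_def by auto
  also have "\<dots> \<le> prob {x \<in> space M. W x > w}" by (intro finite_measure_mono) auto
  finally show "0 < prob {x \<in> space M. W x > w}" .
  show "0 < expectation (\<lambda>x. max (W x - w) 0)"
    by (rule expectation_pos[OF _ _ pos]) (use integrable_pos_part in auto)
qed

lemma lower_tail_eq_0:
  assumes "AE x in M. w < W x"
  shows "prob {x \<in> space M. W x \<le> w} = 0" "expectation (\<lambda>x. max (w - W x) 0) = 0"
proof -
  have "AE x in M. x \<notin> {x \<in> space M. W x \<le> w}" using assms by eventually_elim auto
  then show "prob {x \<in> space M. W x \<le> w} = 0" by (subst prob_eq_0) auto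
  have "expectation (\<lambda>x. max (w - W x) 0) = expectation (\<lambda>x. 0)"
    using assms by (intro integral_cong_AE) (auto elim!: eventually_mono)
  then show "expectation (\<lambda>x. max (w - W x) 0) = 0" by simp
qed

lemma upper_tail_eq_0:
  assumes "AE x in M. W x \<le> w"
  shows "prob {x \<in> space M. W x > w} = 0" "expectation (\<lambda>x. max (W x - w) 0) = 0"
proof -
  have "AE x in M. x \<notin> {x \<in> space M. W x > w}" using assms by eventually_elim auto
  then show "prob {x \<in> space M. W x > w} = 0" by (subst prob_eq_0) auto
  have "expectation (\<lambda>x. max (W x - w) 0) = expectation (\<lambda>x. 0)"
    using assms by (intro integral_cong_AE) (auto elim!: eventually_mono)
  then show "expectation (\<lambda>x. max (W x - w) 0) = 0" by simp
qed

text \<open>To the left of the origin both terms of the density are nonnegative when \<open>a\<close> is, and the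
expected excess is positive as soon as \<open>w\<close> exceeds the infimum of the support.\<close>

lemma raw_density_pos_below:
  assumes "0 \<le> a" "support_inf M W < ereal w" "w < 0"
  shows "0 < raw_density w"
proof -
  have "0 \<le> a * prob {x \<in> space M. W x \<le> w}" using assms(1) by simp
  with above_support_inf(1)[OF assms(2)] assms(3) show ?thesis unfolding raw_density_def by (simp add: max_def)
qed

lemma raw_density_pos_above:
  assumes "a \<le> 0" "ereal w < support_sup M W" "0 \<le> w"
  shows "0 < raw_density w"
proof -
  have "a * prob {x \<in> space M. W x > w} \<le> 0" using assms(1) by (simp add: mult_nonpos_nonneg)
  with below_support_sup(1)[OF assms(2)] assms(3) show ?thesis unfolding raw_density_upper by (simp add: max_def)
qed

end

context equilibrium_variable
begin

lemma prob_eq_0_iff: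
  assumes [measurable]: "S \<in> sets borel"
  shows "N.prob (WA -` S \<inter> space N) = 0 \<longleftrightarrow> (AE w in lborel. w \<in> S \<longrightarrow> raw_density w = 0)"
proof -
  have "N.prob (WA -` S \<inter> space N) = 0 \<longleftrightarrow> emeasure N (WA -` S \<inter> space N) = 0"
    by (simp add: N.emeasure_eq_measure)
  also have "\<dots> \<longleftrightarrow> (\<integral>\<^sup>+w. ennreal (equilibrium_density w) * indicator S w \<partial>lborel) = 0"
    by (subst distributed_emeasure[OF distributed_WA]) auto
  also have "\<dots> \<longleftrightarrow> (AE w in lborel. ennreal (equilibrium_density w) * indicator S w = 0)"
    by (rule nn_integral_0_iff_AE) auto
  also have "\<dots> \<longleftrightarrow> (AE w in lborel. w \<in> S \<longrightarrow> raw_density w = 0)"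
  proof (intro AE_cong)
    fix w
    have "ennreal (equilibrium_density w) = 0 \<longleftrightarrow> raw_density w = 0" using equilibrium_density_nonneg[of w] by (simp add: ennreal_eq_0_iff equilibrium_density_eq_0_iff[symmetric])
    then show "ennreal (equilibrium_density w) * indicator S w = 0 \<longleftrightarrow> (w \<in> S \<longrightarrow> raw_density w = 0)" by (auto simp: indicator_def)
  qed
  finally show ?thesis .
qed

text \<open>A nonzero value of the density is positive, and by right continuity the density is positive on an
interval.\<close>

lemma in_support_WA_iff: "x \<in> rv_support N WA \<longleftrightarrow> (\<forall>U. open U \<and> x \<in> U \<longrightarrow> (\<exists>y\<in>U. raw_density y \<noteq> 0))"
proof -
  have "0 < N.prob (WA -` U \<inter> space N) \<longleftrightarrow> (\<exists>y\<in>U. raw_density y \<noteq> 0)" if U: "open U" for U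
  proof
    assume "0 < N.prob (WA -` U \<inter> space N)"
    then have "\<not> (AE w in lborel. w \<in> U \<longrightarrow> raw_density w = 0)"
      using prob_eq_0_iff[of U] U by auto
    then show "\<exists>y\<in>U. raw_density y \<noteq> 0" by auto
  next
    assume "\<exists>y\<in>U. raw_density y \<noteq> 0"
    then obtain y where y: "y \<in> U" "0 < raw_density y" using raw_density_nonneg by (metis less_eq_real_def)
    have "\<forall>\<^sub>F v in at_right y. 0 < raw_density v" using raw_density_right_continuous y by (intro order_tendstoD(1))
    moreover have "\<forall>\<^sub>F v in at_right y. v \<in> U"
      using U y by (intro eventually_at_in_open'[THEN filter_leD[OF at_le, rotated]]) auto
    ultimately have "\<forall>\<^sub>F v in at_right y. 0 < raw_density v \<and> v \<in> U" by (rule eventually_conj)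
    then obtain b where b: "y < b" "\<And>v. y < v \<Longrightarrow> v < b \<Longrightarrow> 0 < raw_density v \<and> v \<in> U"
      unfolding eventually_at_right_field by auto
    have "\<not> (AE w in lborel. w \<in> U \<longrightarrow> raw_density w = 0)"
    proof
      assume "AE w in lborel. w \<in> U \<longrightarrow> raw_density w = 0"
      then have "AE w in lborel. w \<notin> {y<..<b}" by eventually_elim (use b in force)
      then have "{y<..<b} \<in> null_sets lborel" by (simp add: AE_iff_null_sets)
      then have "emeasure lborel {y<..<b} = 0" by (rule null_setsD1)
      with b(1) show False by simp
    qed
    then have "N.prob (WA -` U \<inter> space N) \<noteq> 0" using prob_eq_0_iff[of U] U by auto
    then show "0 < N.prob (WA -` U \<inter> space N)" by (simp add: zero_less_measure_iff)
  qed
  then show ?thesis by (auto simp: rv_support_def)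
qed

text \<open>Outside the hull the formula leaves only \<open>- max x 0\<close> or \<open>- max (- x) 0\<close>.
Together with nonnegativity this also shows that the hull contains the origin.\<close>

lemma raw_density_eq_0_outside:
  assumes "x \<notin> support_hull M W"
  shows "raw_density x = 0"
proof -
  consider "ereal x < support_inf M W" | "support_sup M W < ereal x"
    using assms by (auto simp: support_hull_def not_le)
  then have "raw_density x \<le> 0"
  proof cases
    case 1
    have "AE z in M. x < W z"
      using AE_support by eventually_elim (use 1 support_bounds(1) in \<open>metis ereal_less(2) ereal_less_eq(3) less_le_trans not_less\<close>)
    from lower_tail_eq_0[OF this] show ?thesis by (simp add: raw_density_def)
  next
    case 2
    have "AE z in M. W z \<le> x"
      using AE_support by eventually_elim (use 2 support_bounds(2) in \<open>metis ereal_less_eq(3) less_imp_le order_trans\<close>)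
    from upper_tail_eq_0[OF this] show ?thesis by (simp add: raw_density_upper)
  qed
  with raw_density_nonneg[of x] show ?thesis by simp
qed

lemma support_WA_subset: "rv_support N WA \<subseteq> support_hull M W"
proof
  fix x assume x: "x \<in> rv_support N WA"
  show "x \<in> support_hull M W"
  proof (rule ccontr)
    assume "x \<notin> support_hull M W"
    then have "\<exists>y\<in>- support_hull M W. raw_density y \<noteq> 0"
      using x closed_support_hull[of M W] unfolding in_support_WA_iff by (auto simp: open_Compl)
    then show False using raw_density_eq_0_outside by auto
  qed
qed

lemma hull_interval: 
  assumes "x \<in> support_hull M W" "y \<in> support_hull M W"
  shows "{x..y} \<subseteq> support_hull M W"
proof
  fix z assume "z \<in> {x..y}"
  then have "ereal x \<le> ereal z" "ereal z \<le> ereal y" by auto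
  with assms show "z \<in> support_hull M W" unfolding support_hull_def mem_Collect_eq by (meson order_trans)
qed

text \<open>The hull is an interval with at least two points, so every point of it, end points included, is a limit
of open intervals inside the hull.\<close>

lemma hull_accessible:
  assumes x: "x \<in> support_hull M W" and e: "0 < e"
  obtains u w where "u < w" "{u<..<w} \<subseteq> support_hull M W" "{u<..<w} \<subseteq> ball x e"
proof -
  obtain s t where st: "s \<in> rv_support M W" "t \<in> rv_support M W" "s < t" by (rule two_support_points)
  then have h: "s \<in> support_hull M W" "t \<in> support_hull M W"
    using support_bounds by (auto simp: support_hull_def)
  show ?thesis
  proof (cases "x < t")
    case True
    show ?thesis
    proof (rule that[of x "min (x + e) t"])
      show "{x<..<min (x + e) t} \<subseteq> support_hull M W" using hull_interval[OF x h(2)] by auto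
    qed (use True e in \<open>auto simp: dist_real_def\<close>)
  next
    case False
    show ?thesis
    proof (rule that[of "max (x - e) s" x])
      show "{max (x - e) s<..<x} \<subseteq> support_hull M W" using hull_interval[OF h(1) x] by auto
    qed (use False e st in \<open>auto simp: dist_real_def\<close>)
  qed
qed

lemma support_WA_eq_iff:
  "rv_support N WA = support_hull M W \<longleftrightarrow>
    (\<forall>u w. u < w \<and> {u<..<w} \<subseteq> support_hull M W \<longrightarrow> (\<exists>x\<in>{u<..<w}. equilibrium_density x \<noteq> 0))"
proof
  assume eq: "rv_support N WA = support_hull M W"
  show "\<forall>u w. u < w \<and> {u<..<w} \<subseteq> support_hull M W \<longrightarrow> (\<exists>x\<in>{u<..<w}. equilibrium_density x \<noteq> 0)"
  proof (intro allI impI)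
    fix u w :: real assume uw: "u < w \<and> {u<..<w} \<subseteq> support_hull M W"
    then have "(u + w) / 2 \<in> {u<..<w}" by auto
    then have "(u + w) / 2 \<in> rv_support N WA" using uw eq by blast
    then show "\<exists>x\<in>{u<..<w}. equilibrium_density x \<noteq> 0"
      unfolding in_support_WA_iff equilibrium_density_eq_0_iff using \<open>(u + w) / 2 \<in> {u<..<w}\<close> by (meson open_greaterThanLessThan)
  qed
next
  assume R: "\<forall>u w. u < w \<and> {u<..<w} \<subseteq> support_hull M W \<longrightarrow> (\<exists>x\<in>{u<..<w}. equilibrium_density x \<noteq> 0)"
  have "x \<in> rv_support N WA" if x: "x \<in> support_hull M W" for x
    unfolding in_support_WA_iff
  proof (intro allI impI)
    fix U assume "open U \<and> x \<in> U"
    then obtain e where e: "0 < e" "ball x e \<subseteq> U" by (meson openE)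
    obtain u w where "u < w" "{u<..<w} \<subseteq> support_hull M W" "{u<..<w} \<subseteq> ball x e"
      by (rule hull_accessible[OF x e(1)])
    with R e(2) show "\<exists>y\<in>U. raw_density y \<noteq> 0" unfolding equilibrium_density_eq_0_iff by blast
  qed
  with support_WA_subset show "rv_support N WA = support_hull M W" by blast
qed

lemma hull_interior:
  assumes "{u<..<w} \<subseteq> support_hull M W" "u < z" "z < w"
  shows "support_inf M W < ereal z" "ereal z < support_sup M W"
proof -
  have "(u + z) / 2 \<in> support_hull M W" "(z + w) / 2 \<in> support_hull M W"
    using assms by (auto intro!: subsetD[OF assms(1)])
  then have "support_inf M W \<le> ereal ((u + z) / 2)" "ereal ((z + w) / 2) \<le> support_sup M W"
    by (auto simp: support_hull_def)
  moreover have "ereal ((u + z) / 2) < ereal z" "ereal z < ereal ((z + w) / 2)" using assms by auto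
  ultimately show "support_inf M W < ereal z" "ereal z < support_sup M W" by order+
qed

lemma support_WA_below:
  assumes "0 \<le> a"
  shows "rv_support N WA \<inter> {..<0} = support_hull M W \<inter> {..<0}"
proof -
  have "x \<in> rv_support N WA" if x: "x \<in> support_hull M W" "x < 0" for x
    unfolding in_support_WA_iff
  proof (intro allI impI)
    fix U assume "open U \<and> x \<in> U"
    then obtain e where e: "0 < e" "ball x e \<subseteq> U" by (meson openE)
    have "0 < min e (-x)" using e x by simp
    then obtain u w where uw: "u < w" "{u<..<w} \<subseteq> support_hull M W" "{u<..<w} \<subseteq> ball x (min e (-x))"
      by (rule hull_accessible[OF x(1)])
    define z where "z = (u + w) / 2"
    have z: "u < z" "z < w" using uw(1) by (auto simp: z_def)
    then have "z \<in> ball x (min e (-x))" using uw(3) by auto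
    then have "z \<in> U" "z < 0" using e(2) by (auto simp: dist_real_def)
    then show "\<exists>y\<in>U. raw_density y \<noteq> 0"
      using raw_density_pos_below[OF assms hull_interior(1)[OF uw(2) z]] by (metis less_irrefl)
  qed
  with support_WA_subset show ?thesis by auto
qed

lemma support_WA_above:
  assumes "a \<le> 0"
  shows "rv_support N WA \<inter> {0<..} = support_hull M W \<inter> {0<..}"
proof -
  have "x \<in> rv_support N WA" if x: "x \<in> support_hull M W" "0 < x" for x
    unfolding in_support_WA_iff
  proof (intro allI impI)
    fix U assume "open U \<and> x \<in> U"
    then obtain e where e: "0 < e" "ball x e \<subseteq> U" by (meson openE)
    have "0 < min e x" using e x by simp
    then obtain u w where uw: "u < w" "{u<..<w} \<subseteq> support_hull M W" "{u<..<w} \<subseteq> ball x (min e x)"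
      by (rule hull_accessible[OF x(1)])
    define z where "z = (u + w) / 2"
    have z: "u < z" "z < w" using uw(1) by (auto simp: z_def)
    then have "z \<in> ball x (min e x)" using uw(3) by auto
    then have "z \<in> U" "0 \<le> z" using e(2) by (auto simp: dist_real_def)
    then show "\<exists>y\<in>U. raw_density y \<noteq> 0"
      using raw_density_pos_above[OF assms hull_interior(2)[OF uw(2) z]] by (metis less_irrefl)
  qed
  with support_WA_subset show ?thesis by auto
qed

lemma support_WA_centered:
  assumes "a = 0"
  shows "rv_support N WA = support_hull M W"
  unfolding support_WA_eq_iff
proof (intro allI impI)
  fix u w :: real assume uw: "u < w \<and> {u<..<w} \<subseteq> support_hull M W"
  define z where "z = (u + w) / 2"
  have z: "u < z" "z < w" using uw by (auto simp: z_def)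
  note h = hull_interior[OF conjunct2[OF uw] z]
  have "0 < raw_density z"
    using raw_density_pos_below[OF _ h(1)] raw_density_pos_above[OF _ h(2)] assms by (cases "z < 0") auto
  then show "\<exists>x\<in>{u<..<w}. equilibrium_density x \<noteq> 0" using z by (auto simp: equilibrium_density_eq_0_iff intro!: bexI[of _ z])
qed

text \<open>If \<open>a > 0\<close> and the support has the finite supremum \<open>\<beta>\<close>, then for
\<open>w\<close> within \<open>a / 2\<close> of \<open>\<beta>\<close> the expected excess over
\<open>w\<close> is at most \<open>a / 2\<close> times the probability of exceeding \<open>w\<close>.
The density, a multiple of the excess minus \<open>a\<close> times that probability, would be negative.
So an equilibrium variable of a bounded variable exists only if its mean is zero.\<close>

lemma bounded_support_imp_centered:
  assumes "\<bar>support_inf M W\<bar> \<noteq> \<infinity>" "\<bar>support_sup M W\<bar> \<noteq> \<infinity>"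
  shows "a = 0"
proof -
  obtain \<alpha> \<beta> where ab: "support_inf M W = ereal \<alpha>" "support_sup M W = ereal \<beta>" using assms by auto
  have AE: "AE x in M. \<alpha> \<le> W x" "AE x in M. W x \<le> \<beta>"
    using AE_support support_bounds ab by (auto elim!: eventually_mono) 
  have mean_le: "\<alpha> \<le> a" "a \<le> \<beta>"
    using integral_ge_const[OF integrable_W AE(1)] integral_le_const[OF integrable_W AE(2)] mean by auto
  have "\<not> 0 < a"
  proof
    assume a: "0 < a"
    \<comment> \<open>within \<open>a / 2\<close> of \<open>\<beta>\<close>, and nonnegative so that \<open>max (- w) 0\<close> vanishes\<close>
    define w where "w = max 0 (\<beta> - a / 2)"
    have w: "0 \<le> w" "w < \<beta>" "\<beta> - w \<le> a / 2" using a mean_le by (auto simp: w_def)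
    have P: "0 < prob {x \<in> space M. W x > w}" using below_support_sup(2)[of w] w ab by simp
    have "expectation (\<lambda>x. max (W x - w) 0) \<le> expectation (\<lambda>x. a / 2 * indicator {x. W x > w} x)"
    proof (rule integral_mono_AE)
      show "integrable M (\<lambda>x. a / 2 * indicator {x. W x > w} x)"
        by (rule integrable_const_bound[of _ "a / 2"]) (use a in \<open>auto simp: indicator_def\<close>)
      show "AE x in M. max (W x - w) 0 \<le> a / 2 * indicator {x. W x > w} x"
        using AE(2) by eventually_elim (use w in \<open>auto simp: indicator_def max_def\<close>)
    qed (use integrable_pos_part in auto)
    also have "\<dots> = a / 2 * prob {x \<in> space M. W x > w}"
    proof -
      have "{x. W x > w} \<inter> space M = {x \<in> space M. W x > w}" by auto
      then show ?thesis by simp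
    qed
    finally have "raw_density w \<le> - (a / 2 * prob {x \<in> space M. W x > w})" using w(1) by (simp add: raw_density_upper max_def)
    also have "\<dots> < 0" using a P by simp
    finally show False using raw_density_nonneg[of w] by simp
  qed
  moreover have "\<not> a < 0"
  proof
    assume a: "a < 0"
    define w where "w = min 0 (\<alpha> - a / 2)"
    have w: "w \<le> 0" "\<alpha> < w" "w - \<alpha> \<le> - a / 2" using a mean_le by (auto simp: w_def)
    have P: "0 < prob {x \<in> space M. W x \<le> w}" using above_support_inf(2)[of w] w ab by simp
    have "expectation (\<lambda>x. max (w - W x) 0) \<le> expectation (\<lambda>x. - a / 2 * indicator {x. W x \<le> w} x)"
    proof (rule integral_mono_AE)
      show "integrable M (\<lambda>x. - a / 2 * indicator {x. W x \<le> w} x)"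
        by (rule integrable_const_bound[of _ "- a / 2"]) (use a in \<open>auto simp: indicator_def\<close>)
      show "AE x in M. max (w - W x) 0 \<le> - a / 2 * indicator {x. W x \<le> w} x"
        using AE(1) by eventually_elim (use w in \<open>auto simp: indicator_def max_def\<close>)
    qed (use integrable_pos_part in auto)
    also have "\<dots> = - a / 2 * prob {x \<in> space M. W x \<le> w}"
    proof -
      have "{x. W x \<le> w} \<inter> space M = {x \<in> space M. W x \<le> w}" by auto
      then show ?thesis by simp
    qed
    finally have "raw_density w \<le> a / 2 * prob {x \<in> space M. W x \<le> w}" using w(1) by (simp add: raw_density_def max_def)
    also have "\<dots> < 0" using a P by (simp add: mult_neg_pos)
    finally show False using raw_density_nonneg[of w] by simp
  qed
  ultimately show ?thesis by simp
qed

lemma WA_bounded: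
  assumes "AE x in M. \<bar>W x\<bar> \<le> C" "0 < C"
  shows "AE y in N. \<bar>WA y\<bar> \<le> C"
proof -
  have "raw_density w = 0" if "\<bar>w\<bar> > C" for w
  proof (cases "0 \<le> w")
    case True
    have "AE x in M. W x \<le> w" using assms(1) by eventually_elim (use that True in auto)
    from upper_tail_eq_0[OF this] show ?thesis using True by (simp add: raw_density_upper max_def)
  next
    case False
    have "AE x in M. w < W x" using assms(1) by eventually_elim (use that False in auto)
    from lower_tail_eq_0[OF this] show ?thesis using False by (simp add: raw_density_def max_def)
  qed
  then have "N.prob (WA -` {w. \<bar>w\<bar> > C} \<inter> space N) = 0" by (subst prob_eq_0_iff) auto
  moreover have "WA -` {w. \<bar>w\<bar> > C} \<inter> space N = {y \<in> space N. \<not> \<bar>WA y\<bar> \<le> C}" by auto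
  ultimately show ?thesis by (subst AE_iff_measurable[OF _ refl]) (auto simp: N.emeasure_eq_measure)
qed

end


section \<open>Scaling, moments and characteristic function\<close>

lemma locally_abs_cont_cmult:
  assumes "locally_abs_cont f"
  shows "locally_abs_cont (\<lambda>t. c * f t)"
  unfolding locally_abs_cont_def
proof (intro allI)
  fix x y
  have ac: "abs_cont_on x y f" using assms by (simp add: locally_abs_cont_def)
  show "abs_cont_on x y (\<lambda>t. c * f t)"
    by (rule abs_cont_on_dominated[OF ac ac, of "\<bar>c\<bar>" 0])
      (auto simp: abs_mult[symmetric] right_diff_distrib)
qed

text \<open>At the origin the difference quotients are \<open>\<bar>h\<bar> powr (s - 1)\<close>, possibly with a
sign, and tend to zero as \<open>s > 1\<close>.\<close>

lemma DERIV_abs_powr_sgn: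
  assumes s: "1 < s"
  shows "((\<lambda>x. \<bar>x\<bar> powr s * sgn x) has_real_derivative s * \<bar>x\<bar> powr (s - 1)) (at x)"
    and "((\<lambda>x. \<bar>x\<bar> powr s) has_real_derivative s * (\<bar>x\<bar> powr (s - 1) * sgn x)) (at x)"
proof -
  consider "0 < x" | "x < 0" | "x = 0" by linarith
  then have "((\<lambda>x. \<bar>x\<bar> powr s * sgn x) has_real_derivative s * \<bar>x\<bar> powr (s - 1)) (at x) \<and>
    ((\<lambda>x. \<bar>x\<bar> powr s) has_real_derivative s * (\<bar>x\<bar> powr (s - 1) * sgn x)) (at x)"
  proof cases
    case 1
    have D: "((\<lambda>x. x powr s) has_real_derivative s * x powr (s - 1)) (at x)"
      using 1 by (auto intro!: derivative_eq_intros)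
    have ev: "\<forall>\<^sub>F y in nhds x. y \<in> {0<..}" using 1 by (intro eventually_nhds_in_open) auto
    have "((\<lambda>x. \<bar>x\<bar> powr s * sgn x) has_real_derivative s * x powr (s - 1)) (at x)"
      by (rule DERIV_cong_ev[THEN iffD1, OF refl _ refl D]) (use ev in \<open>auto elim!: eventually_mono\<close>)
    moreover have "((\<lambda>x. \<bar>x\<bar> powr s) has_real_derivative s * x powr (s - 1)) (at x)"
      by (rule DERIV_cong_ev[THEN iffD1, OF refl _ refl D]) (use ev in \<open>auto elim!: eventually_mono\<close>)
    ultimately show ?thesis using 1 by simp
  next
    case 2
    have D: "((\<lambda>x. (- x) powr s) has_real_derivative - (s * (- x) powr (s - 1))) (at x)"
      using 2 by (auto intro!: derivative_eq_intros)
    have D': "((\<lambda>x. - ((- x) powr s)) has_real_derivative s * (- x) powr (s - 1)) (at x)"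
      using DERIV_minus[OF D] by simp
    have ev: "\<forall>\<^sub>F y in nhds x. y \<in> {..<0}" using 2 by (intro eventually_nhds_in_open) auto
    have "((\<lambda>x. \<bar>x\<bar> powr s * sgn x) has_real_derivative s * (- x) powr (s - 1)) (at x)"
      by (rule DERIV_cong_ev[THEN iffD1, OF refl _ refl D']) (use ev in \<open>auto elim!: eventually_mono\<close>)
    moreover have "((\<lambda>x. \<bar>x\<bar> powr s) has_real_derivative - (s * (- x) powr (s - 1))) (at x)"
      by (rule DERIV_cong_ev[THEN iffD1, OF refl _ refl D]) (use ev in \<open>auto elim!: eventually_mono\<close>)
    ultimately show ?thesis using 2 by simp
  next
    case 3
    have "((\<lambda>h. \<bar>h\<bar> powr (s - 1)) \<longlongrightarrow> \<bar>0\<bar> powr (s - 1)) (at (0::real))"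
      using s by (intro tendsto_powr' tendsto_intros) auto
    then have lim: "((\<lambda>h. \<bar>h\<bar> powr (s - 1)) \<longlongrightarrow> 0) (at (0::real))" by simp
    have lim': "((\<lambda>h. \<bar>h\<bar> powr (s - 1) * sgn h) \<longlongrightarrow> 0) (at (0::real))"
      by (rule Lim_null_comparison[OF _ lim]) (auto simp: abs_mult abs_sgn_eq)
    have q: "\<bar>h\<bar> powr s = \<bar>h\<bar> powr (s - 1) * \<bar>h\<bar>" for h :: real
      by (cases "h = 0") (auto simp: powr_diff)
    have "(\<bar>h\<bar> powr s * sgn h) / h = \<bar>h\<bar> powr (s - 1)" if "h \<noteq> 0" for h
      using that unfolding q by (auto simp: sgn_if)
    then have "((\<lambda>h. (\<bar>h\<bar> powr s * sgn h) / h) \<longlongrightarrow> 0) (at 0)"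
      by (intro Lim_transform_eventually[OF lim]) (auto simp: eventually_at_filter)
    moreover have "(\<bar>h\<bar> powr s) / h = \<bar>h\<bar> powr (s - 1) * sgn h" if "h \<noteq> 0" for h
      using that unfolding q by (auto simp: sgn_if)
    then have "((\<lambda>h. (\<bar>h\<bar> powr s) / h) \<longlongrightarrow> 0) (at 0)"
      by (intro Lim_transform_eventually[OF lim']) (auto simp: eventually_at_filter)
    ultimately show ?thesis using 3 s by (simp add: DERIV_def)
  qed
  then show "((\<lambda>x. \<bar>x\<bar> powr s * sgn x) has_real_derivative s * \<bar>x\<bar> powr (s - 1)) (at x)"
    "((\<lambda>x. \<bar>x\<bar> powr s) has_real_derivative s * (\<bar>x\<bar> powr (s - 1) * sgn x)) (at x)" by auto
qed

context equilibrium_variable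
begin

text \<open>Test with \<open>f (c * x)\<close>. Its second derivative is \<open>c\<^sup>2 * f'' (c * x)\<close>
wherever \<open>f''\<close> exists at \<open>c * x\<close>, that is, almost everywhere; elsewhere the
chain rule fails for \<open>deriv\<close>, and the distribution of \<open>WA\<close> does not charge
these points since it has a density. For \<open>c = 0\<close> the defining equation degenerates to
\<open>0 = 0\<close>.\<close>

lemma equilibrium_scale: "asym_equilibrium M (\<lambda>x. c * W x) N (\<lambda>y. c * WA y)"
proof (cases "c = 0")
  case True
  then show ?thesis
    using N.prob_space_axioms by (simp add: asym_equilibrium_def prob_space)
next
  case c: False
  have mean_c: "expectation (\<lambda>x. c * W x) = c * a" by (simp add: mean)
  have var_c: "variance (\<lambda>x. c * W x) = c\<^sup>2 * s2"
  proof -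
    have "variance (\<lambda>x. c * W x) = expectation (\<lambda>x. c\<^sup>2 * (W x - a)\<^sup>2)"
      unfolding mean_c by (simp add: right_diff_distrib[symmetric] power_mult_distrib)
    also have "\<dots> = c\<^sup>2 * s2" using variance mean by simp
    finally show ?thesis .
  qed
  show ?thesis
    unfolding asym_equilibrium_def
  proof (intro conjI allI impI)
    show "prob_space N" "(\<lambda>y. c * WA y) \<in> borel_measurable N" by (simp_all add: N.prob_space_axioms)
    fix f :: "real \<Rightarrow> real"
    assume df: "\<forall>x. f differentiable at x" and lf: "locally_abs_cont f" and lf': "locally_abs_cont (deriv f)"
      and i1: "integrable M (\<lambda>x. f (c * W x))" and i2: "integrable M (\<lambda>x. deriv f (c * W x))"
      and i3: "integrable N (\<lambda>y. deriv (deriv f) (c * WA y))"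
    define g where "g x = f (c * x)" for x
    define g' where "g' x = c * deriv f (c * x)" for x
    have g': "(g has_real_derivative g' x) (at x)" for x
    proof -
      have "(f has_real_derivative deriv f (c * x)) (at (c * x))"
        using df by (simp add: DERIV_deriv_iff_real_differentiable)
      moreover have "((\<lambda>x. c * x) has_real_derivative c) (at x)" by (auto intro!: derivative_eq_intros)
      ultimately have "((\<lambda>x. f (c * x)) has_real_derivative deriv f (c * x) * c) (at x)" by (rule DERIV_chain2)
      then show ?thesis by (simp add: g_def[abs_def] g'_def mult.commute)
    qed
    then have dg: "deriv g = g'" by (auto intro!: DERIV_imp_deriv)
    have lg': "locally_abs_cont g'"
      unfolding g'_def[abs_def] by (intro locally_abs_cont_cmult locally_abs_cont_scale lf')
    have lg: "locally_abs_cont g" by (rule locally_abs_cont_C1[OF g' locally_abs_cont_continuous[OF lg']])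
    have cont: "continuous_on UNIV (deriv f)" "continuous_on UNIV g'"
      using lf' lg' by (auto intro: locally_abs_cont_continuous)
    note [measurable] = borel_measurable_deriv[OF cont(1)] borel_measurable_deriv[OF cont(2)]
    have dd: "deriv g' x = c\<^sup>2 * deriv (deriv f) (c * x)" if "g' differentiable (at x)" for x
    proof -
      have "((\<lambda>y. g' (y / c) / c) has_real_derivative deriv g' x * (1 / c) / c) (at (c * x))"
      proof (rule DERIV_cdivide)
        have "(g' has_real_derivative deriv g' x) (at (c * x / c))"
          using that c by (simp add: DERIV_deriv_iff_real_differentiable)
        moreover have "((\<lambda>y. y / c) has_real_derivative 1 / c) (at (c * x))" using c by (auto intro!: derivative_eq_intros)
        ultimately show "((\<lambda>y. g' (y / c)) has_real_derivative deriv g' x * (1 / c)) (at (c * x))"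
          by (rule DERIV_chain2)
      qed
      moreover have "(\<lambda>y. g' (y / c) / c) = deriv f" using c by (auto simp: g'_def)
      ultimately have "deriv (deriv f) (c * x) = deriv g' x * (1 / c) / c" by (simp add: DERIV_imp_deriv)
      then show ?thesis using c by (simp add: field_simps power2_eq_square)
    qed
    have "AE y in N. g' differentiable (at (WA y))"
      using borel_set_differentiable[OF cont(2)]
      by (intro AE_WA locally_abs_cont_AE_differentiable lg') (simp add: pred_def)
    then have AE: "AE y in N. c\<^sup>2 * deriv (deriv f) (c * WA y) = deriv g' (WA y)"
      by eventually_elim (simp add: dd)
    have i4: "integrable N (\<lambda>y. deriv g' (WA y))"
    proof (rule integrable_cong_AE_imp[OF _ _ AE])
      show "integrable N (\<lambda>y. c\<^sup>2 * deriv (deriv f) (c * WA y))" using i3 by simp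
    qed measurable
    have "\<forall>x. g differentiable at x" using g' by (auto simp: real_differentiable_def)
    moreover have "integrable M (\<lambda>x. g (W x))" "integrable M (\<lambda>x. g' (W x))"
      using i1 i2 by (simp_all add: g_def g'_def)
    ultimately have "(variance W - (expectation W)\<^sup>2) / 2 * N.expectation (\<lambda>y. deriv (deriv g) (WA y)) =
      expectation (\<lambda>x. g (W x) - g 0 - expectation W * deriv g (W x))"
      using equilibrium lg lg' i4 unfolding asym_equilibrium_def dg[symmetric] by blast
    then have eq: "(s2 - a\<^sup>2) / 2 * N.expectation (\<lambda>y. deriv g' (WA y)) =
      expectation (\<lambda>x. g (W x) - g 0 - a * g' (W x))"
      unfolding variance unfolding mean dg .
    have "N.expectation (\<lambda>y. deriv g' (WA y)) = N.expectation (\<lambda>y. c\<^sup>2 * deriv (deriv f) (c * WA y))"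
      by (intro integral_cong_AE) (use AE in \<open>auto elim!: eventually_mono\<close>)
    then have "N.expectation (\<lambda>y. deriv g' (WA y)) = c\<^sup>2 * N.expectation (\<lambda>y. deriv (deriv f) (c * WA y))"
      by simp
    with eq have "(c\<^sup>2 * s2 - (c * a)\<^sup>2) / 2 * N.expectation (\<lambda>y. deriv (deriv f) (c * WA y)) =
       expectation (\<lambda>x. f (c * W x) - f 0 - c * a * deriv f (c * W x))"
      by (simp add: g_def g'_def field_simps power_mult_distrib)
    then show "(variance (\<lambda>x. c * W x) - (expectation (\<lambda>x. c * W x))\<^sup>2) / 2 *
          N.expectation (\<lambda>y. deriv (deriv f) (c * WA y)) =
          expectation (\<lambda>x. f (c * W x) - f 0 - expectation (\<lambda>x. c * W x) * deriv f (c * W x))"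
      unfolding var_c unfolding mean_c .
  qed
qed

text \<open>Use the test function \<open>x ^ (r + 2) / ((r + 1) * (r + 2))\<close>.\<close>

lemma moments_nat:
  assumes int: "integrable M (\<lambda>x. \<bar>W x\<bar> ^ (r + 2))"
  shows "integrable N (\<lambda>y. WA y ^ r)"
    and "N.expectation (\<lambda>y. WA y ^ r) =
      (2 * expectation (\<lambda>x. W x ^ (r + 2)) - 2 * a * (real r + 2) * expectation (\<lambda>x. W x ^ (r + 1)))
        / ((real r + 1) * (real r + 2) * (s2 - a\<^sup>2))"
proof -
  let ?f = "\<lambda>x::real. x ^ (r + 2) / ((real r + 1) * (real r + 2))"
  let ?f' = "\<lambda>x::real. x ^ (r + 1) / (real r + 1)"
  have ne: "real r + 1 \<noteq> 0" "real r + 2 \<noteq> 0" by linarith+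
  have f': "(?f has_real_derivative ?f' t) (at t)" for t
  proof -
    have "((\<lambda>x. x ^ (r + 2)) has_real_derivative (real r + 2) * t ^ (r + 1)) (at t)"
      using DERIV_pow[of "r + 2" t] by (simp add: add.commute)
    from DERIV_cdivide[OF this, of "(real r + 1) * (real r + 2)"] show ?thesis
      by (rule DERIV_cong) (use ne in simp)
  qed
  have f'': "(?f' has_real_derivative t ^ r) (at t)" for t
  proof -
    have "((\<lambda>x. x ^ (r + 1)) has_real_derivative (real r + 1) * t ^ r) (at t)"
      using DERIV_pow[of "r + 1" t] by (simp add: add.commute)
    from DERIV_cdivide[OF this, of "real r + 1"] show ?thesis
      by (rule DERIV_cong) (use ne in simp)
  qed
  have int1: "integrable M (\<lambda>x. \<bar>W x\<bar> ^ (r + 1))"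
  proof (rule Bochner_Integration.integrable_bound)
    show "integrable M (\<lambda>x. 1 + \<bar>W x\<bar> ^ (r + 2))" using int by auto
    have "\<bar>x\<bar> ^ (r + 1) \<le> 1 + \<bar>x\<bar> ^ (r + 2)" for x :: real
    proof (cases "\<bar>x\<bar> \<le> 1")
      case True
      then have "\<bar>x\<bar> ^ (r + 1) \<le> 1" by (intro power_le_one) auto
      moreover have "0 \<le> \<bar>x\<bar> ^ (r + 2)" by simp
      ultimately show ?thesis by linarith
    next
      case False
      then have "\<bar>x\<bar> ^ (r + 1) \<le> \<bar>x\<bar> ^ (r + 2)" by (intro power_increasing) auto
      then show ?thesis by linarith
    qed
    then show "AE x in M. norm (\<bar>W x\<bar> ^ (r + 1)) \<le> norm (1 + \<bar>W x\<bar> ^ (r + 2))" by simp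
  qed simp
  have G: "\<bar>x\<bar> ^ r * \<bar>x\<bar> = \<bar>x\<bar> ^ (r + 1)" "\<bar>x\<bar> ^ r * \<bar>x\<bar>\<^sup>2 = \<bar>x\<bar> ^ (r + 2)" for x :: real
    by (simp_all only: power_add) simp
  have bnd: "\<bar>w ^ r\<bar> \<le> \<bar>x\<bar> ^ r" if "\<bar>w\<bar> \<le> \<bar>x\<bar>" for x w :: real
    using that by (simp add: power_abs power_mono)
  have i1: "integrable M (\<lambda>x. \<bar>W x\<bar> ^ r * \<bar>W x\<bar>)" "integrable M (\<lambda>x. \<bar>W x\<bar> ^ r * \<bar>W x\<bar>\<^sup>2)"
    unfolding G using int int1 by auto
  note m = moment_identity[OF f' f'' _ bnd i1]
  show "integrable N (\<lambda>y. WA y ^ r)" by (rule m(1)) (auto intro: continuous_intros)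
  have "integrable M (\<lambda>x. W x ^ (r + 2))" "integrable M (\<lambda>x. W x ^ (r + 1))"
  proof -
    show "integrable M (\<lambda>x. W x ^ (r + 2))"
      by (rule Bochner_Integration.integrable_bound[OF int]) (auto simp: abs_mult power_abs)
    show "integrable M (\<lambda>x. W x ^ (r + 1))"
      by (rule Bochner_Integration.integrable_bound[OF int1]) (auto simp: abs_mult power_abs)
  qed
  then have "expectation (\<lambda>x. ?f (W x) - ?f 0 - a * ?f' (W x)) =
     expectation (\<lambda>x. W x ^ (r + 2)) / ((real r + 1) * (real r + 2)) - a * (expectation (\<lambda>x. W x ^ (r + 1)) / (real r + 1))"
    by simp
  moreover have "2 / g * (A / (b * d) - a * (B / b)) = (2 * A - 2 * a * d * B) / (b * d * g)"
    if "b > 0" "d > 0" "g > 0" for A B b d g :: real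
    using that by (simp add: field_simps)
  ultimately show "N.expectation (\<lambda>y. WA y ^ r) =
      (2 * expectation (\<lambda>x. W x ^ (r + 2)) - 2 * a * (real r + 2) * expectation (\<lambda>x. W x ^ (r + 1)))
        / ((real r + 1) * (real r + 2) * (s2 - a\<^sup>2))"
    using m(2) gap_pos by (simp add: continuous_intros)
qed

text \<open>For \<open>r > 0\<close> the test function is \<open>\<bar>x\<bar> powr (r + 2) / ((r + 1) * (r +
2))\<close>. For \<open>r = 0\<close> its second derivative would be \<open>\<bar>x\<bar> powr
0\<close>, which is discontinuous at \<open>0\<close> because of \<open>0 powr 0 = 0\<close>; but
\<open>WA = 0\<close> has probability zero and the identity reduces to the second moment of
\<open>W\<close>.\<close>

lemma absolute_moments:
  assumes r: "0 \<le> r" and int: "integrable M (\<lambda>x. \<bar>W x\<bar> powr (r + 2))"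
  shows "integrable N (\<lambda>y. \<bar>WA y\<bar> powr r)" (is ?int)
    and "N.expectation (\<lambda>y. \<bar>WA y\<bar> powr r) =
      (2 * expectation (\<lambda>x. \<bar>W x\<bar> powr (r + 2)) - 2 * a * (r + 2) * expectation (\<lambda>x. \<bar>W x\<bar> powr (r + 1) * sgn (W x)))
        / ((r + 1) * (r + 2) * (s2 - a\<^sup>2))" (is "?E = ?F")
proof -
  have "?int \<and> ?E = ?F"
  proof (cases "r = 0")
    case True
    have "AE w in lborel. \<bar>w\<bar> powr 0 = (1 :: real)" using AE_lborel_singleton[of 0] by eventually_elim simp
    then have AE: "AE y in N. \<bar>WA y\<bar> powr 0 = 1" by (rule AE_WA) measurable
    have "integrable N (\<lambda>y. \<bar>WA y\<bar> powr 0)"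
      by (rule N.integrable_const_bound[of _ 1]) (use AE in \<open>auto elim: eventually_mono\<close>)
    moreover have "N.expectation (\<lambda>y. \<bar>WA y\<bar> powr 0) = N.expectation (\<lambda>y. 1)"
      using AE by (intro integral_cong_AE) auto
    moreover have "expectation (\<lambda>x. \<bar>W x\<bar> powr 2) = s2 + a\<^sup>2" using second_moment by (simp add: powr_numeral)
    moreover have "expectation (\<lambda>x. \<bar>W x\<bar> powr 1 * sgn (W x)) = a"
    proof -
      have "\<bar>x\<bar> powr 1 * sgn x = x" for x :: real by (simp add: sgn_if abs_if)
      then show ?thesis using mean by simp
    qed
    moreover have "(2 * (s2 + a\<^sup>2) - 2 * a * 2 * a) / (2 * (s2 - a\<^sup>2)) = 1"
      using gap_pos by (simp add: field_simps power2_eq_square)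
    ultimately show ?thesis using True by (simp add: N.prob_space)
  next
    case False
    with r have r0: "0 < r" by simp
    let ?f = "\<lambda>x::real. \<bar>x\<bar> powr (r + 2) / ((r + 1) * (r + 2))"
    let ?f' = "\<lambda>x::real. \<bar>x\<bar> powr (r + 1) * sgn x / (r + 1)"
    have f': "(?f has_real_derivative ?f' t) (at t)" for t
      using DERIV_cdivide[OF DERIV_abs_powr_sgn(2)[of "r + 2" t], of "(r + 1) * (r + 2)"] r0
      by (simp add: add.commute)
    have f'': "(?f' has_real_derivative \<bar>t\<bar> powr r) (at t)" for t
      using DERIV_cdivide[OF DERIV_abs_powr_sgn(1)[of "r + 1" t], of "r + 1"] r0 by simp
    have cont: "continuous_on UNIV (\<lambda>t::real. \<bar>t\<bar> powr r)"
      using r0 by (intro continuous_on_powr' continuous_intros) auto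
    have int1: "integrable M (\<lambda>x. \<bar>W x\<bar> powr (r + 1))"
    proof (rule Bochner_Integration.integrable_bound)
      show "integrable M (\<lambda>x. 1 + \<bar>W x\<bar> powr (r + 2))" using int by auto
      have "\<bar>x\<bar> powr (r + 1) \<le> 1 + \<bar>x\<bar> powr (r + 2)" for x :: real
      proof (cases "\<bar>x\<bar> \<le> 1")
        case True
        then have "\<bar>x\<bar> powr (r + 1) \<le> 1" using r0 by (intro powr_le1) auto
        moreover have "0 \<le> \<bar>x\<bar> powr (r + 2)" by simp
        ultimately show ?thesis by linarith
      next
        case False
        then have "\<bar>x\<bar> powr (r + 1) \<le> \<bar>x\<bar> powr (r + 2)" by (intro powr_mono) auto
        then show ?thesis by linarith
      qed
      then show "AE x in M. norm (\<bar>W x\<bar> powr (r + 1)) \<le> norm (1 + \<bar>W x\<bar> powr (r + 2))" by simp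
    qed simp
    have G: "\<bar>x\<bar> powr r * \<bar>x\<bar> = \<bar>x\<bar> powr (r + 1)" "\<bar>x\<bar> powr r * \<bar>x\<bar>\<^sup>2 = \<bar>x\<bar> powr (r + 2)" for x :: real
      by (cases "x = 0"; simp add: powr_add powr_numeral)+
    have bnd: "\<bar>\<bar>w\<bar> powr r\<bar> \<le> \<bar>x\<bar> powr r" if "\<bar>w\<bar> \<le> \<bar>x\<bar>" for x w :: real
      using that r0 by (simp add: powr_mono2)
    have i1: "integrable M (\<lambda>x. \<bar>W x\<bar> powr r * \<bar>W x\<bar>)" "integrable M (\<lambda>x. \<bar>W x\<bar> powr r * \<bar>W x\<bar>\<^sup>2)"
      unfolding G using int int1 by auto
    note m = moment_identity[OF f' f'' cont bnd i1]
    have int2: "integrable M (\<lambda>x. \<bar>W x\<bar> powr (r + 1) * sgn (W x))"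
      by (rule Bochner_Integration.integrable_bound[OF int1]) (auto simp: abs_mult abs_sgn_eq)
    have E: "expectation (\<lambda>x. ?f (W x) - ?f 0 - a * ?f' (W x)) =
       expectation (\<lambda>x. \<bar>W x\<bar> powr (r + 2)) / ((r + 1) * (r + 2)) -
       a * (expectation (\<lambda>x. \<bar>W x\<bar> powr (r + 1) * sgn (W x)) / (r + 1))"
      using int int2 by simp
    have alg: "2 / g * (A / (b * d) - a * (B / b)) = (2 * A - 2 * a * d * B) / (b * d * g)"
      if "b > 0" "d > 0" "g > 0" for A B b d g :: real
      using that by (simp add: field_simps)
    show ?thesis
    proof
      show ?int by (rule m(1))
      show "?E = ?F"
      proof -
        have "?E = 2 / (s2 - a\<^sup>2) * expectation (\<lambda>x. ?f (W x) - ?f 0 - a * ?f' (W x))"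
          by (rule m(2))
        also have "\<dots> = ?F"
          unfolding E using r0 gap_pos by (intro alg) auto
        finally show ?thesis .
      qed
    qed
  qed
  then show ?int "?E = ?F" by auto
qed

end

lemma (in prob_space) char_distr_cos_sin:
  assumes [measurable]: "X \<in> borel_measurable M"
  shows "char (distr M borel X) t = Complex (expectation (\<lambda>x. cos (t * X x))) (expectation (\<lambda>x. sin (t * X x)))"
proof -
  have int: "integrable M (\<lambda>x. iexp (t * X x))"
    by (rule integrable_const_bound[of _ 1]) auto
  have "char (distr M borel X) t = (\<integral>x. iexp (t * X x) \<partial>M)"
    unfolding char_def by (subst integral_distr) auto
  moreover have "Re (\<integral>x. iexp (t * X x) \<partial>M) = expectation (\<lambda>x. cos (t * X x))"
    by (subst integral_Re[symmetric, OF int]) (simp add: Re_exp)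
  moreover have "Im (\<integral>x. iexp (t * X x) \<partial>M) = expectation (\<lambda>x. sin (t * X x))"
    by (subst integral_Im[symmetric, OF int]) (simp add: Im_exp)
  ultimately show ?thesis by (intro complex_eqI) auto
qed

context equilibrium_variable
begin

text \<open>Test with \<open>- cos (t * x) / t\<^sup>2\<close> and \<open>- sin (t * x) / t\<^sup>2\<close> for the
real and imaginary parts.\<close>

lemma char_WA:
  assumes t: "t \<noteq> 0"
  shows "char (distr N borel WA) t =
    2 * (1 + (complex_of_real a * \<i> * complex_of_real t - 1) * char (distr M borel W) t)
      / complex_of_real (t\<^sup>2 * (s2 - a\<^sup>2))"
proof -
  define C S where "C = expectation (\<lambda>x. cos (t * W x))" and "S = expectation (\<lambda>x. sin (t * W x))"
  have ic: "integrable M (\<lambda>x. cos (t * W x))" "integrable M (\<lambda>x. sin (t * W x))"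
    by (rule integrable_const_bound[of _ 1]; simp)+
  have i1: "integrable M (\<lambda>x. 1 * \<bar>W x\<bar>)" "integrable M (\<lambda>x. 1 * \<bar>W x\<bar>\<^sup>2)"
    using integrable_W integrable_W2 by auto
  have "N.expectation (\<lambda>y. cos (t * WA y)) =
      2 / (s2 - a\<^sup>2) * expectation (\<lambda>x. - cos (t * W x) / t\<^sup>2 - - cos (t * 0) / t\<^sup>2 - a * (sin (t * W x) / t))"
    by (rule moment_identity(2)[where g = "\<lambda>w. cos (t * w)" and f = "\<lambda>x. - cos (t * x) / t\<^sup>2" and f' = "\<lambda>x. sin (t * x) / t"
          and G = "\<lambda>_. 1", OF _ _ _ _ i1])
      (use t in \<open>auto intro!: derivative_eq_intros continuous_intros simp: power2_eq_square\<close>)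
  also have "expectation (\<lambda>x. - cos (t * W x) / t\<^sup>2 - - cos (t * 0) / t\<^sup>2 - a * (sin (t * W x) / t)) =
      - C / t\<^sup>2 + 1 / t\<^sup>2 - a * (S / t)"
    using ic by (simp add: C_def S_def prob_space)
  finally have 1: "N.expectation (\<lambda>y. cos (t * WA y)) = 2 / (s2 - a\<^sup>2) * (- C / t\<^sup>2 + 1 / t\<^sup>2 - a * (S / t))" .
  have "N.expectation (\<lambda>y. sin (t * WA y)) =
      2 / (s2 - a\<^sup>2) * expectation (\<lambda>x. - sin (t * W x) / t\<^sup>2 - - sin (t * 0) / t\<^sup>2 - a * (- cos (t * W x) / t))"
    by (rule moment_identity(2)[where g = "\<lambda>w. sin (t * w)" and f = "\<lambda>x. - sin (t * x) / t\<^sup>2" and f' = "\<lambda>x. - cos (t * x) / t"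
          and G = "\<lambda>_. 1", OF _ _ _ _ i1])
      (use t in \<open>auto intro!: derivative_eq_intros continuous_intros simp: power2_eq_square\<close>)
  also have "expectation (\<lambda>x. - sin (t * W x) / t\<^sup>2 - - sin (t * 0) / t\<^sup>2 - a * (- cos (t * W x) / t)) =
      - S / t\<^sup>2 + a * (C / t)"
    using ic by (simp add: C_def S_def prob_space)
  finally have 2: "N.expectation (\<lambda>y. sin (t * WA y)) = 2 / (s2 - a\<^sup>2) * (- S / t\<^sup>2 + a * (C / t))" .
  define d where "d = t\<^sup>2 * (s2 - a\<^sup>2)"
  have d: "d \<noteq> 0" using t gap_pos by (simp add: d_def)
  have "char (distr N borel WA) t = Complex (2 / (s2 - a\<^sup>2) * (- C / t\<^sup>2 + 1 / t\<^sup>2 - a * (S / t)))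
      (2 / (s2 - a\<^sup>2) * (- S / t\<^sup>2 + a * (C / t)))"
    by (simp add: N.char_distr_cos_sin 1 2)
  also have "2 / (s2 - a\<^sup>2) * (- C / t\<^sup>2 + 1 / t\<^sup>2 - a * (S / t)) = 2 * (1 - C - a * t * S) / d"
    using t gap_pos by (simp add: d_def field_simps power2_eq_square)
  also have "2 / (s2 - a\<^sup>2) * (- S / t\<^sup>2 + a * (C / t)) = 2 * (a * t * C - S) / d"
    using t gap_pos by (simp add: d_def field_simps power2_eq_square)
  also have "Complex (2 * (1 - C - a * t * S) / d) (2 * (a * t * C - S) / d) =
     2 * (1 + (complex_of_real a * \<i> * complex_of_real t - 1) * Complex C S) / complex_of_real d"
    by (intro complex_eqI) (simp_all add: Re_divide_of_real Im_divide_of_real algebra_simps)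
  finally show ?thesis by (simp add: char_distr_cos_sin C_def S_def d_def)
qed

end


section \<open>The asymmetric Laplace distribution\<close>

lemma integrable_imp_limit_0:
  fixes v :: "real \<Rightarrow> real"
  assumes int: "integrable lborel (\<lambda>x. indicator {0..} x * v x)" and lim: "(v \<longlongrightarrow> L) at_top"
  shows "L = 0"
proof (rule ccontr)
  assume "L \<noteq> 0"
  then have "\<bar>L\<bar> / 2 < \<bar>L\<bar>" by simp
  moreover have "((\<lambda>x. \<bar>v x\<bar>) \<longlongrightarrow> \<bar>L\<bar>) at_top" using lim by (rule tendsto_rabs)
  ultimately have "\<forall>\<^sub>F x in at_top. \<bar>L\<bar> / 2 < \<bar>v x\<bar>" by (intro order_tendstoD(1))
  then obtain T where T: "\<And>x. T \<le> x \<Longrightarrow> \<bar>L\<bar> / 2 < \<bar>v x\<bar>" unfolding eventually_at_top_linorder by auto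
  have "integrable lborel (\<lambda>x. indicator {max T 0..} x * (\<bar>L\<bar> / 2))"
    by (rule Bochner_Integration.integrable_bound[OF int])
      (use T in \<open>auto simp: indicator_def abs_mult less_imp_le\<close>)
  then have "integrable lborel (\<lambda>x. indicator {max T 0..} x * (\<bar>L\<bar> / 2) * (2 / \<bar>L\<bar>))"
    by (rule integrable_mult_left)
  moreover have "indicator {max T 0..} x * (\<bar>L\<bar> / 2) * (2 / \<bar>L\<bar>) = (indicator {max T 0..} x :: real)" for x
    using \<open>L \<noteq> 0\<close> by simp
  ultimately have "integrable lborel (indicator {max T 0..} :: real \<Rightarrow> real)" by (simp only:)
  then have fin: "emeasure lborel {max T 0..} < \<infinity>" by (simp add: integrable_indicator_iff)
  have "of_nat n \<le> emeasure lborel {max T 0..}" for n :: nat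
  proof -
    have "emeasure lborel {max T 0..max T 0 + real n} \<le> emeasure lborel {max T 0..}"
      by (intro emeasure_mono) auto
    then show ?thesis by (simp add: ennreal_of_nat_eq_real_of_nat)
  qed
  then have "emeasure lborel {max T 0..} = \<infinity>"
    by (metis ennreal_SUP_of_nat_eq_top SUP_least top_unique infinity_ennreal_def)
  with fin show False by simp
qed

text \<open>Apply the fundamental theorem to \<open>v x = exp (- l * x) * u x\<close> on \<open>{0..T}\<close>. As
both integrals converge, \<open>v T\<close> has a limit as \<open>T\<close> grows, and as
\<open>v\<close> is integrable this limit is zero.\<close>

lemma half_line_by_parts:
  assumes lac: "locally_abs_cont u" and D: "AE x in lborel. (u has_real_derivative D x) (at x)"
    and iu: "integrable lborel (\<lambda>x. indicator {0..} x * (exp (- l * x) * u x))"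
    and iD: "integrable lborel (\<lambda>x. indicator {0..} x * (exp (- l * x) * D x))"
  shows "(\<integral>x. indicator {0..} x * (exp (- l * x) * D x) \<partial>lborel) =
    - u 0 + l * (\<integral>x. indicator {0..} x * (exp (- l * x) * u x) \<partial>lborel)"
proof -
  define v where "v x = exp (- l * x) * u x" for x
  define h where "h x = indicator {0..} x * (exp (- l * x) * D x) - l * (indicator {0..} x * (exp (- l * x) * u x))" for x
  have ih: "integrable lborel h" unfolding h_def[abs_def] using iu iD by auto
  have e: "((\<lambda>x. exp (- l * x)) has_real_derivative - l * exp (- l * x)) (at x)" for x
    by (auto intro!: derivative_eq_intros)
  have "locally_abs_cont (\<lambda>x. exp (- l * x))"
    by (rule locally_abs_cont_C1[OF e]) (intro continuous_intros)
  then have lv: "locally_abs_cont v"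
    using lac unfolding locally_abs_cont_def v_def[abs_def] by (intro allI abs_cont_on_mult) auto
  have Dv: "AE x in lborel. indicator {0..T} x *\<^sub>R deriv v x = indicator {..T} x *\<^sub>R h x" for T
    using D
  proof eventually_elim
    case (elim x)
    have "(v has_real_derivative (- l * exp (- l * x)) * u x + D x * exp (- l * x)) (at x)"
      unfolding v_def[abs_def] by (rule DERIV_mult[OF e elim])
    then have "deriv v x = exp (- l * x) * D x - l * (exp (- l * x) * u x)"
      by (simp add: DERIV_imp_deriv algebra_simps)
    then show ?case by (auto simp: h_def indicator_def)
  qed
  have [measurable]: "deriv v \<in> borel_measurable borel"
    by (intro borel_measurable_deriv locally_abs_cont_continuous lv)
  have [measurable]: "h \<in> borel_measurable borel" using ih by auto
  have "v T - v 0 = (\<integral>x. indicator {..T} x *\<^sub>R h x \<partial>lborel)" if "0 < T" for T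
    unfolding integral_deriv_abs_cont(2)[OF lv that, symmetric] set_lebesgue_integral_def
    by (intro integral_cong_AE Dv) auto
  then have "\<forall>\<^sub>F T in at_top. (\<integral>x. indicator {..T} x *\<^sub>R h x \<partial>lborel) + v 0 = v T"
    by (intro eventually_mono[OF eventually_gt_at_top[of 0]]) (simp add: algebra_simps)
  moreover have "((\<lambda>T. (\<integral>x. indicator {..T} x *\<^sub>R h x \<partial>lborel) + v 0) \<longlongrightarrow> (\<integral>x. h x \<partial>lborel) + v 0) at_top"
    by (intro tendsto_add tendsto_const tendsto_integral_at_top ih) auto
  ultimately have "(v \<longlongrightarrow> (\<integral>x. h x \<partial>lborel) + v 0) at_top" by (rule Lim_transform_eventually[rotated])
  moreover have "integrable lborel (\<lambda>x. indicator {0..} x * v x)" using iu by (simp add: v_def)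
  ultimately have "(\<integral>x. h x \<partial>lborel) + v 0 = 0" by (rule integrable_imp_limit_0[rotated])
  moreover have "(\<integral>x. h x \<partial>lborel) = (\<integral>x. indicator {0..} x * (exp (- l * x) * D x) \<partial>lborel) -
      l * (\<integral>x. indicator {0..} x * (exp (- l * x) * u x) \<partial>lborel)"
    unfolding h_def using iu iD by simp
  ultimately show ?thesis by (simp add: v_def)
qed

lemma half_line_exp_moment:
  fixes l :: real
  assumes l: "0 < l"
  shows "has_bochner_integral lborel (\<lambda>x. indicator {0..} x * (exp (- l * x) * x ^ i)) (fact i / l ^ (i + 1))"
proof -
  have "has_bochner_integral lborel (\<lambda>x. erlang_density 0 l x * x ^ i) (fact i / l ^ i)"
    using nn_integral_erlang_ith_moment[OF l, of 0 i] l
    by (intro has_bochner_integral_nn_integral) (auto simp: erlang_density_def)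
  from has_bochner_integral_mult_right[OF this, of "1 / l"]
  have "has_bochner_integral lborel (\<lambda>x. 1 / l * (erlang_density 0 l x * x ^ i)) (1 / l * (fact i / l ^ i))"
    by simp
  moreover have "1 / l * (erlang_density 0 l x * x ^ i) = indicator {0..} x * (exp (- l * x) * x ^ i)" for x
    using l by (simp add: erlang_density_def)
  moreover have "1 / l * (fact i / l ^ i) = fact i / l ^ (i + 1)" by simp
  ultimately show ?thesis by (simp only:)
qed

text \<open>The density decays exponentially on each side of the origin, with the rates \<open>lr\<close> on the
right and \<open>ll\<close> on the left.\<close>

locale laplace_parameters =
  fixes a b :: real
  assumes b: "0 < b"
begin

definition s :: real where "s = sqrt (2 * b\<^sup>2 + a\<^sup>2)"
definition lr :: real where "lr = (s - a) / b\<^sup>2"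
definition ll :: real where "ll = (s + a) / b\<^sup>2"
definition laplace_density :: "real \<Rightarrow> real" where
  "laplace_density x = 1 / sqrt (2 * b\<^sup>2 + a\<^sup>2) * exp (a / b\<^sup>2 * x - 1 / b * sqrt (2 + a\<^sup>2 / b\<^sup>2) * \<bar>x\<bar>)"

lemma s2: "s\<^sup>2 = 2 * b\<^sup>2 + a\<^sup>2" unfolding s_def by (intro real_sqrt_pow2) auto

lemma s_gt: "\<bar>a\<bar> < s"
  unfolding s_def by (rule real_less_rsqrt) (use b in auto)

lemma s_pos: "0 < s" using s_gt by linarith

lemma rates_pos: "0 < lr" "0 < ll" using s_gt b by (auto simp: lr_def ll_def)

lemma inverse_rates: "1 / lr = (s + a) / 2" "1 / ll = (s - a) / 2"
proof -
  have b2: "b\<^sup>2 = (s + a) * (s - a) / 2" using s2 by (simp add: power2_eq_square algebra_simps)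
  have "s - a \<noteq> 0" "s + a \<noteq> 0" using s_gt by auto
  then have "b\<^sup>2 / (s - a) = (s + a) / 2" "b\<^sup>2 / (s + a) = (s - a) / 2"
    using b2 by (simp_all add: nonzero_divide_eq_eq)
  then show "1 / lr = (s + a) / 2" "1 / ll = (s - a) / 2" by (auto simp: lr_def ll_def)
qed

text \<open>These are the characteristic equations of \<open>b\<^sup>2 / 2 * h'' = h + a * h'\<close>, which the
density solves away from the origin.\<close>

lemma rate_equations: "b\<^sup>2 / 2 * lr = 1 / lr - a" "b\<^sup>2 / 2 * ll = 1 / ll + a"
proof -
  have "b\<^sup>2 / 2 * lr = (s - a) / 2" "b\<^sup>2 / 2 * ll = (s + a) / 2" using b by (auto simp: lr_def ll_def)
  then show "b\<^sup>2 / 2 * lr = 1 / lr - a" "b\<^sup>2 / 2 * ll = 1 / ll + a"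
    unfolding inverse_rates by (simp_all only:) (simp_all add: field_simps)
qed

lemma density_cases:
  "laplace_density x = (if 0 \<le> x then exp (- lr * x) / s else exp (- ll * (- x)) / s)"
proof -
  have "sqrt (2 + a\<^sup>2 / b\<^sup>2) = sqrt ((2 * b\<^sup>2 + a\<^sup>2) / b\<^sup>2)" using b by (simp add: field_simps)
  also have "\<dots> = s / b" using b by (simp add: real_sqrt_divide s_def)
  finally have "1 / b * sqrt (2 + a\<^sup>2 / b\<^sup>2) = s / b\<^sup>2" by (simp add: power2_eq_square)
  then show ?thesis
    unfolding laplace_density_def s_def[symmetric] by (simp add: lr_def ll_def algebra_simps diff_divide_distrib add_divide_distrib)
qed

lemma density_nonneg: "0 \<le> laplace_density x" by (simp add: density_cases less_imp_le[OF s_pos])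

lemma measurable_density[measurable]: "laplace_density \<in> borel_measurable borel"
  unfolding laplace_density_def by measurable

text \<open>Integrals against the Laplace distribution are treated as two integrals over the half line, the left one
being reflected.\<close>

lemma has_integral_split:
  assumes r: "has_bochner_integral lborel (\<lambda>x. indicator {0..} x * (exp (- lr * x) * F x)) A"
    and l: "has_bochner_integral lborel (\<lambda>x. indicator {0..} x * (exp (- ll * x) * F (- x))) B"
    and [measurable]: "F \<in> borel_measurable borel"
  shows "has_bochner_integral lborel (\<lambda>x. laplace_density x * F x) ((A + B) / s)"
proof -
  have "has_bochner_integral lborel (\<lambda>x. indicator {0..} (- x) * (exp (- ll * (- x)) * F (- (- x)))) B"
    using l lborel_has_bochner_integral_real_affine_iff[of "-1" "\<lambda>x. indicator {0..} x * (exp (- ll * x) * F (- x))" B 0]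
    by simp
  then have "has_bochner_integral lborel (\<lambda>x. 1 / s * (indicator {0..} x * (exp (- lr * x) * F x) +
      indicator {0..} (- x) * (exp (- ll * (- x)) * F (- (- x))))) (1 / s * (A + B))"
    using r by (intro has_bochner_integral_mult_right has_bochner_integral_add)
  moreover have "AE x in lborel. 1 / s * (indicator {0..} x * (exp (- lr * x) * F x) +
      indicator {0..} (- x) * (exp (- ll * (- x)) * F (- (- x)))) = laplace_density x * F x"
    using AE_lborel_singleton[of 0] by eventually_elim (auto simp: density_cases indicator_def)
  ultimately show ?thesis
    by (subst (asm) has_bochner_integral_cong_AE) auto
qed

lemma integrable_split:
  assumes int: "integrable lborel (\<lambda>x. laplace_density x * F x)" and [measurable]: "F \<in> borel_measurable borel"
  shows "integrable lborel (\<lambda>x. indicator {0..} x * (exp (- lr * x) * F x))"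
    "integrable lborel (\<lambda>x. indicator {0..} x * (exp (- ll * x) * F (- x)))"
proof -
  have "integrable lborel (\<lambda>x. s * (indicator {0..} x *\<^sub>R (laplace_density x * F x)))"
    using int by (intro integrable_mult_right integrable_mult_indicator) auto
  moreover have "s * (indicator {0..} x *\<^sub>R (laplace_density x * F x)) = indicator {0..} x * (exp (- lr * x) * F x)" for x
    using s_pos by (auto simp: density_cases indicator_def)
  ultimately show "integrable lborel (\<lambda>x. indicator {0..} x * (exp (- lr * x) * F x))" by (simp only:)
  have "integrable lborel (\<lambda>x. s * (indicator {..0} x *\<^sub>R (laplace_density x * F x)))"
    using int by (intro integrable_mult_right integrable_mult_indicator) auto
  then have "integrable lborel (\<lambda>x. s * (indicator {..0} (- x) *\<^sub>R (laplace_density (- x) * F (- x))))"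
    using lborel_integrable_real_affine[of "\<lambda>x. s * (indicator {..0} x *\<^sub>R (laplace_density x * F x))" "-1" 0]
    by simp
  moreover have "AE x in lborel. s * (indicator {..0} (- x) *\<^sub>R (laplace_density (- x) * F (- x))) =
      indicator {0..} x * (exp (- ll * x) * F (- x))"
    using AE_lborel_singleton[of 0]
    by eventually_elim (use s_pos in \<open>auto simp: density_cases indicator_def\<close>)
  ultimately show "integrable lborel (\<lambda>x. indicator {0..} x * (exp (- ll * x) * F (- x)))"
    by (subst (asm) integrable_cong_AE) auto
qed

lemma density_moment:
  "has_bochner_integral lborel (\<lambda>x. laplace_density x * x ^ i)
    (fact i * ((1 / lr) ^ (i + 1) + (- 1) ^ i * (1 / ll) ^ (i + 1)) / s)"
proof -
  have r: "has_bochner_integral lborel (\<lambda>x. indicator {0..} x * (exp (- lr * x) * x ^ i)) (fact i / lr ^ (i + 1))"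
    using rates_pos(1) by (rule half_line_exp_moment)
  have "has_bochner_integral lborel (\<lambda>x. (- 1) ^ i * (indicator {0..} x * (exp (- ll * x) * x ^ i)))
      ((- 1) ^ i * (fact i / ll ^ (i + 1)))"
    using rates_pos(2) by (intro has_bochner_integral_mult_right half_line_exp_moment)
  moreover have "(- 1) ^ i * (indicator {0..} x * (exp (- ll * x) * x ^ i)) =
      indicator {0..} x * (exp (- ll * x) * (- x) ^ i)" for x :: real
    by (subst (2) power_minus) (simp add: mult_ac)
  ultimately have l: "has_bochner_integral lborel (\<lambda>x. indicator {0..} x * (exp (- ll * x) * (- x) ^ i))
      ((- 1) ^ i * (fact i / ll ^ (i + 1)))" by (simp only:)
  have "(fact i / lr ^ (i + 1) + (- 1) ^ i * (fact i / ll ^ (i + 1))) / s =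
      fact i * ((1 / lr) ^ (i + 1) + (- 1) ^ i * (1 / ll) ^ (i + 1)) / s"
    by (simp add: power_divide distrib_left)
  moreover have "(\<lambda>x::real. x ^ i) \<in> borel_measurable borel" by measurable
  ultimately show ?thesis using has_integral_split[OF r l] by (simp only:)
qed

lemma AL_eq: "asym_laplace a b = density lborel (\<lambda>x. ennreal (laplace_density x))"
  by (simp add: asym_laplace_def laplace_density_def)

lemma integral_AL:
  assumes [measurable]: "F \<in> borel_measurable borel"
  shows "integrable (asym_laplace a b) F \<longleftrightarrow> integrable lborel (\<lambda>x. laplace_density x * F x)"
    "(\<integral>x. F x \<partial>asym_laplace a b) = (\<integral>x. laplace_density x * F x \<partial>lborel)"
proof -
  show "integrable (asym_laplace a b) F \<longleftrightarrow> integrable lborel (\<lambda>x. laplace_density x * F x)"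
    unfolding AL_eq by (rule integrable_real_density) (auto simp: density_nonneg)
  show "(\<integral>x. F x \<partial>asym_laplace a b) = (\<integral>x. laplace_density x * F x \<partial>lborel)"
    unfolding AL_eq by (rule integral_real_density) (auto simp: density_nonneg)
qed

lemma real_distribution_AL: "real_distribution (asym_laplace a b)"
proof -
  have "fact 0 * ((1 / lr) ^ (0 + 1) + (- 1) ^ 0 * (1 / ll) ^ (0 + 1)) / s = 1"
    unfolding inverse_rates using s_pos by (simp add: field_simps)
  from density_moment[of 0, unfolded this] have "has_bochner_integral lborel laplace_density 1"
    by simp
  then have "emeasure (asym_laplace a b) (space (asym_laplace a b)) = 1"
    unfolding AL_eq using density_nonneg
    by (simp add: emeasure_density nn_integral_eq_integral has_bochner_integral_iff)
  then show ?thesis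
    by (auto simp: real_distribution_def real_distribution_axioms_def AL_eq intro: prob_spaceI)
qed

lemma mean_variance_AL: "mean_variance (asym_laplace a b) (\<lambda>x. x) a (b\<^sup>2 + a\<^sup>2)"
proof -
  interpret AL: real_distribution "asym_laplace a b" by (rule real_distribution_AL)
  have 1: "has_bochner_integral lborel (\<lambda>x. laplace_density x * x) a"
  proof -
    have "fact 1 * ((1 / lr) ^ (1 + 1) + (- 1) ^ 1 * (1 / ll) ^ (1 + 1)) / s = a"
      unfolding inverse_rates using s_pos by (simp add: field_simps power2_eq_square)
    from density_moment[of 1, unfolded this] show ?thesis by simp
  qed
  have 2: "has_bochner_integral lborel (\<lambda>x. laplace_density x * x\<^sup>2) (b\<^sup>2 + 2 * a\<^sup>2)"
  proof -
    have "fact 2 * ((1 / lr) ^ (2 + 1) + (- 1) ^ 2 * (1 / ll) ^ (2 + 1)) / s = (s\<^sup>2 + 3 * a\<^sup>2) / 2"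
      unfolding inverse_rates using s_pos by (simp add: field_simps power2_eq_square power3_eq_cube)
    also have "\<dots> = b\<^sup>2 + 2 * a\<^sup>2" by (simp add: s2)
    finally have e: "fact 2 * ((1 / lr) ^ (2 + 1) + (- 1) ^ 2 * (1 / ll) ^ (2 + 1)) / s = b\<^sup>2 + 2 * a\<^sup>2" .
    from density_moment[of 2, unfolded e] show ?thesis .
  qed
  have i: "integrable (asym_laplace a b) (\<lambda>x. x)" "integrable (asym_laplace a b) (\<lambda>x. x\<^sup>2)"
    and E: "AL.expectation (\<lambda>x. x) = a" "AL.expectation (\<lambda>x. x\<^sup>2) = b\<^sup>2 + 2 * a\<^sup>2"
    using 1 2 by (auto simp: integral_AL has_bochner_integral_iff)
  have V: "AL.variance (\<lambda>x. x) = b\<^sup>2 + a\<^sup>2" using AL.variance_eq[OF i] E by simp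
  show ?thesis
  proof (intro mean_variance.intro mean_variance_axioms.intro)
    show "prob_space (asym_laplace a b)" by unfold_locales
    show "a\<^sup>2 < b\<^sup>2 + a\<^sup>2" using b by simp
    show "(\<lambda>x. x) \<in> borel_measurable (asym_laplace a b)" by simp
  qed (rule i E V)+
qed

text \<open>Two integrations by parts on each half line turn the integral of \<open>f''\<close> into integrals of
\<open>f\<close> and \<open>f'\<close>. The boundary terms with \<open>f' 0\<close> cancel because the
density is continuous, those with \<open>f 0\<close> add up to \<open>- f 0\<close> because its mass is
one, and the rate equations match the remaining coefficients.\<close>

lemma fixed_point_AL: "asym_equilibrium (asym_laplace a b) (\<lambda>x. x) (asym_laplace a b) (\<lambda>x. x)"
  unfolding asym_equilibrium_def
proof (intro conjI allI impI)
  interpret AL: mean_variance "asym_laplace a b" "\<lambda>x. x" a "b\<^sup>2 + a\<^sup>2" by (rule mean_variance_AL)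
  show "prob_space (asym_laplace a b)" by unfold_locales
  show "(\<lambda>x. x) \<in> borel_measurable (asym_laplace a b)" by simp
  fix f :: "real \<Rightarrow> real"
  assume df: "\<forall>x. f differentiable at x" and lf: "locally_abs_cont f" and lf': "locally_abs_cont (deriv f)"
    and i0: "integrable (asym_laplace a b) (\<lambda>x. f x)" and i1: "integrable (asym_laplace a b) (\<lambda>x. deriv f x)"
    and i2: "integrable (asym_laplace a b) (\<lambda>x. deriv (deriv f) x)"
  let ?R = "\<lambda>F. \<integral>x. indicator {0..} x * (exp (- lr * x) * F x) \<partial>lborel"
  let ?L = "\<lambda>F. \<integral>x. indicator {0..} x * (exp (- ll * x) * F (- x)) \<partial>lborel"
  have [measurable]: "f \<in> borel_measurable borel"
    using lf by (intro borel_measurable_continuous_onI locally_abs_cont_continuous)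
  have [measurable]: "deriv f \<in> borel_measurable borel" "deriv (deriv f) \<in> borel_measurable borel"
    using lf lf' by (auto intro!: borel_measurable_deriv locally_abs_cont_continuous)
  have h: "integrable lborel (\<lambda>x. indicator {0..} x * (exp (- lr * x) * F x))"
    "integrable lborel (\<lambda>x. indicator {0..} x * (exp (- ll * x) * F (- x)))"
    "(\<integral>x. F x \<partial>asym_laplace a b) = (?R F + ?L F) / s"
    if "integrable (asym_laplace a b) F" and F[measurable]: "F \<in> borel_measurable borel" for F
  proof -
    have "integrable lborel (\<lambda>x. laplace_density x * F x)" using that by (simp add: integral_AL)
    from integrable_split[OF this F]
    show *: "integrable lborel (\<lambda>x. indicator {0..} x * (exp (- lr * x) * F x))"
      "integrable lborel (\<lambda>x. indicator {0..} x * (exp (- ll * x) * F (- x)))" .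
    have "has_bochner_integral lborel (\<lambda>x. laplace_density x * F x) ((?R F + ?L F) / s)"
      using * by (intro has_integral_split F) (simp_all add: has_bochner_integral_iff)
    then show "(\<integral>x. F x \<partial>asym_laplace a b) = (?R F + ?L F) / s"
      by (simp add: integral_AL has_bochner_integral_iff)
  qed
  have D1: "(f has_real_derivative deriv f x) (at x)" for x using df by (simp add: DERIV_deriv_iff_real_differentiable)
  have D2: "AE x in lborel. (deriv f has_real_derivative deriv (deriv f) x) (at x)"
    using locally_abs_cont_AE_differentiable[OF lf']
    by eventually_elim (simp add: DERIV_deriv_iff_real_differentiable)
  have chain: "((\<lambda>x. g (- x)) has_real_derivative - d) (at x)" if "(g has_real_derivative d) (at (- x))" for g d and x :: real
  proof -
    have "(uminus has_real_derivative - 1) (at x)" by (auto intro!: derivative_eq_intros)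
    from DERIV_chain2[where f = g and g = uminus, OF that this] show ?thesis by simp
  qed
  have lrefl: "locally_abs_cont (\<lambda>x. g (- x))" if "locally_abs_cont g" for g
    using locally_abs_cont_scale[OF that, of "-1"] by simp
  have D2': "AE x in lborel. (deriv f has_real_derivative deriv (deriv f) (- x)) (at (- x))"
  proof -
    have "AE x in distr lborel borel uminus. deriv f differentiable (at x)"
      using locally_abs_cont_AE_differentiable[OF lf'] by (subst lborel_distr_uminus)
    then have "AE x in lborel. deriv f differentiable (at (- x))"
      using borel_set_differentiable[OF locally_abs_cont_continuous[OF lf']]
      by (subst (asm) AE_distr_iff) auto
    then show ?thesis by eventually_elim (simp add: DERIV_deriv_iff_real_differentiable)
  qed
  note m = \<open>f \<in> borel_measurable borel\<close> \<open>deriv f \<in> borel_measurable borel\<close> \<open>deriv (deriv f) \<in> borel_measurable borel\<close>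
  note h0 = h[OF i0 m(1)] and h1 = h[OF i1 m(2)] and h2 = h[OF i2 m(3)]
  have R1: "?R (deriv f) = - f 0 + lr * ?R f"
    by (rule half_line_by_parts[OF lf _ h0(1) h1(1)]) (use D1 in auto)
  have R2: "?R (deriv (deriv f)) = - deriv f 0 + lr * ?R (deriv f)"
    by (rule half_line_by_parts[OF lf' D2 h1(1) h2(1)])
  have L1: "- ?L (deriv f) = - f 0 + ll * ?L f"
  proof -
    have "(\<integral>x. indicator {0..} x * (exp (- ll * x) * - deriv f (- x)) \<partial>lborel) = - f (- 0) + ll * ?L f"
      by (rule half_line_by_parts[OF lrefl[OF lf] _ h0(2)]) (use D1 chain h1(2) in auto)
    then show ?thesis by simp
  qed
  have L2: "- ?L (deriv (deriv f)) = - deriv f 0 + ll * ?L (deriv f)"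
  proof -
    have "AE x in lborel. ((\<lambda>x. deriv f (- x)) has_real_derivative - deriv (deriv f) (- x)) (at x)"
      using D2' by eventually_elim (rule chain)
    then have "(\<integral>x. indicator {0..} x * (exp (- ll * x) * - deriv (deriv f) (- x)) \<partial>lborel) =
        - deriv f (- 0) + ll * ?L (deriv f)"
      by (rule half_line_by_parts[OF lrefl[OF lf'] _ h1(2)]) (use h2(2) in auto)
    then show ?thesis by simp
  qed
  have key: "b\<^sup>2 / 2 * (?R (deriv (deriv f)) + ?L (deriv (deriv f))) =
      ?R f + ?L f - f 0 * s - a * (?R (deriv f) + ?L (deriv f))"
  proof -
    have "?R f = (?R (deriv f) + f 0) * (1 / lr)" "?L f = (f 0 - ?L (deriv f)) * (1 / ll)"
      using R1 L1 rates_pos by (auto simp: field_simps)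
    moreover have "?R (deriv (deriv f)) + ?L (deriv (deriv f)) = lr * ?R (deriv f) - ll * ?L (deriv f)"
      using R2 L2 by linarith
    moreover have "b\<^sup>2 / 2 * (lr * x - ll * y) = (1 / lr - a) * x - (1 / ll + a) * y" for x y
      unfolding rate_equations[symmetric] by (simp add: algebra_simps)
    moreover have "(1 / lr - a) * x - (1 / ll + a) * y = (x + z) * (1 / lr) + (z - y) * (1 / ll) - z * s - a * (x + y)" for x y z
      unfolding inverse_rates by (simp add: field_simps)
    ultimately show ?thesis by simp
  qed
  have "b\<^sup>2 / 2 * AL.expectation (\<lambda>x. deriv (deriv f) x) =
      AL.expectation f - f 0 - a * AL.expectation (deriv f)"
  proof -
    have "c * (x2 / s) = x0 / s - f 0 - a * (x1 / s)" if "c * x2 = x0 - f 0 * s - a * x1" for c x0 x1 x2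
    proof -
      have "c * (x2 / s) = (x0 - f 0 * s - a * x1) / s" using that by simp
      then show ?thesis using s_pos by (simp add: diff_divide_distrib)
    qed
    from this[OF key] show ?thesis unfolding h0(3) h1(3) h2(3) .
  qed
  also have "\<dots> = AL.expectation (\<lambda>x. f x - f 0 - a * deriv f x)"
    using i0 i1 by (simp add: AL.prob_space)
  finally show "(AL.variance (\<lambda>x. x) - (AL.expectation (\<lambda>x. x))\<^sup>2) / 2 *
         AL.expectation (\<lambda>x. deriv (deriv f) x) =
       AL.expectation (\<lambda>x. f x - f 0 - AL.expectation (\<lambda>x. x) * deriv f x)"
    unfolding AL.variance unfolding AL.mean by simp
qed

end

text \<open>For a fixed point the formula for the characteristic function becomes a linear equation for \<open>char
\<mu> t\<close>.\<close>

lemma fixed_point_char: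
  assumes "equilibrium_variable \<mu> (\<lambda>x. x) a s2 \<mu> (\<lambda>x. x)" "real_distribution \<mu>" "t \<noteq> 0"
  shows "char \<mu> t = 2 / (complex_of_real (t\<^sup>2 * (s2 - a\<^sup>2) + 2) - 2 * complex_of_real a * \<i> * complex_of_real t)"
proof -
  interpret equilibrium_variable \<mu> "\<lambda>x. x" a s2 \<mu> "\<lambda>x. x" by fact
  interpret D: real_distribution \<mu> by fact
  have "distr \<mu> borel (\<lambda>x. x) = \<mu>" by (rule distr_id2) simp
  with char_WA[OF assms(3)] have eq: "char \<mu> t =
    2 * (1 + (complex_of_real a * \<i> * complex_of_real t - 1) * char \<mu> t) / complex_of_real (t\<^sup>2 * (s2 - a\<^sup>2))" by simp
  define d where "d = t\<^sup>2 * (s2 - a\<^sup>2)"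
  have d: "0 < d" using assms(3) gap_pos by (simp add: d_def)
  then have "complex_of_real d \<noteq> 0" by simp
  then have "char \<mu> t * complex_of_real d = 2 * (1 + (complex_of_real a * \<i> * complex_of_real t - 1) * char \<mu> t)"
    using eq unfolding d_def[symmetric] by (metis nonzero_divide_eq_eq)
  then have "char \<mu> t * (complex_of_real (d + 2) - 2 * complex_of_real a * \<i> * complex_of_real t) = 2"
    by (simp add: algebra_simps)
  moreover have "Re (complex_of_real (d + 2) - 2 * complex_of_real a * \<i> * complex_of_real t) = d + 2" by simp
  then have "complex_of_real (d + 2) - 2 * complex_of_real a * \<i> * complex_of_real t \<noteq> 0"
    using d by (metis zero_complex.simps(1) add_pos_pos less_irrefl zero_less_numeral)
  ultimately show ?thesis unfolding d_def[symmetric] by (simp add: eq_divide_eq)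
qed

theorem fixed_point_unique:
  assumes "equilibrium_variable \<mu> (\<lambda>x. x) a s2 \<mu> (\<lambda>x. x)" "real_distribution \<mu>"
    and "equilibrium_variable \<nu> (\<lambda>x. x) a s2 \<nu> (\<lambda>x. x)" "real_distribution \<nu>"
  shows "\<mu> = \<nu>"
proof (rule Levy_uniqueness[OF assms(2,4)])
  show "char \<mu> = char \<nu>"
  proof
    fix t show "char \<mu> t = char \<nu> t"
      using fixed_point_char[OF assms(1,2), of t] fixed_point_char[OF assms(3,4), of t]
        real_distribution.char_zero[OF assms(2)] real_distribution.char_zero[OF assms(4)]
      by (cases "t = 0") auto
  qed
qed


section \<open>The asymmetric equilibrium transformation\<close>

theorem proposition3p2:
  fixes M :: "'a measure" and W :: "'a \<Rightarrow> real"
    and N :: "'b measure" and WA :: "'b \<Rightarrow> real"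
    and a \<sigma> :: real
  assumes "prob_space M" and "W \<in> borel_measurable M"
    and "has_mean_variance M W a (\<sigma>\<^sup>2)"
    and "0 < \<sigma>\<^sup>2" and "a\<^sup>2 < \<sigma>\<^sup>2"
    and "asym_equilibrium M W N WA"
  shows
    "let p = (\<lambda>w. 2 / (\<sigma>\<^sup>2 - a\<^sup>2) *
                (a * measure M {x \<in> space M. W x \<le> w}
                 - (LBINT v:{0..1}. (\<integral>x. W x * indicator {y. y \<le> w / v} (W x) \<partial>M))))
     in
     \<comment> \<open>(i)\<close>
     (\<forall>\<mu>. real_distribution \<mu> \<and> has_mean_variance \<mu> (\<lambda>w. w) a (\<sigma>\<^sup>2) \<and>
            asym_equilibrium \<mu> (\<lambda>w. w) \<mu> (\<lambda>w. w)
          \<longleftrightarrow> \<mu> = asym_laplace a (sqrt (\<sigma>\<^sup>2 - a\<^sup>2))) \<and>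
     \<comment> \<open>(ii)\<close>
     (\<exists>!\<mu>. real_distribution \<mu> \<and> asym_equilibrium M W \<mu> (\<lambda>w. w)) \<and>
     absolutely_continuous lborel (distr N borel WA) \<and>
     (\<forall>w. 0 \<le> p w) \<and>
     distributed N lborel WA (\<lambda>w. ennreal (p w)) \<and>
     (\<forall>w. p w = 2 / (\<sigma>\<^sup>2 - a\<^sup>2) *
            ((LBINT v:{0..1}. (\<integral>x. W x * indicator {y. y > w / v} (W x) \<partial>M))
             - a * measure M {x \<in> space M. W x > w})) \<and>
     \<comment> \<open>(iii)\<close>
     (\<bar>support_inf M W\<bar> \<noteq> \<infinity> \<and> \<bar>support_sup M W\<bar> \<noteq> \<infinity> \<longrightarrow>
        rv_support N WA = support_hull M W) \<and>
     (a = 0 \<longrightarrow> rv_support N WA = support_hull M W) \<and>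
     (rv_support N WA = support_hull M W \<longleftrightarrow>
        (\<forall>u w. u < w \<and> {u<..<w} \<subseteq> support_hull M W \<longrightarrow> (\<exists>x\<in>{u<..<w}. p x \<noteq> 0))) \<and>
     rv_support N WA \<subseteq> support_hull M W \<and>
     (0 \<le> a \<longrightarrow> rv_support N WA \<inter> {..<0} = support_hull M W \<inter> {..<0}) \<and>
     (a \<le> 0 \<longrightarrow> rv_support N WA \<inter> {0<..} = support_hull M W \<inter> {0<..}) \<and>
     (\<forall>C>0. (AE x in M. \<bar>W x\<bar> \<le> C) \<longrightarrow> (AE y in N. \<bar>WA y\<bar> \<le> C)) \<and>
     \<comment> \<open>(iv)\<close>
     (\<forall>c. asym_equilibrium M (\<lambda>x. c * W x) N (\<lambda>y. c * WA y)) \<and>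
     \<comment> \<open>(v)\<close>
     (\<forall>r::nat. integrable M (\<lambda>x. \<bar>W x\<bar> ^ (r + 2)) \<longrightarrow>
        integrable N (\<lambda>y. WA y ^ r) \<and>
        prob_space.expectation N (\<lambda>y. WA y ^ r) =
          (2 * prob_space.expectation M (\<lambda>x. W x ^ (r + 2))
           - 2 * a * (real r + 2) * prob_space.expectation M (\<lambda>x. W x ^ (r + 1)))
          / ((real r + 1) * (real r + 2) * (\<sigma>\<^sup>2 - a\<^sup>2))) \<and>
     (\<forall>r\<ge>0. integrable M (\<lambda>x. \<bar>W x\<bar> powr (r + 2)) \<longrightarrow>
        integrable N (\<lambda>y. \<bar>WA y\<bar> powr r) \<and>
        prob_space.expectation N (\<lambda>y. \<bar>WA y\<bar> powr r) =
          (2 * prob_space.expectation M (\<lambda>x. \<bar>W x\<bar> powr (r + 2))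
           - 2 * a * (r + 2) * prob_space.expectation M (\<lambda>x. \<bar>W x\<bar> powr (r + 1) * sgn (W x)))
          / ((r + 1) * (r + 2) * (\<sigma>\<^sup>2 - a\<^sup>2))) \<and>
     \<comment> \<open>(vi)\<close>
     (\<forall>t. t \<noteq> 0 \<longrightarrow>
        char (distr N borel WA) t =
          2 * (1 + (complex_of_real a * \<i> * complex_of_real t - 1) * char (distr M borel W) t)
          / complex_of_real (t\<^sup>2 * (\<sigma>\<^sup>2 - a\<^sup>2)))"
proof -
  interpret equilibrium_variable M W a "\<sigma>\<^sup>2" N WA
    using assms unfolding has_mean_variance_def
    by (intro equilibrium_variable.intro mean_variance.intro mean_variance_axioms.intro
        equilibrium_variable_axioms.intro) auto
  let ?p = "\<lambda>w. 2 / (\<sigma>\<^sup>2 - a\<^sup>2) *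
                (a * measure M {x \<in> space M. W x \<le> w}
                 - (LBINT v:{0..1}. (\<integral>x. W x * indicator {y. y \<le> w / v} (W x) \<partial>M)))"
  have p: "?p = equilibrium_density" by (simp add: fun_eq_iff equilibrium_density_def raw_density_formula_le)
  let ?b = "sqrt (\<sigma>\<^sup>2 - a\<^sup>2)"
  have b: "0 < ?b" "?b\<^sup>2 + a\<^sup>2 = \<sigma>\<^sup>2" using gap_pos by auto
  interpret L: laplace_parameters a ?b by unfold_locales (rule b)
  have unique: "\<mu> = density lborel (\<lambda>w. ennreal (equilibrium_density w))"
    if "real_distribution \<mu>" "asym_equilibrium M W \<mu> (\<lambda>w. w)" for \<mu>
  proof -
    interpret E: equilibrium_variable M W a "\<sigma>\<^sup>2" \<mu> "\<lambda>w. w"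
      using that(2) by unfold_locales
    have "distr \<mu> borel (\<lambda>w. w) = \<mu>"
      using that(1) by (intro distr_id2) (simp add: real_distribution.events_eq_borel)
    then show ?thesis using E.distr_WA by simp
  qed
  have AL: "mean_variance (asym_laplace a ?b) (\<lambda>w. w) a (\<sigma>\<^sup>2)"
    using L.mean_variance_AL unfolding b(2) .
  have AL_eq: "equilibrium_variable (asym_laplace a ?b) (\<lambda>w. w) a (\<sigma>\<^sup>2) (asym_laplace a ?b) (\<lambda>w. w)"
    by (intro equilibrium_variable.intro AL equilibrium_variable_axioms.intro L.fixed_point_AL)
  have fixed_point: "\<forall>\<mu>. real_distribution \<mu> \<and> has_mean_variance \<mu> (\<lambda>w. w) a (\<sigma>\<^sup>2) \<and>
            asym_equilibrium \<mu> (\<lambda>w. w) \<mu> (\<lambda>w. w)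
          \<longleftrightarrow> \<mu> = asym_laplace a ?b"
  proof (intro allI iffI)
    fix \<mu> assume \<mu>: "real_distribution \<mu> \<and> has_mean_variance \<mu> (\<lambda>w. w) a (\<sigma>\<^sup>2) \<and>
            asym_equilibrium \<mu> (\<lambda>w. w) \<mu> (\<lambda>w. w)"
    then interpret D: real_distribution \<mu> by simp
    have "equilibrium_variable \<mu> (\<lambda>w. w) a (\<sigma>\<^sup>2) \<mu> (\<lambda>w. w)"
      using \<mu> D.prob_space_axioms assms(5) unfolding has_mean_variance_def
      by (intro equilibrium_variable.intro mean_variance.intro mean_variance_axioms.intro
          equilibrium_variable_axioms.intro) auto
    then show "\<mu> = asym_laplace a ?b"
      using D.real_distribution_axioms AL_eq L.real_distribution_AL by (rule fixed_point_unique)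
  next
    fix \<mu> assume "\<mu> = asym_laplace a ?b"
    then show "real_distribution \<mu> \<and> has_mean_variance \<mu> (\<lambda>w. w) a (\<sigma>\<^sup>2) \<and>
            asym_equilibrium \<mu> (\<lambda>w. w) \<mu> (\<lambda>w. w)"
      using L.real_distribution_AL L.fixed_point_AL mean_variance.integrable_W[OF AL]
        mean_variance.integrable_W2[OF AL] mean_variance.mean[OF AL] mean_variance.variance[OF AL]
      unfolding has_mean_variance_def by blast
  qed
  have exists: "\<exists>!\<mu>. real_distribution \<mu> \<and> asym_equilibrium M W \<mu> (\<lambda>w. w)"
  proof (rule ex1I)
    let ?\<mu> = "distr N borel WA"
    show "real_distribution ?\<mu> \<and> asym_equilibrium M W ?\<mu> (\<lambda>w. w)"
    proof
      show "real_distribution ?\<mu>" by (rule N.real_distribution_distr) simp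
      then interpret D: real_distribution ?\<mu> .
      show "asym_equilibrium M W ?\<mu> (\<lambda>w. w)"
        unfolding asym_equilibrium_def
      proof (intro conjI allI impI)
        fix f :: "real \<Rightarrow> real"
        assume f: "\<forall>x. f differentiable at x" "locally_abs_cont f" "locally_abs_cont (deriv f)"
          "integrable M (\<lambda>x. f (W x))" "integrable M (\<lambda>x. deriv f (W x))"
          and i: "integrable ?\<mu> (\<lambda>y. deriv (deriv f) y)"
        have m: "deriv (deriv f) \<in> borel_measurable borel"
          using borel_measurable_integrable[OF i] by simp
        have "integrable N (\<lambda>y. deriv (deriv f) (WA y))"
          using i by (subst (asm) integrable_distr_eq) (use m in auto)
        then have "(variance W - (expectation W)\<^sup>2) / 2 * N.expectation (\<lambda>y. deriv (deriv f) (WA y)) =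
            expectation (\<lambda>x. f (W x) - f 0 - expectation W * deriv f (W x))"
          using equilibrium f unfolding asym_equilibrium_def by blast
        moreover have "D.expectation (\<lambda>y. deriv (deriv f) y) = N.expectation (\<lambda>y. deriv (deriv f) (WA y))"
          using m by (intro integral_distr) auto
        ultimately show "(variance W - (expectation W)\<^sup>2) / 2 * D.expectation (\<lambda>y. deriv (deriv f) y) =
            expectation (\<lambda>x. f (W x) - f 0 - expectation W * deriv f (W x))" by (simp only:)
      qed (simp_all add: D.prob_space_axioms)
    qed
    show "\<mu> = ?\<mu>" if "real_distribution \<mu> \<and> asym_equilibrium M W \<mu> (\<lambda>w. w)" for \<mu>
      using unique that distr_WA by simp
  qed
  have ac: "absolutely_continuous lborel (distr N borel WA)"
    unfolding distr_WA by (rule absolutely_continuousI_density) simp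
  have p_upper: "equilibrium_density w = 2 / (\<sigma>\<^sup>2 - a\<^sup>2) *
            ((LBINT v:{0..1}. (\<integral>x. W x * indicator {y. y > w / v} (W x) \<partial>M))
             - a * measure M {x \<in> space M. W x > w})" for w
    by (simp add: equilibrium_density_def raw_density_formula_gt)
  have bounded_support: "rv_support N WA = support_hull M W"
    if "\<bar>support_inf M W\<bar> \<noteq> \<infinity> \<and> \<bar>support_sup M W\<bar> \<noteq> \<infinity>"
    using that by (intro support_WA_centered bounded_support_imp_centered) auto
  show ?thesis
    unfolding Let_def p
    by (intro conjI allI impI fixed_point[rule_format] exists ac equilibrium_density_nonneg distributed_WA p_upper
        support_WA_eq_iff support_WA_subset support_WA_below support_WA_above
        WA_bounded equilibrium_scale moments_nat absolute_moments char_WA)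
      (assumption | rule bounded_support, assumption | rule support_WA_centered, assumption)+
qed

end
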